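(* For every integer $t\ge -1$, neither $E_5(K_t)$ nor $E_6(K_t)$ contains a point with abscissa ($x$-coordinate) $\theta_t-1$. For every fixed positive integer $n$, only finitely many integers $t\ge -1$ are such that $E_n(K_t)$ contains a point with abscissa $\theta_t-1$.
   Context: For an integer $t\ge -1$, let $g_t(X)=X^3-tX^2-(t+3)X-1$ (irreducible over $\mathbb{Q}$ with three real roots), let $\theta_t$ be the largest real root of $g_t$, and let $K_t=\mathbb{Q}(\theta_t)$. For a positive integer $n$, $E_n$ is the elliptic curve $y^2=x^3-n^2x$ over $\mathbb{Q}$. *)

theory Defs
  imports
    Complex_Main
    "HOL-Computational_Algebra.Polynomial"
    "HOL-Algebra.Generated_Fields"
    "HOL-Algebra.Algebraic_Closure_Type"
begin

definition simplest_cubic :: "int \<Rightarrow> real poly" where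
  "simplest_cubic t = [:-1, - (of_int t + 3), - of_int t, 1:]"

definition theta :: "int \<Rightarrow> real" where
  "theta t = Max {x. poly (simplest_cubic t) x = 0}"

(* The subfield of the reals generated over the rationals by theta t; ring_of_type_algebra is
   the type class field of reals, viewed as a ring record. *)
definition cubic_field :: "int \<Rightarrow> real set" where
  "cubic_field t = generate_field (ring_of_type_algebra :: real ring) (\<rat> \<union> {theta t})"

datatype 'a curve_point = Infinity | Affine 'a 'a

(* E_n(K) for the curve y^2 = x^3 - n^2 x, with K a subfield of the reals. *)
definition curve_points :: "nat \<Rightarrow> real set \<Rightarrow> real curve_point set" where
  "curve_points n K =
     insert Infinity {Affine x y | x y. x \<in> K \<and> y \<in> K \<and> y ^ 2 = x ^ 3 - of_nat n ^ 2 * x}"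

lemma poly_simplest_cubic:
  "poly (simplest_cubic t) x = x ^ 3 - of_int t * x ^ 2 - (of_int t + 3) * x - 1"
  by (simp add: simplest_cubic_def algebra_simps power2_eq_square power3_eq_cube)

lemma finite_roots_simplest_cubic: "finite {x. poly (simplest_cubic t) x = 0}"
  by (rule poly_roots_finite) (simp add: simplest_cubic_def)

(* Max of an empty set would be unspecified; the next two lemmas show that theta t really is the
   largest real root. *)
lemma poly_simplest_cubic_theta: "poly (simplest_cubic t) (theta t) = 0"
proof -
  let ?p = "simplest_cubic t"
  have "0 < lead_coeff ?p"
    by (simp add: simplest_cubic_def)
  then obtain N where N: "\<And>x. x \<ge> N \<Longrightarrow> lead_coeff ?p \<le> poly ?p x"
    using poly_pinfty_gt_lc by blast
  define b where "b = max N 1"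
  have "poly ?p 0 < 0"
    by (simp add: simplest_cubic_def)
  moreover have "0 < poly ?p b"
    using N[of b] \<open>0 < lead_coeff ?p\<close> by (simp add: b_def)
  moreover have "0 < b"
    by (simp add: b_def)
  ultimately obtain x where "poly ?p x = 0"
    using poly_IVT_pos by blast
  then have "{x. poly ?p x = 0} \<noteq> {}"
    by blast
  from Max_in[OF finite_roots_simplest_cubic this] show ?thesis
    by (simp add: theta_def)
qed

lemma theta_greatest: "poly (simplest_cubic t) x = 0 \<Longrightarrow> x \<le> theta t"
  unfolding theta_def by (intro Max_ge finite_roots_simplest_cubic) simp

lemma subfield_cubic_field: "subfield (cubic_field t) (ring_of_type_algebra :: real ring)"
proof -
  interpret field "ring_of_type_algebra :: real ring"
    by (rule field_from_type_algebra)
  show ?thesis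
    unfolding cubic_field_def
    by (rule generate_field_is_subfield) (simp add: ring_of_type_algebra_def)
qed

end

theory Submission
  imports Defs "HOL-Computational_Algebra.Computational_Algebra"
begin

text \<open>
  Let \<open>f(x) = x\<^sup>3 - n\<^sup>2 x\<close>. If \<open>y = p(\<theta>)\<close> with \<open>p\<close> rational and \<open>y\<^sup>2 = f(\<theta> - 1)\<close>, then \<open>g\<^sub>t\<close> divides
  \<open>p\<^sup>2 - f(X - 1)\<close>. Taking norms, \<open>B A C\<close> is a square, where \<open>B = -g\<^sub>t(1)\<close>, \<open>A = -g\<^sub>t(n + 1)\<close> and
  \<open>C = -g\<^sub>t(1 - n)\<close> are linear in \<open>t\<close>. For \<open>n = 6\<close> this is impossible by congruences on the
  squarefree parts of \<open>A\<close>, \<open>B\<close>, \<open>C\<close>. For \<open>n = 5\<close> it is impossible once \<open>5\<close> does not divide \<open>B\<close>, and when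
  \<open>5\<close> divides \<open>B\<close> the polynomial \<open>g\<^sub>t\<close> splits modulo \<open>5\<close> with root \<open>-2\<close>, while \<open>f(-3) = 3\<close> is not a
  square modulo \<open>5\<close>.

  For fixed \<open>n > 3\<close> the three linear polynomials are pairwise independent, so that finiteness is
  Siegel's theorem for an elliptic curve with rational 2-torsion. It is proved by Pade
  approximation: after a shift, a large solution \<open>T\<^sub>0\<close> makes each \<open>sqrt ((T + a) (T\<^sub>0 + a))\<close> an integer for
  every further solution \<open>T\<close> in the same square classes. These integers are the coefficients in an
  interpolation problem for \<open>(T\<^sub>0 + z) powr (k + 1/2)\<close> at the three points \<open>a\<close>, and the obstructions to
  solving it in low degree are rational numbers with controlled denominators that are too small
  not to vanish. For \<open>n \<le> 2\<close> a conjugate of \<open>f(\<theta> - 1)\<close> is negative. For \<open>n = 3\<close> two of the three linear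
  polynomials coincide; there the fourth zero of \<open>p\<^sup>2 - f(X - 1)\<close> gives three rational squares in
  arithmetic progression with difference \<open>3\<close>, contradicting the fact that \<open>3\<close> is not a congruent number.
\<close>

section \<open>Hermite interpolation at integer nodes\<close>

text \<open>Size and denominator are tracked together because the contradiction in the end comes
  from comparing them. \<open>p\<close> counts the linear factors divided out so far; every further
  Taylor coefficient may cost one more factor 2 in size and one more \<open>d\<close> in the
  denominator.\<close>

definition tame :: "real \<Rightarrow> int \<Rightarrow> nat \<Rightarrow> real fps \<Rightarrow> bool" where
  "tame c d p F \<longleftrightarrow> (\<forall>h. \<bar>F $ h\<bar> \<le> c * 2 ^ (p + h) \<and> of_int d ^ (p + h) * F $ h \<in> \<int>)"

lemma tame_1: "tame 1 d 0 1"
  by (auto simp: tame_def)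

lemma inverse_linear_fps:
  fixes \<alpha> :: real
  assumes "\<alpha> \<noteq> 0"
  shows "inverse (fps_const \<alpha> + fps_X) = Abs_fps (\<lambda>h. (-1) ^ h / \<alpha> ^ Suc h)"
proof (rule fps_inverse_unique)
  show "(fps_const \<alpha> + fps_X) * Abs_fps (\<lambda>h. (-1) ^ h / \<alpha> ^ Suc h) = 1"
  proof (rule fps_ext)
    fix n
    show "((fps_const \<alpha> + fps_X) * Abs_fps (\<lambda>h. (-1) ^ h / \<alpha> ^ Suc h)) $ n = 1 $ n"
      using assms by (cases n) (auto simp: algebra_simps)
  qed
qed

lemma sum_power2_less: "(\<Sum>i\<le>h. (2::real) ^ i) \<le> 2 ^ Suc h"
  by (induction h) auto

text \<open>The inverse of \<open>\<alpha> + X\<close> has coefficients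
  \<open>(-1) ^ h / \<alpha> ^ Suc h\<close>, of size at most 1 and with denominator dividing
  \<open>d ^ Suc h\<close>. Convolution with them replaces a geometric bound by its partial sums,
  which at most doubles it; hence one step in \<open>p\<close>.\<close>

lemma tame_mult_inverse_linear:
  assumes F: "tame c d p F" and "\<alpha> \<noteq> 0" and "\<alpha> dvd d" and "c \<ge> 0"
  shows "tame c d (Suc p) (F * inverse (fps_const (of_int \<alpha>) + fps_X))"
  unfolding tame_def
proof (intro allI conjI)
  fix h
  let ?G = "\<lambda>i. (-1) ^ i / of_int \<alpha> ^ Suc i :: real"
  have nth: "(F * inverse (fps_const (of_int \<alpha>) + fps_X)) $ h = (\<Sum>i\<le>h. F $ i * ?G (h - i))"
    using assms by (simp add: inverse_linear_fps fps_mult_nth atLeast0AtMost)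
  have "1 \<le> \<bar>\<alpha>\<bar>"
    using \<open>\<alpha> \<noteq> 0\<close> by linarith
  then have ge1: "1 \<le> \<bar>real_of_int \<alpha>\<bar>"
    by linarith
  have G1: "\<bar>?G i\<bar> \<le> 1" for i
  proof -
    have "1 \<le> \<bar>real_of_int \<alpha>\<bar> ^ Suc i"
      using ge1 by (rule one_le_power)
    moreover have "\<bar>?G i\<bar> = 1 / \<bar>real_of_int \<alpha>\<bar> ^ Suc i"
      by (simp add: abs_divide power_abs abs_mult)
    ultimately show ?thesis
      by (simp add: divide_le_eq_1)
  qed
  have "\<bar>\<Sum>i\<le>h. F $ i * ?G (h - i)\<bar> \<le> (\<Sum>i\<le>h. c * 2 ^ (p + i) * 1)"
  proof (intro order_trans[OF sum_abs] sum_mono)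
    fix i
    have "\<bar>F $ i\<bar> \<le> c * 2 ^ (p + i)"
      using F by (simp add: tame_def)
    then show "\<bar>F $ i * ?G (h - i)\<bar> \<le> c * 2 ^ (p + i) * 1"
      unfolding abs_mult by (intro mult_mono G1) (use \<open>c \<ge> 0\<close> in auto)
  qed
  also have "\<dots> = c * 2 ^ p * (\<Sum>i\<le>h. 2 ^ i)"
    by (simp add: sum_distrib_left power_add mult_ac)
  also have "\<dots> \<le> c * 2 ^ p * 2 ^ Suc h"
    by (intro mult_left_mono sum_power2_less) (use \<open>c \<ge> 0\<close> in auto)
  finally show "\<bar>(F * inverse (fps_const (of_int \<alpha>) + fps_X)) $ h\<bar> \<le> c * 2 ^ (Suc p + h)"
    by (simp add: nth power_add mult_ac)
  from \<open>\<alpha> dvd d\<close> obtain e where e: "d = \<alpha> * e"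
    by blast
  have "of_int d ^ (Suc p + h) * (F $ i * ?G (h - i)) \<in> \<int>" if "i \<le> h" for i
  proof -
    have "of_int d ^ (Suc p + h) = of_int d ^ (p + i) * (of_int d ^ Suc (h - i) :: real)"
      using that by (simp flip: power_add)
    moreover have "of_int d ^ Suc (h - i) * ?G (h - i) = of_int ((-1) ^ (h - i) * e ^ Suc (h - i))"
      using \<open>\<alpha> \<noteq> 0\<close> by (simp add: e power_mult_distrib)
    ultimately have "of_int d ^ (Suc p + h) * (F $ i * ?G (h - i)) =
        (of_int d ^ (p + i) * F $ i) * of_int ((-1) ^ (h - i) * e ^ Suc (h - i))"
      by (simp only: mult.assoc mult.left_commute[of _ "F $ i"])
    moreover have "of_int d ^ (p + i) * F $ i \<in> \<int>"
      using F by (simp add: tame_def)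
    ultimately show ?thesis
      by (simp only: Ints_mult Ints_of_int)
  qed
  then show "of_int d ^ (Suc p + h) * (F * inverse (fps_const (of_int \<alpha>) + fps_X)) $ h \<in> \<int>"
    unfolding nth sum_distrib_left by (intro Ints_sum) auto
qed

lemma tame_mult_linear:
  assumes F: "tame c d p F" and "c \<ge> 0"
  shows "tame (c * (\<bar>of_int a\<bar> + 1)) d p (F * (fps_const (of_int a) + fps_X))"
  unfolding tame_def
proof (intro allI conjI)
  fix h
  have nth: "(F * (fps_const (of_int a) + fps_X)) $ h =
    F $ h * of_int a + (if h = 0 then 0 else F $ (h - 1))"
    by (simp add: algebra_simps)
  have bd: "\<bar>F $ h\<bar> \<le> c * 2 ^ (p + h)" for h
    using F by (simp add: tame_def)
  have "\<bar>if h = 0 then 0 else F $ (h - 1)\<bar> \<le> c * 2 ^ (p + h)"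
    using order_trans[OF bd[of "h - 1"], of "c * 2 ^ (p + h)"] \<open>c \<ge> 0\<close>
    by (cases h) auto
  moreover have "\<bar>F $ h * of_int a\<bar> \<le> c * 2 ^ (p + h) * \<bar>of_int a\<bar>"
    unfolding abs_mult by (intro mult_right_mono bd) auto
  ultimately have "\<bar>(F * (fps_const (of_int a) + fps_X)) $ h\<bar> \<le> c * 2 ^ (p + h) * \<bar>of_int a\<bar> + c * 2 ^ (p + h)"
    unfolding nth by (intro order_trans[OF abs_triangle_ineq] add_mono)
  then show "\<bar>(F * (fps_const (of_int a) + fps_X)) $ h\<bar> \<le> c * (\<bar>of_int a\<bar> + 1) * 2 ^ (p + h)"
    by (simp add: algebra_simps)
  have int: "of_int d ^ (p + h) * F $ h \<in> \<int>" for h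
    using F by (simp add: tame_def)
  have "of_int d ^ (p + h) * F $ (h - 1) \<in> \<int>" if "h \<noteq> 0"
  proof -
    have "of_int d ^ (p + h) * F $ (h - 1) = of_int d * (of_int d ^ (p + (h - 1)) * F $ (h - 1))"
      using that by (cases h) auto
    then show ?thesis
      using int[of "h - 1"] by (simp only: Ints_mult Ints_of_int)
  qed
  moreover have "of_int d ^ (p + h) * F $ h * of_int a \<in> \<int>"
    by (rule Ints_mult[OF int Ints_of_int])
  ultimately have "of_int d ^ (p + h) * F $ h * of_int a +
      (if h = 0 then 0 else of_int d ^ (p + h) * F $ (h - 1)) \<in> \<int>"
    by (intro Ints_add) (simp_all split: if_split)
  moreover have "of_int d ^ (p + h) * (F * (fps_const (of_int a) + fps_X)) $ h =
      of_int d ^ (p + h) * F $ h * of_int a + (if h = 0 then 0 else of_int d ^ (p + h) * F $ (h - 1))"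
    by (simp add: nth algebra_simps)
  ultimately show "of_int d ^ (p + h) * (F * (fps_const (of_int a) + fps_X)) $ h \<in> \<int>"
    by (rule ssubst[rotated])
qed

text \<open>The Taylor expansion at \<open>a\<close> of the product of the \<open>z - c\<close> over
  the other nodes, in the local variable \<open>z - a\<close>.\<close>

definition local_factor :: "int set \<Rightarrow> int \<Rightarrow> real fps" where
  "local_factor S a = (\<Prod>c\<in>S - {a}. fps_const (of_int (a - c)) + fps_X)"

lemma tame_inverse_local_factor:
  assumes "finite S" "\<And>c. c \<in> S - {a} \<Longrightarrow> a - c dvd d"
  shows "tame 1 d (m * card (S - {a})) (inverse (local_factor S a) ^ m)"
proof -
  have step: "tame 1 d (p + card B) (F * inverse (\<Prod>c\<in>B. fps_const (of_int (a - c)) + fps_X))"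
    if "finite B" "B \<subseteq> S - {a}" "tame 1 d p F" for B p F
    using that
  proof (induction B arbitrary: F p rule: finite_induct)
    case (insert b B)
    have "tame 1 d (Suc p) (F * inverse (fps_const (of_int (a - b)) + fps_X))"
      using insert assms by (intro tame_mult_inverse_linear) auto
    from insert.IH[OF _ this] insert show ?case
      by (simp add: fps_inverse_mult mult_ac)
  qed auto
  show ?thesis
  proof (induction m)
    case (Suc m)
    from step[OF _ _ this, of "S - {a}"] show ?case
      using \<open>finite S\<close> by (simp add: local_factor_def mult_ac add_ac)
  qed (simp add: tame_1)
qed

lemma local_factor_nth_0: "finite S \<Longrightarrow> local_factor S a $ 0 \<noteq> 0"
proof -
  assume "finite S"
  have "(\<Prod>c\<in>B. fps_const (real_of_int (a - c)) + fps_X) $ 0 = (\<Prod>c\<in>B. of_int (a - c))" for B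
    by (induction B rule: infinite_finite_induct) auto
  then show ?thesis
    using \<open>finite S\<close> by (auto simp: local_factor_def simp del: of_int_diff)
qed

section \<open>Taylor expansions of polynomials at a node\<close>

lemma pcompose_power: "pcompose (p ^ n) q = pcompose p q ^ n" for p q :: "'a::comm_semiring_1 poly"
  by (induction n) (simp_all add: pcompose_mult pcompose_1)

text \<open>The Taylor expansion at \<open>a\<close>, taken as a power series so that it can be
  multiplied by inverses of local factors.\<close>

definition jet :: "real \<Rightarrow> real poly \<Rightarrow> real fps" where
  "jet a P = fps_of_poly (pcompose P [:a, 1:])"

lemma jet_mult: "jet a (P * Q) = jet a P * jet a Q"
  by (simp add: jet_def pcompose_mult fps_of_poly_mult)

lemma jet_add: "jet a (P + Q) = jet a P + jet a Q"
  by (simp add: jet_def pcompose_add fps_of_poly_add)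

lemma jet_diff: "jet a (P - Q) = jet a P - jet a Q"
  by (simp add: jet_def pcompose_diff fps_of_poly_diff)

lemma jet_smult: "jet a (smult c P) = fps_const c * jet a P"
  by (simp add: jet_def pcompose_smult fps_of_poly_smult)

lemma jet_linear: "jet a [:b, 1:] = fps_const (a + b) + fps_X"
  by (simp add: jet_def pcompose_pCons fps_of_poly_pCons add.commute)

lemma jet_0: "jet a 0 = 0"
  by (simp add: jet_def)

lemma jet_1: "jet a 1 = 1"
  by (simp add: jet_def pcompose_1)

lemma jet_power: "jet a (P ^ n) = jet a P ^ n"
  by (induction n) (simp_all add: jet_1 jet_mult)

lemma jet_sum: "jet a (\<Sum>i\<in>I. f i) = (\<Sum>i\<in>I. jet a (f i))"
  by (induction I rule: infinite_finite_induct) (simp_all add: jet_0 jet_add)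

lemma jet_prod: "jet a (\<Prod>i\<in>I. f i) = (\<Prod>i\<in>I. jet a (f i))"
  by (induction I rule: infinite_finite_induct) (simp_all add: jet_1 jet_mult)

lemma jet_pderiv: "jet a (pderiv P) = fps_deriv (jet a P)"
  by (simp add: jet_def pderiv_pcompose pderiv_pCons flip: fps_of_poly_pderiv)

lemma power_dvd_of_jet:
  assumes "\<And>h. h < m \<Longrightarrow> jet a P $ h = 0"
  shows "[:-a, 1:] ^ m dvd P"
proof -
  have "monom 1 m dvd pcompose P [:a, 1:]"
    using assms by (auto simp: monom_1_dvd_iff' jet_def)
  then obtain Q where "pcompose P [:a, 1:] = monom 1 m * Q"
    by blast
  then have "pcompose (pcompose P [:a, 1:]) [:-a, 1:] = pcompose (monom 1 m) [:-a, 1:] * pcompose Q [:-a, 1:]"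
    by (simp only: pcompose_mult)
  moreover have "pcompose (monom 1 m) [:-a, 1:] = [:-a, 1:] ^ m"
  proof -
    have "pcompose [:0, 1:] [:-a, 1:] = [:-a, 1:]"
      by (simp add: pcompose_pCons)
    then show ?thesis
      unfolding monom_altdef smult_1_left pcompose_power by (rule arg_cong)
  qed
  moreover have "pcompose (pcompose P [:a, 1:]) [:-a, 1:] = P"
  proof -
    have "pcompose [:a, 1:] [:-a, 1:] = [:0, 1:]"
      by (simp add: pcompose_pCons)
    then show ?thesis
      by (metis pcompose_assoc pcompose_idR)
  qed
  ultimately show ?thesis
    by (metis dvd_triv_left)
qed

text \<open>A nonzero polynomial has at most as many zeros, with multiplicity, as its degree. The
  degree bound is expressed by coefficients so that it also makes sense for the zero
  polynomial.\<close>

lemma eq_0_if_jets_0: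
  assumes S: "finite S" and m: "m > 0"
    and deg: "\<And>l. l \<ge> card S * m \<Longrightarrow> coeff P l = 0"
    and jets: "\<And>a h. a \<in> S \<Longrightarrow> h < m \<Longrightarrow> jet (of_int a) P $ h = 0"
  shows "P = 0"
proof (rule ccontr)
  assume "P \<noteq> 0"
  have "m \<le> order (of_int a) P" if "a \<in> S" for a
    using power_dvd_of_jet[of m "of_int a" P] jets[OF that] \<open>P \<noteq> 0\<close> by (simp add: order_divides)
  then have "card S * m \<le> (\<Sum>a\<in>S. order (of_int a) P)"
    using sum_bounded_below[of S m "\<lambda>a. order (of_int a) P"] by simp
  also have "\<dots> = (\<Sum>x\<in>of_int ` S. order x P)"
    by (subst sum.reindex) (auto simp: inj_on_def)
  also have "\<dots> \<le> (\<Sum>x\<in>{x. poly P x = 0}. order x P)"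
  proof (intro sum_mono2)
    have "poly P (of_int a) = 0" if "a \<in> S" for a
      using jets[OF that m] by (simp add: jet_def)
    then show "real_of_int ` S \<subseteq> {x. poly P x = 0}"
      by auto
  qed (use \<open>P \<noteq> 0\<close> poly_roots_finite in auto)
  also have "\<dots> \<le> degree P"
    by (rule sum_order_le_degree) fact
  finally show False
    using deg[of "degree P"] \<open>P \<noteq> 0\<close> by simp
qed

text \<open>The summand for \<open>a\<close> is the product of the \<open>(z - b) ^ m\<close> over
  the other nodes, times the truncated series of \<open>\<psi> a\<close> divided by that product.
  The basis polynomials \<open>Q a * (z - a) ^ h\<close> are monic, so only \<open>h = m - 1\<close>
  reaches the top degree, which gives the last clause: the residue form for
  \<open>i = 0\<close>.\<close>

lemma hermite_interpolation:
  fixes \<psi> :: "int \<Rightarrow> real fps"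
  assumes S: "finite S" "S \<noteq> {}" and m: "m > 0"
  obtains H where "\<And>l. l \<ge> card S * m \<Longrightarrow> coeff H l = 0"
    and "\<And>a h. a \<in> S \<Longrightarrow> h < m \<Longrightarrow> jet (of_int a) H $ h = \<psi> a $ h"
    and "coeff H (card S * m - 1) = (\<Sum>a\<in>S. (\<psi> a * inverse (local_factor S a) ^ m) $ (m - 1))"
proof -
  define c where "c a h = (\<psi> a * inverse (local_factor S a) ^ m) $ h" for a h
  define Q :: "int \<Rightarrow> real poly" where "Q a = (\<Prod>b\<in>S - {a}. [:- of_int b, 1:]) ^ m" for a
  define H where "H = (\<Sum>a\<in>S. Q a * (\<Sum>h<m. smult (c a h) ([:- of_int a, 1:] ^ h)))"
  have card: "card S = Suc (card (S - {a}))" if "a \<in> S" for a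
    using S that by (metis card.remove)
  have Q_deg: "degree (Q a * [:- of_int a, 1:] ^ h) = card (S - {a}) * m + h" for a h
  proof -
    have "(\<Prod>b\<in>S - {a}. [:- real_of_int b, 1:]) \<noteq> 0"
      using S by auto
    then show ?thesis
      by (subst degree_mult_eq)
        (auto simp: Q_def degree_power_eq degree_prod_eq_sum_degree degree_linear_power)
  qed
  have Q_lead: "lead_coeff (Q a * [:- of_int a, 1:] ^ h) = 1" for a h
    by (simp add: Q_def lead_coeff_mult lead_coeff_power lead_coeff_prod)
  have coeff_H: "coeff H l = (\<Sum>a\<in>S. \<Sum>h<m. c a h * coeff (Q a * [:- of_int a, 1:] ^ h) l)" for l
    by (simp add: H_def coeff_sum sum_distrib_left)
  show ?thesis
  proof
    fix l
    assume "card S * m \<le> l"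
    then have "degree (Q a * [:- of_int a, 1:] ^ h) < l" if "a \<in> S" "h < m" for a h
      unfolding Q_deg using card[OF that(1)] that(2) by (auto simp: add_ac)
    then show "coeff H l = 0"
      unfolding coeff_H by (intro sum.neutral ballI) (auto intro!: mult_eq_0_iff[THEN iffD2] coeff_eq_0)
  next
    have "(\<Sum>h<m. c a h * coeff (Q a * [:- of_int a, 1:] ^ h) (card S * m - 1)) = c a (m - 1)"
      if "a \<in> S" for a
    proof -
      have eq: "card S * m - 1 = card (S - {a}) * m + (m - 1)"
        using m card[OF that] by simp
      have "coeff (Q a * [:- of_int a, 1:] ^ h) (card S * m - 1) = (if h = m - 1 then 1 else 0)"
        if "h < m" for h
      proof (cases "h = m - 1")
        case True
        then show ?thesis
          using Q_lead[of a h] unfolding eq Q_deg by simp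
      next
        case False
        then show ?thesis
          using that unfolding eq by (simp add: coeff_eq_0 Q_deg)
      qed
      then have "(\<Sum>h<m. c a h * coeff (Q a * [:- of_int a, 1:] ^ h) (card S * m - 1)) =
          (\<Sum>h<m. if h = m - 1 then c a h else 0)"
        by (intro sum.cong) auto
      then show ?thesis
        using m by (simp add: sum.delta')
    qed
    then show "coeff H (card S * m - 1) = (\<Sum>a\<in>S. (\<psi> a * inverse (local_factor S a) ^ m) $ (m - 1))"
      unfolding coeff_H by (simp add: c_def)
  next
    fix a h
    assume a: "a \<in> S" and h: "h < m"
    have jet_lin: "jet (real_of_int a) [:- real_of_int b, 1:] = fps_const (of_int (a - b)) + fps_X" for b
      by (simp add: jet_linear)
    have other: "jet (of_int a) (Q b * P) $ h = 0" if b: "b \<in> S" "b \<noteq> a" for b P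
    proof -
      have "Q b * P = [:- of_int a, 1:] ^ m * ((\<Prod>x\<in>S - {b} - {a}. [:- of_int x, 1:]) ^ m * P)"
      proof -
        have "(\<Prod>x\<in>S - {b}. [:- real_of_int x, 1:]) =
            [:- of_int a, 1:] * (\<Prod>x\<in>S - {b} - {a}. [:- of_int x, 1:])"
          using S a b by (intro prod.remove) auto
        then show ?thesis
          by (simp only: Q_def power_mult_distrib mult.assoc)
      qed
      then have "jet (of_int a) (Q b * P) = fps_X ^ m * jet (of_int a) ((\<Prod>x\<in>S - {b} - {a}. [:- of_int x, 1:]) ^ m * P)"
        by (simp only: jet_mult jet_power jet_linear) simp
      then show ?thesis
        using h by (simp add: fps_X_power_mult_nth)
    qed
    have "jet (of_int a) H $ h = (\<Sum>b\<in>S. jet (of_int a) (Q b * (\<Sum>h<m. smult (c b h) ([:- of_int b, 1:] ^ h))) $ h)"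
      by (simp add: H_def jet_sum fps_sum_nth)
    also have "\<dots> = jet (of_int a) (Q a * (\<Sum>h<m. smult (c a h) ([:- of_int a, 1:] ^ h))) $ h"
      using other S a by (subst sum.remove[of _ a]) auto
    also have "jet (of_int a) (Q a * (\<Sum>h<m. smult (c a h) ([:- of_int a, 1:] ^ h))) =
        local_factor S a ^ m * (\<Sum>h<m. fps_const (c a h) * fps_X ^ h)"
      unfolding Q_def jet_mult jet_power jet_sum jet_prod jet_smult jet_lin local_factor_def
      by simp
    \<comment> \<open>Truncating the cofactor at order \<open>m\<close> does not affect the
      coefficients below \<open>m\<close>.\<close>
    also have "\<dots> $ h = (local_factor S a ^ m * (\<psi> a * inverse (local_factor S a) ^ m)) $ h"
      unfolding fps_mult_nth[of "local_factor S a ^ m"]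
      using h by (intro sum.cong refl arg_cong2[where f = "(*)"])
        (auto simp: fps_sum_nth c_def if_distrib sum.delta' cong: if_cong)
    also have "local_factor S a ^ m * (\<psi> a * inverse (local_factor S a) ^ m) = \<psi> a"
    proof -
      have "local_factor S a ^ m * inverse (local_factor S a) ^ m = 1"
        using inverse_mult_eq_1'[OF local_factor_nth_0[OF S(1), of a]]
        by (simp only: power_mult_distrib[symmetric] power_one)
      then show ?thesis
        by (simp add: mult.left_commute[of _ "\<psi> a"])
    qed
    finally show "jet (of_int a) H $ h = \<psi> a $ h" .
  qed
qed

text \<open>The sum of the residues of \<open>z ^ i \<psi>(z) / (\<Prod>c\<in>S. z - c) ^ m\<close> at the points of \<open>S\<close>.\<close>

definition residue_form :: "int set \<Rightarrow> nat \<Rightarrow> nat \<Rightarrow> (int \<Rightarrow> real fps) \<Rightarrow> real" where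
  "residue_form S m i \<psi> =
    (\<Sum>a\<in>S. (\<psi> a * (inverse (local_factor S a) ^ m * (fps_const (of_int a) + fps_X) ^ i)) $ (m - 1))"

text \<open>\<open>z ^ i * P\<close> still has degree below \<open>card S * m\<close>, so it is the
  Hermite interpolant of \<open>z ^ i \<psi>\<close>, and its top coefficient is the residue
  form.\<close>

lemma residue_form_interpolant:
  assumes S: "finite S" "S \<noteq> {}" and m: "m > 0"
    and deg: "\<And>l. l + i \<ge> card S * m \<Longrightarrow> coeff P l = 0"
    and jets: "\<And>a h. a \<in> S \<Longrightarrow> h < m \<Longrightarrow> jet (of_int a) P $ h = \<psi> a $ h"
    and i: "i < card S * m"
  shows "coeff P (card S * m - Suc i) = residue_form S m i \<psi>"
proof -
  let ?x = "\<lambda>a. fps_const (real_of_int a) + fps_X"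
  obtain H where H: "\<And>l. l \<ge> card S * m \<Longrightarrow> coeff H l = 0"
    "\<And>a h. a \<in> S \<Longrightarrow> h < m \<Longrightarrow> jet (of_int a) H $ h = (\<psi> a * ?x a ^ i) $ h"
    "coeff H (card S * m - 1) =
      (\<Sum>a\<in>S. (\<psi> a * ?x a ^ i * inverse (local_factor S a) ^ m) $ (m - 1))"
    by (rule hermite_interpolation[OF S m, of "\<lambda>a. \<psi> a * ?x a ^ i"]) blast
  define R where "R = monom 1 i * P"
  have R: "jet (of_int a) R = jet (of_int a) P * ?x a ^ i" for a
    by (simp add: R_def jet_mult monom_altdef jet_power jet_linear mult_ac)
  have "R - H = 0"
  proof (rule eq_0_if_jets_0[OF S(1) m])
    fix l
    assume l: "l \<ge> card S * m"
    then have "coeff R l = 0"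
      using deg[of "l - i"] by (auto simp: R_def coeff_monom_mult)
    then show "coeff (R - H) l = 0"
      using H(1)[OF l] by simp
  next
    fix a h
    assume "a \<in> S" "h < m"
    then show "jet (of_int a) (R - H) $ h = 0"
      using jets by (auto simp: jet_diff H(2) R fps_mult_nth intro!: sum.cong)
  qed
  then have "coeff R (card S * m - 1) = coeff H (card S * m - 1)"
    by simp
  moreover have "coeff R (card S * m - 1) = coeff P (card S * m - Suc i)"
    using i by (simp add: R_def coeff_monom_mult)
  ultimately show ?thesis
    unfolding H(3) residue_form_def by (simp add: mult_ac)
qed

text \<open>An instance of the residue theorem: the degree condition says that the rational function
  decays like \<open>z ^ (-2)\<close> at infinity, so its residues sum to 0.\<close>

lemma residue_form_poly_eq_0:
  assumes S: "finite S" "S \<noteq> {}" and m: "m > 0" and i: "degree P + i + 1 < card S * m"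
  shows "residue_form S m i (\<lambda>a. jet (of_int a) P) = 0"
proof -
  have "residue_form S m i (\<lambda>a. jet (of_int a) P) = coeff P (card S * m - Suc i)"
    using i by (intro residue_form_interpolant[symmetric] S m) (auto intro: coeff_eq_0)
  also have "\<dots> = 0"
    using i by (intro coeff_eq_0) auto
  finally show ?thesis .
qed

text \<open>The degree drops one step at a time: once the top \<open>i\<close> coefficients vanish,
  the next one is the residue form with index \<open>i\<close>.\<close>

lemma interpolant_if_residue_forms_0:
  assumes S: "finite S" "S \<noteq> {}" and m: "m > 0"
    and 0: "\<And>i. i < n \<Longrightarrow> residue_form S m i \<psi> = 0" and n: "n \<le> card S * m"
  obtains P where "\<And>l. l + n \<ge> card S * m \<Longrightarrow> coeff P l = 0"
    and "\<And>a h. a \<in> S \<Longrightarrow> h < m \<Longrightarrow> jet (of_int a) P $ h = \<psi> a $ h"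
proof -
  obtain P where P: "\<And>l. l \<ge> card S * m \<Longrightarrow> coeff P l = 0"
    "\<And>a h. a \<in> S \<Longrightarrow> h < m \<Longrightarrow> jet (of_int a) P $ h = \<psi> a $ h"
    by (rule hermite_interpolation[OF S m, of \<psi>]) blast
  have "\<forall>l. l + i \<ge> card S * m \<longrightarrow> coeff P l = 0" if "i \<le> n" for i
    using that
  proof (induction i)
    case 0
    then show ?case
      using P(1) by simp
  next
    case (Suc i)
    then have "coeff P (card S * m - Suc i) = residue_form S m i \<psi>"
      using n by (intro residue_form_interpolant S m P(2)) auto
    then have *: "coeff P (card S * m - Suc i) = 0"
      using 0[of i] Suc.prems by simp
    show ?case
    proof (intro allI impI)
      fix l
      assume "card S * m \<le> l + Suc i"
      then consider "card S * m \<le> l + i" | "l = card S * m - Suc i"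
        by linarith
      then show "coeff P l = 0"
        using Suc * by cases auto
    qed
  qed
  with P(2) that show ?thesis
    by blast
qed

text \<open>The jets of \<open>(T + z) powr \<kappa>\<close>, with arbitrary constants at the nodes, satisfy
  \<open>(T + z) \<psi>' = \<kappa> \<psi>\<close>. An interpolating polynomial \<open>H\<close> of degree below \<open>card S * k\<close> then
  satisfies the equation to order \<open>k\<close> at every node, hence identically.\<close>

lemma jets_eq_0_if_interpolant:
  fixes T \<kappa> :: real
  assumes S: "finite S" and k: "k > 0" and \<kappa>: "\<And>n. \<kappa> \<noteq> of_nat n"
    and deg: "\<And>l. l \<ge> card S * k \<Longrightarrow> coeff H l = 0"
    and jets: "\<And>a h. a \<in> S \<Longrightarrow> h \<le> k \<Longrightarrow> jet (of_int a) H $ h = \<psi> a $ h"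
    and ode: "\<And>a h. a \<in> S \<Longrightarrow> h < k \<Longrightarrow> (T + of_int a) * (of_nat (Suc h) * \<psi> a $ Suc h) = (\<kappa> - of_nat h) * \<psi> a $ h"
  shows "a \<in> S \<Longrightarrow> h \<le> k \<Longrightarrow> \<psi> a $ h = 0"
proof -
  define E where "E = [:T, 1:] * pderiv H - smult \<kappa> H"
  have coeff_E: "coeff E l = T * (of_nat (Suc l) * coeff H (Suc l)) + (of_nat l - \<kappa>) * coeff H l" for l
    by (cases l) (auto simp: E_def coeff_pderiv algebra_simps coeff_pCons)
  have "E = 0"
  proof (rule eq_0_if_jets_0[OF S k])
    fix l
    assume "l \<ge> card S * k"
    then show "coeff E l = 0"
      by (simp add: coeff_E deg)
  next
    fix a h
    assume a: "a \<in> S" and h: "h < k"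
    have "jet (of_int a) E = (fps_const (T + of_int a) + fps_X) * fps_deriv (jet (of_int a) H)
        - fps_const \<kappa> * jet (of_int a) H"
      by (simp add: E_def jet_mult jet_diff jet_smult jet_linear jet_pderiv add_ac del: mult_pCons_left)
    also have "\<dots> $ h = (T + of_int a) * (of_nat (Suc h) * jet (of_int a) H $ Suc h)
        - (\<kappa> - of_nat h) * jet (of_int a) H $ h"
      by (cases h) (auto simp: algebra_simps)
    also have "\<dots> = 0"
      using ode[OF a h] jets[OF a] h by simp
    finally show "jet (of_int a) E $ h = 0" .
  qed
  \<comment> \<open>The differential operator multiplies the leading coefficient by
    \<open>degree H - \<kappa>\<close>, which is nonzero as \<open>\<kappa>\<close> is not a natural
    number.\<close>
  have "lead_coeff H = 0"
  proof -
    have "coeff E (degree H) = (of_nat (degree H) - \<kappa>) * lead_coeff H"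
      by (simp add: coeff_E coeff_eq_0)
    then show ?thesis
      using \<kappa>[of "degree H"] \<open>E = 0\<close> by auto
  qed
  then show "\<psi> a $ h = 0" if "a \<in> S" "h \<le> k"
    using jets[OF that] by (simp add: jet_0)
qed

section \<open>Approximation of half-integral powers\<close>

text \<open>For \<open>k = 0\<close> consecutive coefficients have ratio of size
  \<open>\<bar>1/2 - h\<bar> / (h + 1)\<close>, at most 1; each step in \<open>k\<close> at most
  doubles the bound by Pascal's rule.\<close>

lemma abs_gbinomial_half_le: "\<bar>(of_nat k + 1/2 :: real) gchoose h\<bar> \<le> 2 ^ k"
proof (induction k arbitrary: h)
  case 0
  have "\<bar>(1/2 :: real) gchoose h\<bar> \<le> 1"
  proof (induction h)
    case (Suc h)
    have "of_nat (Suc h) * ((1/2 :: real) gchoose Suc h) = (1/2 - of_nat h) * ((1/2) gchoose h)"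
      using gbinomial_mult_1[of "1/2 :: real" h] by (simp add: algebra_simps)
    then have "real (Suc h) * \<bar>(1/2) gchoose Suc h\<bar> = \<bar>1/2 - real h\<bar> * \<bar>(1/2) gchoose h\<bar>"
      by (metis abs_mult abs_of_nat)
    also have "\<dots> \<le> real (Suc h) * 1"
      using Suc by (intro mult_mono) auto
    finally show ?case
      by simp
  qed simp
  then show ?case by simp
next
  case (Suc k)
  show ?case
  proof (cases h)
    case (Suc j)
    have "(of_nat (Suc k) + 1/2 :: real) gchoose h = ((of_nat k + 1/2) gchoose j) + ((of_nat k + 1/2) gchoose h)"
    proof -
      have "of_nat (Suc k) + 1/2 = (of_nat k + 1/2 :: real) + 1"
        by simp
      then show ?thesis
        unfolding \<open>h = Suc j\<close> by (simp only: gbinomial_Suc_Suc)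
    qed
    then show ?thesis
      using Suc.IH[of j] Suc.IH[of h] by simp
  qed (use one_le_power[of "2 :: real" "Suc k"] in simp)
qed

text \<open>At the exponent -1/2 the scaled coefficient is, up to sign, the central binomial
  coefficient; Pascal's rule carries integrality upwards by unit steps.\<close>

lemma gbinomial_half_integral: "4 ^ h * ((of_nat k + 1/2 :: real) gchoose h) \<in> \<int>"
proof -
  have minus_half: "4 ^ h * ((-1/2 :: real) gchoose h) = (-1) ^ h * of_nat ((2 * h) choose h)" for h
  proof (induction h)
    case (Suc h)
    have central: "real (Suc h) * real ((2 * Suc h) choose Suc h) = 2 * (2 * real h + 1) * real ((2 * h) choose h)"
    proof -
      have "Suc h * ((2 * Suc h) choose Suc h) = (2 * h + 2) * ((2 * h + 1) choose h)"
        using Suc_times_binomial_eq[of "2 * h + 1" h] by (simp add: mult_ac)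
      moreover have "(2 * h + 1) choose h = (2 * h + 1) choose Suc h"
        using binomial_symmetric[of h "2 * h + 1"] by simp
      moreover have "Suc h * ((2 * h + 1) choose Suc h) = (2 * h + 1) * ((2 * h) choose h)"
        using Suc_times_binomial_eq[of "2 * h" h] by (simp add: mult_ac)
      ultimately have "Suc h * ((2 * Suc h) choose Suc h) = 2 * (2 * h + 1) * ((2 * h) choose h)"
      proof -
        assume *: "Suc h * ((2 * Suc h) choose Suc h) = (2 * h + 2) * ((2 * h + 1) choose h)"
          "(2 * h + 1) choose h = (2 * h + 1) choose Suc h"
          "Suc h * ((2 * h + 1) choose Suc h) = (2 * h + 1) * ((2 * h) choose h)"
        have "(2 * h + 2) * ((2 * h + 1) choose h) = 2 * (Suc h * ((2 * h + 1) choose h))"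
          by simp
        with * show ?thesis
          by (simp only: mult.assoc)
      qed
      from arg_cong[OF this, of real] show ?thesis
        by (simp only: of_nat_mult of_nat_add of_nat_numeral of_nat_1)
    qed
    have "real (Suc h) * ((-1/2) gchoose Suc h) = (-1/2 - real h) * ((-1/2) gchoose h)"
      using gbinomial_mult_1[of "-1/2 :: real" h] by (simp add: algebra_simps)
    then have "real (Suc h) * (4 ^ Suc h * ((-1/2) gchoose Suc h)) =
        - 2 * (2 * real h + 1) * (4 ^ h * ((-1/2) gchoose h))"
    proof -
      assume *: "real (Suc h) * ((-1/2) gchoose Suc h) = (-1/2 - real h) * ((-1/2) gchoose h)"
      have "real (Suc h) * (4 ^ Suc h * ((-1/2) gchoose Suc h)) =
          4 * 4 ^ h * (real (Suc h) * ((-1/2) gchoose Suc h))"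
        by (simp only: power_Suc mult_ac)
      also have "\<dots> = - 2 * (2 * real h + 1) * (4 ^ h * ((-1/2) gchoose h))"
        unfolding * by (simp add: field_simps)
      finally show ?thesis .
    qed
    also have "\<dots> = (-1) ^ Suc h * (2 * (2 * real h + 1) * real ((2 * h) choose h))"
      unfolding Suc by (simp add: algebra_simps)
    also have "\<dots> = real (Suc h) * ((-1) ^ Suc h * of_nat ((2 * Suc h) choose Suc h))"
      unfolding central[symmetric] by (simp only: mult.left_commute)
    finally have "real (Suc h) * (4 ^ Suc h * ((-1/2) gchoose Suc h)) =
        real (Suc h) * ((-1) ^ Suc h * of_nat ((2 * Suc h) choose Suc h))" .
    then show ?case
      by (simp only: mult_cancel_left of_nat_eq_0_iff) simp
  qed simp
  \<comment> \<open>The exponents start at \<open>f 0 = -1/2\<close>, so \<open>k + 1/2\<close> is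
    \<open>f (Suc k)\<close>.\<close>
  define f :: "nat \<Rightarrow> real" where "f n = of_nat n - 1/2" for n
  have "4 ^ h * (f n gchoose h) \<in> \<int>" for n
  proof (induction n arbitrary: h)
    case 0
    have "f 0 = -1/2"
      by (simp add: f_def)
    then show ?case
      using minus_half[of h] by simp
  next
    case (Suc n)
    show ?case
    proof (cases h)
      case (Suc j)
      have "f (Suc n) gchoose h = (f n gchoose j) + (f n gchoose h)"
      proof -
        have "f (Suc n) = f n + 1"
          by (simp add: f_def)
        then show ?thesis
          unfolding \<open>h = Suc j\<close> by (simp only: gbinomial_Suc_Suc)
      qed
      then have "4 ^ h * (f (Suc n) gchoose h) = 4 * (4 ^ j * (f n gchoose j)) + 4 ^ h * (f n gchoose h)"
        by (simp add: \<open>h = Suc j\<close> distrib_left)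
      then show ?thesis
        using Suc.IH[of j] Suc.IH[of h] by (simp only: Ints_add Ints_mult Ints_numeral)
    qed simp
  qed
  from this[of "Suc k"] show ?thesis
    by (simp add: f_def add.commute)
qed

text \<open>The Taylor polynomial at 0, of degree below \<open>N\<close>, of
  \<open>(T + z) powr (k + 1/2)\<close>.\<close>

definition half_power_poly :: "nat \<Rightarrow> nat \<Rightarrow> real \<Rightarrow> real poly" where
  "half_power_poly N k T =
    (\<Sum>l<N. monom (((of_nat k + 1/2) gchoose l) * T powr (of_nat k + 1/2 - of_nat l)) l)"

lemma degree_half_power_poly: "N > 0 \<Longrightarrow> degree (half_power_poly N k T) \<le> N - 1"
  unfolding half_power_poly_def by (intro degree_sum_le) (auto intro!: order_trans[OF degree_monom_le])

lemma jet_monom: "jet a (monom c l) $ h = c * (of_nat (l choose h) * a ^ (l - h))"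
proof (cases "h \<le> l")
  case True
  have "jet a (monom c l) $ h = c * coeff ([:a, 1:] ^ l) h"
    unfolding monom_altdef jet_smult jet_power by (simp add: jet_def pcompose_pCons fps_of_poly_power flip: fps_of_poly_nth)
  then show ?thesis
    using True by (simp add: coeff_linear_poly_power)
next
  case False
  have "jet a (monom c l) $ h = c * coeff ([:a, 1:] ^ l) h"
    unfolding monom_altdef jet_smult jet_power by (simp add: jet_def pcompose_pCons fps_of_poly_power flip: fps_of_poly_nth)
  also have "coeff ([:a, 1:] ^ l) h = 0"
    using False by (intro coeff_eq_0) (simp add: degree_linear_power)
  finally show ?thesis
    using False by (simp add: binomial_eq_0)
qed

text \<open>Maclaurin's formula with Lagrange remainder is applied to the Taylor coefficient of
  order \<open>h\<close>, as a function of the centre. Since \<open>k < N\<close> the exponent in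
  the remainder is negative, so \<open>T + x \<ge> T / 2\<close> bounds it.\<close>

lemma half_power_jet_error:
  fixes a T :: real
  assumes a: "\<bar>a\<bar> \<le> T / 2" and T: "T > 0" and h: "h < N" and kN: "k < N"
  shows "\<bar>((of_nat k + 1/2) gchoose h) * (T + a) powr (of_nat k + 1/2 - of_nat h)
      - jet a (half_power_poly N k T) $ h\<bar>
    \<le> 2 ^ k * 2 ^ N * (T / 2) powr (of_nat k + 1/2 - of_nat N) * \<bar>a\<bar> ^ (N - h)"
proof -
  define \<kappa> :: real where "\<kappa> = of_nat k + 1/2"
  \<comment> \<open>\<open>D j\<close> is the derivative of order \<open>j\<close> of \<open>x
    \<mapsto> (\<kappa> gchoose h) * (T + x) powr (\<kappa> - h)\<close>.\<close>
  define D where "D j x = (\<kappa> gchoose h) * ((fact j * ((\<kappa> - of_nat h) gchoose j)) * (T + x) powr (\<kappa> - of_nat h - of_nat j))"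
    for j x
  have deriv: "DERIV (D j) x :> D (Suc j) x" if "\<bar>x\<bar> \<le> \<bar>a\<bar>" for j x
  proof -
    have pos: "T + x > 0"
      using that a T by linarith
    have "fact (Suc j) * ((\<kappa> - of_nat h) gchoose Suc j) =
        (fact j * ((\<kappa> - of_nat h) gchoose j)) * (\<kappa> - of_nat h - of_nat j)"
      unfolding gbinomial_mult_fact by simp
    then have "D (Suc j) x = (\<kappa> gchoose h) * ((fact j * ((\<kappa> - of_nat h) gchoose j)) *
        ((\<kappa> - of_nat h - of_nat j) * (T + x) powr (\<kappa> - of_nat h - of_nat j - 1)))"
      by (simp only: D_def of_nat_Suc mult.assoc) (simp add: algebra_simps)
    moreover have "((\<lambda>x. (T + x) powr (\<kappa> - of_nat h - of_nat j)) has_real_derivative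
        (\<kappa> - of_nat h - of_nat j) * (T + x) powr (\<kappa> - of_nat h - of_nat j - 1)) (at x)"
      using pos by (auto intro!: derivative_eq_intros)
    ultimately show ?thesis
      unfolding D_def by (simp only: DERIV_cmult)
  qed
  obtain x where x: "\<bar>x\<bar> \<le> \<bar>a\<bar>"
    "D 0 a = (\<Sum>j<N - h. D j 0 / fact j * a ^ j) + D (N - h) x / fact (N - h) * a ^ (N - h)"
    using Maclaurin_bi_le[of D "D 0" "N - h" a] deriv by auto
  have D_eq: "D j y / fact j = (\<kappa> gchoose (h + j)) * of_nat ((h + j) choose h) * (T + y) powr (\<kappa> - of_nat (h + j))"
    for j y
  proof -
    have "(\<kappa> gchoose (h + j)) * of_nat ((h + j) choose h) = (\<kappa> gchoose h) * ((\<kappa> - of_nat h) gchoose j)"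
      using gbinomial_trinomial_revision[of h "h + j" \<kappa>] by (simp only: binomial_gbinomial) simp
    then show ?thesis
      by (simp add: D_def diff_diff_eq)
  qed
  have "jet a (half_power_poly N k T) $ h =
      (\<Sum>l<N. (\<kappa> gchoose l) * T powr (\<kappa> - of_nat l) * (of_nat (l choose h) * a ^ (l - h)))"
    by (simp add: half_power_poly_def jet_sum fps_sum_nth jet_monom \<kappa>_def)
  also have "\<dots> = (\<Sum>l\<in>{h..<N}. (\<kappa> gchoose l) * T powr (\<kappa> - of_nat l) * (of_nat (l choose h) * a ^ (l - h)))"
    by (intro sum.mono_neutral_right) (auto simp: binomial_eq_0)
  also have "\<dots> = (\<Sum>j<N - h. D j 0 / fact j * a ^ j)"
    by (intro sum.reindex_bij_witness[of _ "\<lambda>j. h + j" "\<lambda>l. l - h"])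
      (use h in \<open>auto simp: D_eq mult_ac\<close>)
  finally have "D 0 a - jet a (half_power_poly N k T) $ h = D (N - h) x / fact (N - h) * a ^ (N - h)"
    using x(2) by simp
  also have "\<bar>\<dots>\<bar> = \<bar>\<kappa> gchoose N\<bar> * of_nat (N choose h) * (T + x) powr (\<kappa> - of_nat N) * \<bar>a\<bar> ^ (N - h)"
    unfolding D_eq using h by (simp add: abs_mult power_abs)
  also have "\<dots> \<le> 2 ^ k * 2 ^ N * (T / 2) powr (\<kappa> - of_nat N) * \<bar>a\<bar> ^ (N - h)"
  proof (intro mult_mono)
    show "\<bar>\<kappa> gchoose N\<bar> \<le> 2 ^ k"
      unfolding \<kappa>_def by (rule abs_gbinomial_half_le)
    show "real (N choose h) \<le> 2 ^ N"
      using binomial_le_pow2[of N h] by (metis of_nat_le_iff of_nat_numeral of_nat_power)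
    have "real (Suc k) \<le> real N"
      using kN by simp
    then show "(T + x) powr (\<kappa> - real N) \<le> (T / 2) powr (\<kappa> - real N)"
      using x(1) a T by (intro powr_mono2') (auto simp: \<kappa>_def)
  qed auto
  finally show ?thesis
    by (simp add: D_def \<kappa>_def)
qed

section \<open>Size and denominators of residue forms, and the estimate at three nodes\<close>

lemma tame_mult_linear_power:
  assumes "tame c d p F" "c \<ge> 0"
  shows "tame (c * (\<bar>of_int a\<bar> + 1) ^ i) d p (F * (fps_const (of_int a) + fps_X) ^ i)"
proof (induction i)
  case (Suc i)
  from tame_mult_linear[OF this, of a] show ?case
    using \<open>c \<ge> 0\<close> by (simp add: mult_ac)
qed (use assms in simp)

lemma residue_form_weights:
  assumes "finite S" and "a \<in> S" and "\<And>c. c \<in> S - {a} \<Longrightarrow> a - c dvd d"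
  shows "tame ((\<bar>of_int a\<bar> + 1) ^ i) d (m * (card S - 1))
    (inverse (local_factor S a) ^ m * (fps_const (of_int a) + fps_X) ^ i)"
  using tame_mult_linear_power[OF tame_inverse_local_factor[of S a d m], of a i] assms
  by simp

text \<open>The coefficient of order \<open>m - 1\<close> is a convolution of \<open>m\<close> terms
  at each node; the weights are bounded by \<open>tame\<close> with total exponent below
  \<open>m * card S\<close>.\<close>

lemma residue_form_bound:
  assumes S: "finite S" and m: "m > 0" and d: "\<And>a c. a \<in> S \<Longrightarrow> c \<in> S - {a} \<Longrightarrow> a - c dvd d"
    and R: "\<And>a. a \<in> S \<Longrightarrow> \<bar>of_int a\<bar> \<le> R" and B: "\<And>a h. a \<in> S \<Longrightarrow> h < m \<Longrightarrow> \<bar>\<psi> a $ h\<bar> \<le> B"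
  shows "\<bar>residue_form S m i \<psi>\<bar> \<le> of_nat (card S) * (of_nat m * (B * ((R + 1) ^ i * 2 ^ (m * card S))))"
proof -
  let ?V = "\<lambda>a. inverse (local_factor S a) ^ m * (fps_const (real_of_int a) + fps_X) ^ i"
  have "\<bar>(\<psi> a * ?V a) $ (m - 1)\<bar> \<le> of_nat m * (B * ((R + 1) ^ i * 2 ^ (m * card S)))" if a: "a \<in> S" for a
  proof -
    have R0: "0 \<le> R"
      using R[OF a] by linarith
    have cS: "m * card S = m * (card S - 1) + m"
      using a S by (cases "card S") auto
    have V: "\<bar>?V a $ h\<bar> \<le> (R + 1) ^ i * 2 ^ (m * card S)" if "h < m" for h
    proof -
      have "\<bar>?V a $ h\<bar> \<le> (\<bar>of_int a\<bar> + 1) ^ i * 2 ^ (m * (card S - 1) + h)"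
        using residue_form_weights[OF S a d[OF a], of i m] unfolding tame_def by blast
      also have "\<dots> \<le> (R + 1) ^ i * 2 ^ (m * card S)"
        using R[OF a] R0 that unfolding cS by (intro mult_mono power_mono power_increasing) auto
      finally show ?thesis .
    qed
    have "0 \<le> B"
      using B[OF a m] by (rule order_trans[OF abs_ge_zero])
    have "\<bar>(\<psi> a * ?V a) $ (m - 1)\<bar> \<le> (\<Sum>h=0..m - 1. \<bar>\<psi> a $ h * ?V a $ (m - 1 - h)\<bar>)"
      unfolding fps_mult_nth by (rule sum_abs)
    also have "\<dots> \<le> (\<Sum>h=0..m - 1. B * ((R + 1) ^ i * 2 ^ (m * card S)))"
      unfolding abs_mult using m \<open>0 \<le> B\<close> by (intro sum_mono mult_mono B V a) auto
    also have "\<dots> = of_nat m * (B * ((R + 1) ^ i * 2 ^ (m * card S)))"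
      using m by simp
    finally show ?thesis .
  qed
  then have "(\<Sum>a\<in>S. \<bar>(\<psi> a * ?V a) $ (m - 1)\<bar>) \<le>
      of_nat (card S) * (of_nat m * (B * ((R + 1) ^ i * 2 ^ (m * card S))))"
    by (rule sum_bounded_above)
  then show ?thesis
    unfolding residue_form_def by (rule order_trans[OF sum_abs])
qed

text \<open>\<open>D\<close> clears the data; \<open>d ^ (m * card S)\<close> clears the weights, of
  which only coefficients below order \<open>m\<close> enter.\<close>

lemma residue_form_integral:
  assumes S: "finite S" and m: "m > 0" and d: "\<And>a c. a \<in> S \<Longrightarrow> c \<in> S - {a} \<Longrightarrow> a - c dvd d"
    and D: "\<And>a h. a \<in> S \<Longrightarrow> h < m \<Longrightarrow> D * \<psi> a $ h \<in> \<int>"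
  shows "D * of_int d ^ (m * card S) * residue_form S m i \<psi> \<in> \<int>"
proof -
  let ?V = "\<lambda>a. inverse (local_factor S a) ^ m * (fps_const (real_of_int a) + fps_X) ^ i"
  have "D * of_int d ^ (m * card S) * (\<psi> a * ?V a) $ (m - 1) \<in> \<int>" if a: "a \<in> S" for a
  proof -
    have cS: "m * card S = m * (card S - 1) + m"
      using a S by (cases "card S") auto
    have V: "of_int d ^ (m * card S) * ?V a $ h \<in> \<int>" if "h < m" for h
    proof -
      have "of_int d ^ (m * (card S - 1) + h) * ?V a $ h \<in> \<int>"
        using residue_form_weights[OF S a d[OF a], of i m] unfolding tame_def by blast
      then have "of_int (d ^ (m - h)) * (of_int d ^ (m * (card S - 1) + h) * ?V a $ h) \<in> \<int>"
        by (rule Ints_mult[OF Ints_of_int])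
      moreover have "of_int (d ^ (m - h)) * (of_int d ^ (m * (card S - 1) + h) * ?V a $ h) =
          of_int d ^ (m * card S) * ?V a $ h"
      proof -
        have "m * card S = (m - h) + (m * (card S - 1) + h)"
          unfolding cS using that by simp
        then show ?thesis
          by (simp only: power_add of_int_power mult.assoc)
      qed
      ultimately show ?thesis
        by (simp only:)
    qed
    have "D * of_int d ^ (m * card S) * (\<psi> a * ?V a) $ (m - 1) =
        (\<Sum>h=0..m - 1. (D * \<psi> a $ h) * (of_int d ^ (m * card S) * ?V a $ (m - 1 - h)))"
      unfolding fps_mult_nth sum_distrib_left by (intro sum.cong) (simp_all only: mult_ac)
    also have "\<dots> \<in> \<int>"
      using m by (intro Ints_sum Ints_mult D V a) auto
    finally show ?thesis .
  qed
  then show ?thesis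
    unfolding residue_form_def sum_distrib_left by (intro Ints_sum) auto
qed

text \<open>The data at \<open>a\<close> are the jets of
  \<open>(T\<^sub>0 + z) powr (k + 1/2)\<close> times \<open>sqrt (T + a)\<close>. Some residue form
  of them is nonzero with a controlled denominator, hence not too small. It would vanish if
  \<open>sqrt (T + a)\<close> were replaced by \<open>sqrt T\<close> and the power by a Taylor
  polynomial, so it is only as large as the errors of these replacements, which are the two summands
  of the conclusion.\<close>

lemma three_nodes_estimate:
  fixes S :: "int set" and R d T\<^sub>0 T :: int and k :: nat
  assumes S: "card S = 3" and R: "R \<ge> 1" "\<And>a. a \<in> S \<Longrightarrow> \<bar>a\<bar> \<le> R"
    and d: "d \<ge> 1" "\<And>a c. a \<in> S \<Longrightarrow> c \<in> S - {a} \<Longrightarrow> a - c dvd d"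
    and T\<^sub>0: "T\<^sub>0 \<ge> 2 * R" and T: "T \<ge> 2 * R" and k: "k \<ge> 1"
    and squares: "\<And>a. a \<in> S \<Longrightarrow> \<exists>s :: int. (T + a) * (T\<^sub>0 + a) = s ^ 2"
  defines "C \<equiv> 4 * d ^ 3 * 3 * (R + 1) ^ 2 * 16 * (64 * R ^ 3)"
  shows "1 \<le> of_int C ^ Suc k * sqrt (of_int T\<^sub>0) *
    (sqrt (of_int T) / of_int T\<^sub>0 ^ (2 * k) + of_int T\<^sub>0 ^ k / sqrt (of_int T))"
proof -
  \<comment> \<open>Order \<open>k + 1\<close> is matched at the nodes, because the differential
    equation loses one order.\<close>
  define m where "m = Suc k"
  define \<kappa> :: real where "\<kappa> = of_nat k + 1/2"
  define \<phi> where "\<phi> a h = (\<kappa> gchoose h) * (of_int (T\<^sub>0 + a)) powr (\<kappa> - of_nat h)" for a h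
  define \<psi> where "\<psi> a = Abs_fps (\<lambda>h. sqrt (of_int (T + a)) * \<phi> a h)" for a
  have fin: "finite S" "S \<noteq> {}"
    using S by (auto intro: card_ge_0_finite)
  have m: "m > 0"
    by (simp add: m_def)
  have pos0: "T\<^sub>0 + a \<ge> 1" and pos: "T + a \<ge> 1" if "a \<in> S" for a
    using R(2)[OF that] R(1) T\<^sub>0 T by linarith+
  have T0_pos: "real_of_int T\<^sub>0 \<ge> 1" "real_of_int T \<ge> 1"
    using T\<^sub>0 T R(1) by linarith+
  have powr_eq: "of_int (T\<^sub>0 + a) powr (\<kappa> - of_nat h) = sqrt (of_int (T\<^sub>0 + a)) * of_int (T\<^sub>0 + a) ^ (k - h)"
    if "a \<in> S" "h < m" for a h
  proof -
    have "real_of_int (T\<^sub>0 + a) > 0"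
      using pos0[OF that(1)] by linarith
    moreover have "\<kappa> - of_nat h = 1/2 + of_nat (k - h)"
      using that(2) by (simp add: \<kappa>_def m_def of_nat_diff)
    ultimately show ?thesis
      by (simp add: powr_add powr_half_sqrt powr_realpow)
  qed
  \<comment> \<open>The square condition makes \<open>sqrt (T + a) * sqrt (T\<^sub>0 + a)\<close> an
    integer; the remaining denominators are those of half-integral binomial coefficients.\<close>
  have integral: "4 ^ k * \<psi> a $ h \<in> \<int>" if ah: "a \<in> S" "h < m" for a h
  proof -
    obtain s where s: "(T + a) * (T\<^sub>0 + a) = s ^ 2"
      using squares[OF ah(1)] by blast
    have "sqrt (of_int (T + a)) * sqrt (of_int (T\<^sub>0 + a)) = sqrt (of_int (s ^ 2))"
      by (simp only: s[symmetric] of_int_mult real_sqrt_mult)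
    also have "\<dots> = of_int \<bar>s\<bar>"
      by simp
    finally have s': "sqrt (of_int (T + a)) * sqrt (of_int (T\<^sub>0 + a)) = of_int \<bar>s\<bar>" .
    have "4 ^ k = 4 ^ (k - h) * (4 ^ h :: real)"
      using ah(2) by (simp add: m_def flip: power_add)
    then have "4 ^ k * \<psi> a $ h = of_int (4 ^ (k - h)) * (4 ^ h * (\<kappa> gchoose h)) *
        ((sqrt (of_int (T + a)) * sqrt (of_int (T\<^sub>0 + a))) * of_int ((T\<^sub>0 + a) ^ (k - h)))"
      by (simp only: \<psi>_def \<phi>_def fps_nth_Abs_fps powr_eq[OF ah] of_int_power of_int_numeral mult_ac)
    then show ?thesis
      unfolding s' using gbinomial_half_integral[of h k] by (simp only: \<kappa>_def Ints_mult Ints_of_int)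
  qed
  have ode: "(of_int T\<^sub>0 + of_int a) * (of_nat (Suc h) * \<psi> a $ Suc h) = (\<kappa> - of_nat h) * \<psi> a $ h"
    if "a \<in> S" for a h
  proof -
    have "real_of_int (T\<^sub>0 + a) > 0"
      using pos0[OF that] by linarith
    then have "of_int (T\<^sub>0 + a) * of_int (T\<^sub>0 + a) powr (\<kappa> - of_nat (Suc h)) = of_int (T\<^sub>0 + a) powr (\<kappa> - of_nat h)"
      by (simp add: powr_mult_base)
    moreover have "of_nat (Suc h) * (\<kappa> gchoose Suc h) = (\<kappa> - of_nat h) * (\<kappa> gchoose h)"
      using gbinomial_mult_1[of \<kappa> h] by (simp add: algebra_simps)
    moreover have "(of_int T\<^sub>0 + of_int a) * (of_nat (Suc h) * \<psi> a $ Suc h) = sqrt (of_int (T + a)) *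
        ((of_nat (Suc h) * (\<kappa> gchoose Suc h)) * (of_int (T\<^sub>0 + a) * of_int (T\<^sub>0 + a) powr (\<kappa> - of_nat (Suc h))))"
      by (simp only: \<psi>_def \<phi>_def fps_nth_Abs_fps of_int_add mult_ac)
    ultimately show ?thesis
      by (simp only: \<psi>_def \<phi>_def fps_nth_Abs_fps mult_ac)
  qed
  \<comment> \<open>If all three forms vanished, an interpolant of degree below
    \<open>3 * m - 3 = 3 * k\<close> would exist, and \<open>jets_eq_0_if_interpolant\<close> would
    force the jets to be 0, although their constant terms are positive.\<close>
  obtain i where i: "i < 3" "residue_form S m i \<psi> \<noteq> 0"
  proof (rule ccontr)
    assume "\<not> thesis"
    then have "\<And>i. i < 3 \<Longrightarrow> residue_form S m i \<psi> = 0"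
      using that by blast
    then obtain H where H: "\<And>l. l + 3 \<ge> card S * m \<Longrightarrow> coeff H l = 0"
      "\<And>a h. a \<in> S \<Longrightarrow> h < m \<Longrightarrow> jet (of_int a) H $ h = \<psi> a $ h"
      using interpolant_if_residue_forms_0[OF fin m, of 3 \<psi>] S m by auto
    obtain a where a: "a \<in> S"
      using fin by blast
    have "\<psi> a $ 0 = 0"
    proof (rule jets_eq_0_if_interpolant[where k = k and H = H and \<kappa> = \<kappa> and T = "of_int T\<^sub>0"])
      show "\<kappa> \<noteq> of_nat n" for n
      proof
        assume "\<kappa> = of_nat n"
        then have "real (2 * k + 1) = real (2 * n)"
          by (simp add: \<kappa>_def)
        then have "2 * k + 1 = 2 * n"
          by (simp only: of_nat_eq_iff)
        then show False
          by presburger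
      qed
      show "coeff H l = 0" if "l \<ge> card S * k" for l
        using H(1)[of l] that S by (simp add: m_def)
    qed (use fin k H(2) ode a in \<open>auto simp: m_def\<close>)
    moreover have "real_of_int (T + a) > 0" "real_of_int (T\<^sub>0 + a) > 0"
      using pos[OF a] pos0[OF a] by linarith+
    ultimately show False
      by (simp add: \<psi>_def \<phi>_def)
  qed
  define N :: real where "N = 4 ^ k * of_int d ^ (m * card S)"
  have "N * residue_form S m i \<psi> \<in> \<int>"
    unfolding N_def by (rule residue_form_integral[OF fin(1) m d(2) integral])
  moreover have "N > 0"
    using d(1) by (simp add: N_def)
  ultimately have ge1: "1 \<le> N * \<bar>residue_form S m i \<psi>\<bar>"
    using i(2) Ints_nonzero_abs_ge1[of "N * residue_form S m i \<psi>"] by (simp add: abs_mult)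

  \<comment> \<open>\<open>3 * k\<close> terms are the most for which
    \<open>degree P + i + 1 < 3 * m\<close> holds for every \<open>i < 3\<close>.\<close>
  define P where "P = half_power_poly (3 * k) k (of_int T\<^sub>0)"
  define \<chi> where "\<chi> a = \<psi> a - fps_const (sqrt (of_int T)) * jet (of_int a) P" for a
  have "residue_form S m i (\<lambda>a. jet (of_int a) P) = 0"
  proof (rule residue_form_poly_eq_0[OF fin m])
    have "degree P \<le> 3 * k - 1"
      unfolding P_def using k by (intro degree_half_power_poly) simp
    then show "degree P + i + 1 < card S * m"
      using i(1) k S by (simp add: m_def)
  qed
  then have res_eq: "residue_form S m i \<psi> = residue_form S m i \<chi>"
    by (simp add: residue_form_def \<chi>_def left_diff_distrib mult.assoc sum_subtractf flip: sum_distrib_left)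
  define B where "B = sqrt (of_int T) * (64 ^ k * of_int R ^ (3 * k) * (sqrt (of_int T\<^sub>0) / of_int T\<^sub>0 ^ (2 * k)))
    + of_int R / sqrt (of_int T) * (2 ^ k * (2 * sqrt (of_int T\<^sub>0) * (2 * of_int T\<^sub>0) ^ k))"
  have \<chi>_bound: "\<bar>\<chi> a $ h\<bar> \<le> B" if ah: "a \<in> S" "h < m" for a h
  proof -
    have aR: "\<bar>real_of_int a\<bar> \<le> of_int R"
      using R(2)[OF ah(1)] by linarith
    have R1: "1 \<le> real_of_int R"
      using R(1) by simp
    \<comment> \<open>The first summand is the Taylor truncation error, the second comes from
      replacing \<open>sqrt (T + a)\<close> by \<open>sqrt T\<close>.\<close>
    have "\<chi> a $ h = sqrt (of_int T) * (\<phi> a h - jet (of_int a) P $ h)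
        + (sqrt (of_int (T + a)) - sqrt (of_int T)) * \<phi> a h"
      by (simp add: \<chi>_def \<psi>_def algebra_simps)
    also have "\<bar>\<dots>\<bar> \<le> sqrt (of_int T) * \<bar>\<phi> a h - jet (of_int a) P $ h\<bar>
        + \<bar>sqrt (of_int (T + a)) - sqrt (of_int T)\<bar> * \<bar>\<phi> a h\<bar>"
      using T0_pos by (intro order_trans[OF abs_triangle_ineq]) (simp add: abs_mult)
    also have "\<dots> \<le> B"
      unfolding B_def
    proof (intro add_mono mult_mono mult_left_mono)
      have "\<bar>\<phi> a h - jet (of_int a) P $ h\<bar> \<le>
          2 ^ k * 2 ^ (3 * k) * (of_int T\<^sub>0 / 2) powr (\<kappa> - of_nat (3 * k)) * \<bar>of_int a\<bar> ^ (3 * k - h)"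
        using half_power_jet_error[of "of_int a" "of_int T\<^sub>0" h "3 * k" k] aR T\<^sub>0 T0_pos ah k
        unfolding \<phi>_def P_def \<kappa>_def m_def by simp
      also have "(of_int T\<^sub>0 / 2) powr (\<kappa> - of_nat (3 * k)) = sqrt (of_int T\<^sub>0 / 2) / (of_int T\<^sub>0 / 2) ^ (2 * k)"
      proof -
        have "\<kappa> - of_nat (3 * k) = 1/2 - of_nat (2 * k)"
          by (simp add: \<kappa>_def)
        moreover have "(of_int T\<^sub>0 / 2 :: real) powr of_nat (2 * k) = (of_int T\<^sub>0 / 2) ^ (2 * k)"
          using T0_pos by (intro powr_realpow) simp
        moreover have "(of_int T\<^sub>0 / 2 :: real) powr (1/2) = sqrt (of_int T\<^sub>0 / 2)"
          using T0_pos by (intro powr_half_sqrt) simp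
        ultimately show ?thesis
          by (simp only: powr_diff)
      qed
      also have "2 ^ k * 2 ^ (3 * k) * (sqrt (of_int T\<^sub>0 / 2) / (of_int T\<^sub>0 / 2) ^ (2 * k)) * \<bar>real_of_int a\<bar> ^ (3 * k - h)
        \<le> 2 ^ k * 2 ^ (3 * k) * (sqrt (of_int T\<^sub>0) / (of_int T\<^sub>0 / 2) ^ (2 * k)) * of_int R ^ (3 * k)"
      proof (intro mult_mono mult_left_mono divide_right_mono)
        have "\<bar>real_of_int a\<bar> ^ (3 * k - h) \<le> of_int R ^ (3 * k - h)"
          using aR by (intro power_mono) auto
        also have "\<dots> \<le> of_int R ^ (3 * k)"
          using R1 by (intro power_increasing) auto
        finally show "\<bar>real_of_int a\<bar> ^ (3 * k - h) \<le> of_int R ^ (3 * k)" .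
      qed (use T0_pos in auto)
      also have "\<dots> = 64 ^ k * of_int R ^ (3 * k) * (sqrt (of_int T\<^sub>0) / of_int T\<^sub>0 ^ (2 * k))"
      proof -
        have "(64::real) ^ k = 2 ^ k * 2 ^ (3 * k) * 2 ^ (2 * k)"
          by (simp add: power_mult flip: power_mult_distrib)
        then show ?thesis
          by (simp add: power_divide)
      qed
      finally show "\<bar>\<phi> a h - jet (of_int a) P $ h\<bar> \<le>
        64 ^ k * of_int R ^ (3 * k) * (sqrt (of_int T\<^sub>0) / of_int T\<^sub>0 ^ (2 * k))" .
    next
      have posT: "real_of_int (T + a) \<ge> 1"
        using pos[OF ah(1)] by linarith
      have "(sqrt (of_int (T + a)) - sqrt (of_int T)) * (sqrt (of_int (T + a)) + sqrt (of_int T)) = of_int a"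
        using posT T0_pos by (simp add: algebra_simps)
      then have "\<bar>sqrt (of_int (T + a)) - sqrt (of_int T)\<bar> * (sqrt (of_int (T + a)) + sqrt (of_int T)) = \<bar>of_int a\<bar>"
        using posT T0_pos by (metis abs_mult abs_of_nonneg add_nonneg_nonneg real_sqrt_ge_zero order_trans zero_le_one)
      moreover have "\<bar>sqrt (of_int (T + a)) - sqrt (of_int T)\<bar> * sqrt (of_int T) \<le>
          \<bar>sqrt (of_int (T + a)) - sqrt (of_int T)\<bar> * (sqrt (of_int (T + a)) + sqrt (of_int T))"
        using posT by (intro mult_left_mono) auto
      ultimately have "\<bar>sqrt (of_int (T + a)) - sqrt (of_int T)\<bar> * sqrt (of_int T) \<le> of_int R"
        using aR by linarith
      then show "\<bar>sqrt (of_int (T + a)) - sqrt (of_int T)\<bar> \<le> of_int R / sqrt (of_int T)"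
        using T0_pos by (simp add: pos_le_divide_eq)
    next
      have pos0': "real_of_int (T\<^sub>0 + a) \<ge> 1"
        using pos0[OF ah(1)] by linarith
      have le2: "real_of_int (T\<^sub>0 + a) \<le> 2 * of_int T\<^sub>0"
        using aR T\<^sub>0 by linarith
      have "\<bar>\<phi> a h\<bar> = \<bar>\<kappa> gchoose h\<bar> * (sqrt (of_int (T\<^sub>0 + a)) * of_int (T\<^sub>0 + a) ^ (k - h))"
        unfolding \<phi>_def abs_mult powr_eq[OF ah] using pos0' by simp
      also have "\<dots> \<le> 2 ^ k * (2 * sqrt (of_int T\<^sub>0) * (2 * of_int T\<^sub>0) ^ k)"
      proof (intro mult_mono)
        show "\<bar>\<kappa> gchoose h\<bar> \<le> 2 ^ k"
          unfolding \<kappa>_def by (rule abs_gbinomial_half_le)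
        have "sqrt (of_int (T\<^sub>0 + a)) \<le> sqrt (2 ^ 2 * of_int T\<^sub>0)"
          using le2 T0_pos by (intro real_sqrt_le_mono) simp
        also have "\<dots> = 2 * sqrt (of_int T\<^sub>0)"
          by (simp add: real_sqrt_mult)
        finally show "sqrt (of_int (T\<^sub>0 + a)) \<le> 2 * sqrt (of_int T\<^sub>0)" .
        have "real_of_int (T\<^sub>0 + a) ^ (k - h) \<le> (2 * of_int T\<^sub>0) ^ (k - h)"
          using le2 pos0' by (intro power_mono) auto
        also have "\<dots> \<le> (2 * of_int T\<^sub>0) ^ k"
          using T0_pos by (intro power_increasing) auto
        finally show "real_of_int (T\<^sub>0 + a) ^ (k - h) \<le> (2 * of_int T\<^sub>0) ^ k" .
      qed (use pos0' T0_pos in auto)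
      finally show "\<bar>\<phi> a h\<bar> \<le> 2 ^ k * (2 * sqrt (of_int T\<^sub>0) * (2 * of_int T\<^sub>0) ^ k)" .
    qed (use T0_pos R1 in auto)
    finally show ?thesis .
  qed
  define E where "E = sqrt (of_int T\<^sub>0) * (sqrt (of_int T) / of_int T\<^sub>0 ^ (2 * k) + of_int T\<^sub>0 ^ k / sqrt (of_int T))"
  have "E \<ge> 0"
    unfolding E_def using T0_pos by (intro mult_nonneg_nonneg add_nonneg_nonneg divide_nonneg_nonneg) auto
  have R1: "1 \<le> real_of_int R"
    using R(1) by simp
  have "B \<le> (64 * of_int R ^ 3) ^ m * E"
  proof -
    have "64 ^ k * real_of_int R ^ (3 * k) = (64 * of_int R ^ 3) ^ k"
      by (simp add: power_mult_distrib power_mult)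
    also have "\<dots> \<le> (64 * of_int R ^ 3) ^ m"
      using one_le_power[OF R1, of 3] by (intro power_increasing) (auto simp: m_def)
    finally have 1: "64 ^ k * real_of_int R ^ (3 * k) \<le> (64 * of_int R ^ 3) ^ m" .
    have "of_int R * (2 ^ k * (2 * 2 ^ k)) \<le> (of_int R ^ 3) ^ m * (64 ^ m :: real)"
    proof (intro mult_mono)
      have "real_of_int R ^ 1 \<le> of_int R ^ (3 * m)"
        using R1 by (intro power_increasing) (auto simp: m_def)
      then show "real_of_int R \<le> (of_int R ^ 3) ^ m"
        by (simp add: power_mult)
      have "(2::real) ^ k * (2 * 2 ^ k) = 2 ^ (k + Suc k)"
        by (simp only: power_add power_Suc)
      also have "\<dots> \<le> 2 ^ (6 * m)"
        by (intro power_increasing) (auto simp: m_def)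
      also have "\<dots> = 64 ^ m"
        by (simp add: power_mult)
      finally show "(2::real) ^ k * (2 * 2 ^ k) \<le> 64 ^ m" .
    qed (use R1 in auto)
    then have 2: "of_int R * (2 ^ k * (2 * 2 ^ k)) \<le> (64 * real_of_int R ^ 3) ^ m"
      by (simp add: power_mult_distrib mult.commute)
    have "B = (64 ^ k * of_int R ^ (3 * k)) * (sqrt (of_int T\<^sub>0) * (sqrt (of_int T) / of_int T\<^sub>0 ^ (2 * k)))
        + (of_int R * (2 ^ k * (2 * 2 ^ k))) * (sqrt (of_int T\<^sub>0) * (of_int T\<^sub>0 ^ k / sqrt (of_int T)))"
      by (simp add: B_def power_mult_distrib mult_ac)
    also have "\<dots> \<le> (64 * of_int R ^ 3) ^ m * (sqrt (of_int T\<^sub>0) * (sqrt (of_int T) / of_int T\<^sub>0 ^ (2 * k)))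
        + (64 * of_int R ^ 3) ^ m * (sqrt (of_int T\<^sub>0) * (of_int T\<^sub>0 ^ k / sqrt (of_int T)))"
      using T0_pos by (intro add_mono mult_right_mono 1 2) auto
    finally show ?thesis
      by (simp add: E_def distrib_left)
  qed
  have "1 \<le> N * \<bar>residue_form S m i \<chi>\<bar>"
    using ge1 res_eq by simp
  also have "\<dots> \<le> N * (of_nat (card S) * (of_nat m * (B * ((of_int R + 1) ^ i * 2 ^ (m * card S)))))"
    using \<open>N > 0\<close> R(2) by (intro mult_left_mono residue_form_bound fin m d(2) \<chi>_bound) force+
  \<comment> \<open>Every factor is bounded by an \<open>m\<close>-th power. In \<open>C\<close>,
    the 4 comes from binomial denominators, \<open>d ^ 3\<close> from the weights, 3 from
    \<open>card S\<close>, \<open>(R + 1) ^ 2\<close> from \<open>i \<le> 2\<close>, 16 from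
    \<open>m \<le> 2 ^ m\<close> and \<open>2 ^ (3 * m) = 8 ^ m\<close>, and
    \<open>64 * R ^ 3\<close> from \<open>B\<close>.\<close>
  also have "\<dots> \<le> (4 ^ m * (of_int d ^ 3) ^ m) * (3 ^ m * (2 ^ m *
      (((64 * of_int R ^ 3) ^ m * E) * (((of_int R + 1) ^ 2) ^ m * 8 ^ m))))"
  proof (intro mult_mono)
    show "N \<le> 4 ^ m * (of_int d ^ 3) ^ m"
    proof -
      have "real_of_int d ^ (m * card S) = (of_int d ^ 3) ^ m"
        by (simp only: S power_mult[symmetric] mult.commute)
      moreover have "(4::real) ^ k \<le> 4 ^ m"
        unfolding m_def by simp
      ultimately show ?thesis
        unfolding N_def using d(1) by (simp add: mult_right_mono)
    qed
    show "real (card S) \<le> 3 ^ m"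
      unfolding S m_def by simp
    show "real m \<le> 2 ^ m"
      using of_nat_less_two_power[of m] by (rule less_imp_le)
    have "(real_of_int R + 1) ^ i \<le> (of_int R + 1) ^ (2 * m)"
      using i(1) R1 by (intro power_increasing) (auto simp: m_def)
    then show "(real_of_int R + 1) ^ i \<le> ((of_int R + 1) ^ 2) ^ m"
      by (simp add: power_mult)
    show "(2::real) ^ (m * card S) \<le> 8 ^ m"
      unfolding S by (simp add: mult.commute[of m] power_mult)
    obtain a where "a \<in> S"
      using fin by blast
    then have "0 \<le> B"
      using \<chi>_bound[of a 0] m by (meson abs_ge_zero order_trans)
    then show "0 \<le> B * ((real_of_int R + 1) ^ i * 2 ^ (m * card S))"
      and "0 \<le> real m * (B * ((real_of_int R + 1) ^ i * 2 ^ (m * card S)))"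
      and "0 \<le> real (card S) * (real m * (B * ((real_of_int R + 1) ^ i * 2 ^ (m * card S))))"
      using R1 by simp_all
    show "B \<le> (64 * real_of_int R ^ 3) ^ m * E"
      by fact
  qed (use R1 d(1) \<open>E \<ge> 0\<close> in auto)
  also have "\<dots> = of_int C ^ m * E"
  proof -
    have "(12288::real) ^ m = 2 ^ m * (3 ^ m * (4 ^ m * (8 ^ m * 64 ^ m)))"
      by (simp flip: power_mult_distrib)
    then show ?thesis
      unfolding C_def by (simp add: power_mult_distrib mult_ac)
  qed
  finally show ?thesis
    by (simp add: E_def m_def mult.assoc)
qed

text \<open>With \<open>T\<^sub>0\<close> large and \<open>T\<close> much larger, \<open>k\<close>
  is chosen so that \<open>sqrt T\<close> lies between two consecutive thresholds \<open>f k\<close>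
  and \<open>f (Suc k)\<close>. Then both summands in \<open>three_nodes_estimate\<close> are below
  1/2.\<close>

lemma finite_if_translates_in_square_classes:
  fixes S Ts :: "int set"
  assumes S: "card S = 3" and nonneg: "\<And>T. T \<in> Ts \<Longrightarrow> T \<ge> 0"
    and squares: "\<And>T T' a. T \<in> Ts \<Longrightarrow> T' \<in> Ts \<Longrightarrow> a \<in> S \<Longrightarrow> \<exists>s :: int. (T + a) * (T' + a) = s ^ 2"
  shows "finite Ts"
proof (rule ccontr)
  assume "infinite Ts"
  have large: "\<exists>T\<in>Ts. T \<ge> M" for M
  proof (rule ccontr)
    assume "\<not> ?thesis"
    then have "Ts \<subseteq> {0..M}"
      using nonneg by force
    with \<open>infinite Ts\<close> show False
      using finite_subset by blast
  qed
  have fin: "finite S"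
    using S by (auto intro: card_ge_0_finite)
  define R where "R = (\<Sum>a\<in>S. \<bar>a\<bar>) + 1"
  define d where "d = (\<Prod>a\<in>S. \<Prod>c\<in>S - {a}. \<bar>a - c\<bar>)"
  have R: "R \<ge> 1" "\<bar>a\<bar> \<le> R" if "a \<in> S" for a
    unfolding R_def using member_le_sum[OF that, of abs] fin by (auto intro: sum_nonneg)
  have R1: "R \<ge> 1"
    unfolding R_def by (simp add: sum_nonneg)
  have d1: "d \<ge> 1"
  proof -
    have "d > 0"
      unfolding d_def by (intro prod_pos) auto
    then show ?thesis
      by simp
  qed
  have d: "a - c dvd d" if "a \<in> S" "c \<in> S - {a}" for a c
  proof -
    have "\<bar>a - c\<bar> dvd (\<Prod>c\<in>S - {a}. \<bar>a - c\<bar>)"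
      using that fin by (intro dvd_prodI) auto
    also have "\<dots> dvd d"
      unfolding d_def using that fin by (intro dvd_prodI) auto
    finally show ?thesis
      by simp
  qed
  define C where "C = 4 * d ^ 3 * 3 * (R + 1) ^ 2 * 16 * (64 * R ^ 3)"
  \<comment> \<open>The term \<open>4 * C ^ 9\<close> starts the induction for \<open>growth\<close>
    at \<open>k = 3\<close>; the term \<open>4 * C ^ 8 * T\<^sub>0 ^ 7\<close> in the choice of
    \<open>T\<close> is \<open>(f 3) ^ 2\<close>, so that the index found is at least 3.\<close>
  obtain T\<^sub>0 where T\<^sub>0: "T\<^sub>0 \<in> Ts" "T\<^sub>0 \<ge> 2 * R + 4 * C ^ 9 + 1"
    using large by blast
  obtain T where T: "T \<in> Ts" "T \<ge> 2 * R + 4 * C ^ 8 * T\<^sub>0 ^ 7 + 1"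
    using large by blast
  define c u x y :: real where "c = of_int C" and "u = of_int T\<^sub>0" and "x = sqrt (of_int T)" and "y = sqrt (of_int T\<^sub>0)"
  have "C \<ge> 1"
    unfolding C_def using R1 d1 by (simp add: int_one_le_iff_zero_less)
  then have c1: "c \<ge> 1"
    by (simp add: c_def)
  have "0 < C ^ 9"
    using \<open>C \<ge> 1\<close> by simp
  then have T0: "T\<^sub>0 \<ge> 2 * R" "T\<^sub>0 > 4 * C ^ 9"
    using T\<^sub>0(2) R1 by linarith+
  have "0 \<le> 4 * C ^ 8 * T\<^sub>0 ^ 7"
    using \<open>C \<ge> 1\<close> T0 R1 by simp
  then have T': "T \<ge> 2 * R" "T > 4 * C ^ 8 * T\<^sub>0 ^ 7"
    using T(2) R1 by linarith+
  have estimate: "1 \<le> c ^ Suc k * y * (x / u ^ (2 * k) + u ^ k / x)" if "k \<ge> 1" for k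
    unfolding c_def y_def x_def u_def C_def
    by (rule three_nodes_estimate[OF S R1 R(2) d1 d T0(1) T'(1) that squares[OF T(1) T\<^sub>0(1)]])
  have "real_of_int (4 * C ^ 9) < of_int T\<^sub>0"
    using T0(2) by (simp only: of_int_less_iff)
  then have u_big: "u > 4 * c ^ 9"
    by (simp add: u_def c_def)
  have u1: "u \<ge> 2"
    using u_big one_le_power[OF c1, of 9] by linarith
  have y: "y ^ 2 = u" "y > 1"
    using u1 by (simp_all add: y_def u_def)
  \<comment> \<open>\<open>f k < x\<close> says exactly that the second summand of the estimate is
    below 1/2.\<close>
  define f where "f k = 2 * c ^ Suc k * y * u ^ k" for k
  have f_mono: "f j \<le> f k" if "j \<le> k" for j k
    unfolding f_def using that c1 y u1 by (intro mult_mono power_increasing) auto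
  have "f 3 < x"
  proof -
    have "real_of_int (4 * C ^ 8 * T\<^sub>0 ^ 7) < of_int T"
      using T'(2) by (simp only: of_int_less_iff)
    then have "sqrt (4 * c ^ 8 * u ^ 7) < x"
      by (simp add: c_def u_def x_def)
    also have "4 * c ^ 8 * u ^ 7 = (f 3) ^ 2"
      by (simp add: f_def power_mult_distrib y flip: power_mult power_Suc)
    finally show ?thesis
      using c1 y u1 by (simp add: f_def)
  qed
  obtain n where n: "x < 2 ^ n"
    using real_arch_pow[of 2 x] by auto
  have "2 ^ n \<le> f n"
  proof -
    have "1 * 1 \<le> (2 * c ^ Suc n) * y"
      using y one_le_power[OF c1, of "Suc n"] by (intro mult_mono) auto
    then have "1 * (2 ^ n :: real) \<le> (2 * c ^ Suc n * y) * u ^ n"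
      using u1 c1 y by (intro mult_mono power_mono) auto
    then show ?thesis
      by (simp add: f_def)
  qed
  define j where "j = (LEAST j. x \<le> f j)"
  have "x \<le> f n"
    using n \<open>2 ^ n \<le> f n\<close> by linarith
  then have j: "x \<le> f j"
    unfolding j_def by (rule LeastI)
  have j_least: "f i < x" if "i < j" for i
    using not_less_Least[OF that[unfolded j_def]] by simp
  have "j > 3"
  proof (rule ccontr)
    assume "\<not> j > 3"
    then have "f j \<le> f 3"
      by (intro f_mono) simp
    with j \<open>f 3 < x\<close> show False
      by linarith
  qed
  then obtain k where k: "j = Suc k" "k \<ge> 3"
    by (cases j) auto
  have "x > 0"
    using j_least[of k] k c1 y u1 by (intro less_trans[of 0 "f k" x]) (auto simp: f_def)
  have "c ^ Suc k * y * (u ^ k / x) < 1/2"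
    using j_least[of k] k \<open>x > 0\<close> by (simp add: f_def field_simps)
  moreover have "c ^ Suc k * y * (x / u ^ (2 * k)) < 1/2"
  proof -
    \<comment> \<open>This is what the first summand needs once \<open>x\<close> is replaced by its
      upper bound \<open>f (Suc k)\<close>.\<close>
    have growth: "4 * c ^ (2 * k + 3) * u ^ 2 < u ^ k"
      using k(2)
    proof (induction k rule: dec_induct)
      case base
      have "4 * c ^ 9 * u ^ 2 < u * u ^ 2"
        using u_big u1 by (intro mult_strict_right_mono) auto
      then show ?case
        by (simp add: power3_eq_cube power2_eq_square)
    next
      case (step k)
      have "c ^ 2 \<le> c ^ 9"
        using c1 by (intro power_increasing) auto
      then have "c ^ 2 \<le> u"
        using u_big c1 by (smt (verit) zero_le_power)
      have "c ^ (2 * Suc k + 3) = c ^ 2 * c ^ (2 * k + 3)"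
        by (simp only: power_add[symmetric]) simp
      then have "4 * c ^ (2 * Suc k + 3) * u ^ 2 = c ^ 2 * (4 * c ^ (2 * k + 3) * u ^ 2)"
        by simp
      also have "\<dots> < u * u ^ k"
        using step.IH c1 u1 \<open>c ^ 2 \<le> u\<close> by (intro mult_le_less_imp_less) auto
      finally show ?case
        by simp
    qed
    have "c ^ Suc k * y * (x / u ^ (2 * k)) \<le> c ^ Suc k * y * (f (Suc k) / u ^ (2 * k))"
      using j k(1) c1 y u1 by (intro mult_left_mono divide_right_mono) auto
    also have "\<dots> = 2 * c ^ (2 * k + 3) * u ^ 2 / u ^ k"
    proof -
      have "c ^ (2 * k + 3) = c ^ Suc k * c ^ Suc (Suc k)"
      proof -
        have "2 * k + 3 = Suc k + Suc (Suc k)"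
          by simp
        then show ?thesis
          by (simp only: power_add)
      qed
      moreover have "u ^ (2 * k) = u ^ k * u ^ k"
        by (simp only: mult_2 power_add)
      ultimately have "c ^ Suc k * y * (f (Suc k) / u ^ (2 * k)) =
          2 * c ^ (2 * k + 3) * y ^ 2 * (u * u ^ k) / (u ^ k * u ^ k)"
        by (simp add: f_def power2_eq_square)
      also have "\<dots> = 2 * c ^ (2 * k + 3) * u ^ 2 / u ^ k"
        using u1 unfolding y by (simp add: power2_eq_square)
      finally show ?thesis .
    qed
    also have "\<dots> < 1/2"
      using growth u1 by (simp add: field_simps)
    finally show ?thesis .
  qed
  moreover have "1 \<le> c ^ Suc k * y * (x / u ^ (2 * k)) + c ^ Suc k * y * (u ^ k / x)"
    unfolding distrib_left[symmetric] by (rule estimate) (use k(2) in simp)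
  ultimately show False
    by linarith
qed

section \<open>Square values of three linear polynomials\<close>

text \<open>With \<open>e = gcd d x\<close> and \<open>d = k * e\<close>, the cofactor
  \<open>k\<close> divides a power of \<open>e\<close>; squarefreeness makes \<open>k\<close> and
  \<open>e\<close> coprime, so \<open>k\<close> is a unit.\<close>

lemma squarefree_dvd_power:
  fixes d x :: int
  assumes "squarefree d" "d dvd x ^ n"
  shows "d dvd x"
  using assms(2)
proof (induction n)
  case (Suc n)
  show ?case
  proof (cases "d dvd x ^ n")
    case False
    define e where "e = gcd d x"
    have "d \<noteq> 0"
      using assms(1) by auto
    then obtain k m where km: "d = k * e" "x = m * e" "coprime k m"
      unfolding e_def using gcd_coprime_exists[of d x] by auto
    have "e \<noteq> 0"
      using \<open>d \<noteq> 0\<close> km by auto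
    have "x ^ Suc n = m * e * x ^ n"
      using arg_cong[OF km(2), of "\<lambda>z. z * x ^ n"] by simp
    also have "\<dots> = m * x ^ n * e"
      by (simp only: mult_ac)
    finally have "k * e dvd m * x ^ n * e"
      using Suc.prems km(1) by metis
    then have "k dvd m * x ^ n"
      using \<open>e \<noteq> 0\<close> by simp
    then have "k dvd (m * e) ^ n"
      using km(2,3) by (simp add: coprime_dvd_mult_right_iff)
    then have "k dvd e ^ n"
      unfolding power_mult_distrib using km(3)
      by (meson coprime_dvd_mult_right_iff coprime_power_right_iff)
    moreover have "coprime k e"
    proof (rule coprimeI)
      fix c
      assume "c dvd k" "c dvd e"
      then have "c ^ 2 dvd d"
        unfolding km(1) power2_eq_square by (rule mult_dvd_mono)
      then show "is_unit c"
        using assms(1) squarefreeD by blast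
    qed
    ultimately have "is_unit k"
      by (metis coprime_absorb_left coprime_power_right_iff is_unit_power_iff power_0)
    then have "d dvd e"
      unfolding km(1) by (simp add: mult_unit_dvd_iff')
    then show ?thesis
      by (simp add: e_def)
  qed (use Suc.IH in blast)
qed (metis dvd_trans one_dvd power_0)

text \<open>With \<open>x = d * r ^ 2\<close> the factor \<open>r\<close> cancels against
  \<open>s\<close>, leaving \<open>d * y = z ^ 2\<close>; the squarefree \<open>d\<close> then
  divides \<open>z\<close>.\<close>

lemma squarefree_part_of_square_product:
  fixes x y s :: int
  assumes "x * y = s ^ 2" "x \<noteq> 0"
  obtains u where "y = squarefree_part x * u ^ 2"
proof -
  define d r where "d = squarefree_part x" and "r = square_part x"
  have x: "x = d * r ^ 2"
    unfolding d_def r_def by (rule squarefree_decompose)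
  have "d \<noteq> 0" "r \<noteq> 0"
    using assms(2) x by auto
  have "r ^ 2 dvd s ^ 2"
    unfolding assms(1)[symmetric] x by simp
  then have "r dvd s"
    by simp
  then obtain z where z: "s = r * z"
    by blast
  have "d * y = z ^ 2"
    using assms(1) \<open>r \<noteq> 0\<close> unfolding x z by (simp add: power2_eq_square)
  then have "d dvd z ^ 2"
    by (metis dvd_triv_left)
  then have "d dvd z"
    by (rule squarefree_dvd_power[rotated]) (simp add: d_def)
  then obtain u where "z = d * u"
    by blast
  then have "y = d * u ^ 2"
    using \<open>d * y = z ^ 2\<close> \<open>d \<noteq> 0\<close> by (simp add: power2_eq_square)
  then show ?thesis
    using that[of u] by (simp add: d_def)
qed

lemma squarefree_part_dvd_of_square_product:
  fixes x y s :: int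
  assumes "x * y = s ^ 2"
  shows "squarefree_part x dvd y"
proof (cases "x = 0")
  case False
  then show ?thesis
    using squarefree_part_of_square_product[OF assms] by (metis dvd_triv_left)
qed simp

lemma squarefree_part_pos: "(x :: int) > 0 \<Longrightarrow> squarefree_part x > 0"
proof -
  assume "x > 0"
  then have "0 < squarefree_part x * square_part x ^ 2"
    by (simp flip: squarefree_decompose)
  then show ?thesis
    by (simp add: zero_less_mult_iff)
qed

text \<open>Multiplying by the complementary leading coefficients \<open>w i\<close> turns the three
  forms into translates \<open>M * t + a i\<close> of one variable. For two solutions, the values at
  the same translate multiply to a square, as both lie in the class of
  \<open>w i * d i\<close>.\<close>

lemma finite_square_values_fixed_class:
  fixes A B d :: "nat \<Rightarrow> int"
  assumes A: "\<And>i. i < 3 \<Longrightarrow> A i > 0"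
    and indep: "\<And>i j. i < 3 \<Longrightarrow> j < 3 \<Longrightarrow> i \<noteq> j \<Longrightarrow> A i * B j \<noteq> A j * B i"
  shows "finite {t. t \<ge> 0 \<and> (\<forall>i<3. \<exists>r. A i * t + B i = d i * r ^ 2)}" (is "finite ?X")
proof -
  define K where "K = (\<Sum>i<3. \<bar>B i\<bar>)"
  define M where "M = (\<Prod>i<3. A i)"
  define w where "w i = (\<Prod>j\<in>{..<3} - {i}. A j)" for i :: nat
  have M: "M = A i * w i" if "i < 3" for i
    unfolding M_def w_def using that by (intro prod.remove) auto
  have "M > 0"
    unfolding M_def using A by (intro prod_pos) auto
  define a where "a i = w i * B i" for i
  have "inj_on a {..<3}"
  proof (rule inj_onI, rule ccontr)
    fix i j :: nat
    assume ij: "i \<in> {..<3}" "j \<in> {..<3}" "a i = a j" "i \<noteq> j"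
    then have "A i * A j * a i = A i * A j * a j"
      by simp
    then have "M * (A j * B i) = M * (A i * B j)"
      using M[of i] M[of j] ij unfolding a_def by (simp add: mult_ac)
    then show False
      using \<open>M > 0\<close> indep[of i j] ij by auto
  qed
  then have card: "card (a ` {..<3}) = 3"
    by (simp add: card_image)
  have shift: "M * t + a i = w i * (A i * t + B i)" if "i < 3" for i t
    unfolding M[OF that] a_def by (simp add: algebra_simps)
  have "finite ((\<lambda>t. M * t) ` ?X)"
  proof (rule finite_if_translates_in_square_classes[OF card])
    show "T \<ge> 0" if "T \<in> (\<lambda>t. M * t) ` ?X" for T
      using that \<open>M > 0\<close> by auto
  next
    fix T T' b
    assume "T \<in> (\<lambda>t. M * t) ` ?X" "T' \<in> (\<lambda>t. M * t) ` ?X" "b \<in> a ` {..<3}"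
    then obtain t t' i where t: "t \<in> ?X" "T = M * t" and t': "t' \<in> ?X" "T' = M * t'" and i: "i < 3" "b = a i"
      by auto
    obtain r r' where "A i * t + B i = d i * r ^ 2" "A i * t' + B i = d i * r' ^ 2"
      using t(1) t'(1) i(1) by blast
    then have "(T + b) * (T' + b) = (w i * d i * r * r') ^ 2"
      unfolding t(2) t'(2) i(2) shift[OF i(1)] by (simp add: power2_eq_square)
    then show "\<exists>s. (T + b) * (T' + b) = s ^ 2"
      by blast
  qed
  then show ?thesis
    by (rule finite_imageD) (use \<open>M > 0\<close> in \<open>auto simp: inj_on_def\<close>)
qed

text \<open>The squarefree part of each factor \<open>L i\<close> divides the product of the other
  two, and \<open>A i * L j\<close> is congruent to the constant \<open>c i j\<close> modulo
  \<open>L i\<close>. So all squarefree parts divide the fixed nonzero \<open>N\<close>, which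
  leaves finitely many square classes.\<close>

lemma finite_square_values:
  fixes A B :: "nat \<Rightarrow> int"
  assumes A: "\<And>i. i < 3 \<Longrightarrow> A i > 0"
    and indep: "\<And>i j. i < 3 \<Longrightarrow> j < 3 \<Longrightarrow> i \<noteq> j \<Longrightarrow> A i * B j \<noteq> A j * B i"
  shows "finite {t. t \<ge> 0 \<and> (\<exists>s. (\<Prod>i<3. A i * t + B i) = s ^ 2)}" (is "finite ?X")
proof -
  define c where "c i j = A i * B j - A j * B i" for i j
  define N where "N = (\<Prod>i<3. \<Prod>j\<in>{..<3} - {i}. c i j)"
  have "N \<noteq> 0"
    unfolding N_def c_def using indep by auto
  define D where "D = PiE {..<3::nat} (\<lambda>_. {d :: int. d dvd N})"
  have "finite D"
    unfolding D_def using \<open>N \<noteq> 0\<close> by (intro finite_PiE) auto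
  have "?X \<subseteq> (\<Union>d\<in>D. {t. t \<ge> 0 \<and> (\<forall>i<3. \<exists>r. A i * t + B i = d i * r ^ 2)})"
  proof
    fix t
    assume "t \<in> ?X"
    then obtain s where t: "t \<ge> 0" "(\<Prod>i<3. A i * t + B i) = s ^ 2"
      by blast
    define L where "L i = A i * t + B i" for i
    define d where "d i = squarefree_part (L i)" for i
    have "d i dvd N" if i: "i < 3" for i
    proof -
      have "L i * (\<Prod>j\<in>{..<3} - {i}. L j) = s ^ 2"
        unfolding t(2)[folded L_def, symmetric] using i by (intro prod.remove[symmetric]) auto
      then have "d i dvd (\<Prod>j\<in>{..<3} - {i}. L j)"
        unfolding d_def by (rule squarefree_part_dvd_of_square_product)
      then have "d i dvd (\<Prod>j\<in>{..<3} - {i}. A i * L j)"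
        by (simp add: prod.distrib)
      moreover have "d i dvd L i"
        unfolding d_def by (metis dvd_triv_left squarefree_decompose)
      have "A i * L j mod d i = c i j mod d i" for j
      proof -
        have "A i * L j - c i j = L i * A j"
          by (simp add: L_def c_def algebra_simps)
        then show ?thesis
          using \<open>d i dvd L i\<close> by (simp add: mod_eq_dvd_iff)
      qed
      then have "(\<Prod>j\<in>{..<3} - {i}. A i * L j) mod d i = (\<Prod>j\<in>{..<3} - {i}. c i j) mod d i"
        by (subst (1 2) mod_prod_eq[symmetric]) simp
      ultimately have "d i dvd (\<Prod>j\<in>{..<3} - {i}. c i j)"
        by (simp only: dvd_eq_mod_eq_0)
      also have "\<dots> dvd N"
        unfolding N_def using i by (intro dvd_prodI) auto
      finally show ?thesis .
    qed
    then have "restrict d {..<3} \<in> D"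
      by (auto simp: D_def)
    moreover have "\<forall>i<3. \<exists>r. A i * t + B i = restrict d {..<3} i * r ^ 2"
      using squarefree_decompose by (auto simp: d_def L_def[symmetric])
    ultimately show "t \<in> (\<Union>d\<in>D. {t. t \<ge> 0 \<and> (\<forall>i<3. \<exists>r. A i * t + B i = d i * r ^ 2)})"
      using t(1) by blast
  qed
  moreover have "finite (\<Union>d\<in>D. {t. t \<ge> 0 \<and> (\<forall>i<3. \<exists>r. A i * t + B i = d i * r ^ 2)})"
    using \<open>finite D\<close> by (intro finite_UN_I finite_square_values_fixed_class A indep)
  ultimately show ?thesis
    by (rule finite_subset)
qed

section \<open>Points over the cubic field\<close>

definition rat_eval :: "rat poly \<Rightarrow> real \<Rightarrow> real" where
  "rat_eval p x = poly (map_poly of_rat p) x"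

lemma rat_eval_pCons [simp]: "rat_eval (pCons a p) x = of_rat a + x * rat_eval p x"
  by (simp add: rat_eval_def map_poly_pCons)

lemma rat_eval_0 [simp]: "rat_eval 0 x = 0"
  by (simp add: rat_eval_def)

lemma rat_eval_add [simp]: "rat_eval (p + q) x = rat_eval p x + rat_eval q x"
proof (induction p arbitrary: q)
  case (pCons a p)
  then show ?case
    by (cases q) (simp add: of_rat_add algebra_simps)
qed simp

lemma rat_eval_smult [simp]: "rat_eval (smult c p) x = of_rat c * rat_eval p x"
  by (induction p) (simp_all add: of_rat_mult algebra_simps)

lemma rat_eval_mult [simp]: "rat_eval (p * q) x = rat_eval p x * rat_eval q x"
  by (induction p) (simp_all add: algebra_simps)

lemma rat_eval_minus [simp]: "rat_eval (- p) x = - rat_eval p x"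
  using rat_eval_smult[of "-1" p x] by simp

lemma rat_eval_diff [simp]: "rat_eval (p - q) x = rat_eval p x - rat_eval q x"
  using rat_eval_add[of p "- q" x] by simp

lemma rat_eval_1 [simp]: "rat_eval 1 x = 1"
  by (simp add: one_pCons)

lemma rat_eval_power [simp]: "rat_eval (p ^ n) x = rat_eval p x ^ n"
  by (induction n) simp_all

text \<open>The cubic over the rationals, where division with remainder and greatest common divisors
  are available.\<close>

definition cubic_rat :: "int \<Rightarrow> rat poly" where
  "cubic_rat t = [:-1, - (of_int t + 3), - of_int t, 1:]"

lemma rat_eval_cubic_rat: "rat_eval (cubic_rat t) x = poly (simplest_cubic t) x"
  by (simp add: cubic_rat_def simplest_cubic_def of_rat_minus of_rat_add of_rat_diff)

text \<open>By the rational root theorem a root would be 1 or -1, but there the cubic takes the odd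
  value \<open>- (2 * t + 3)\<close> and the value 1.\<close>

lemma poly_cubic_rat_nonzero: "poly (cubic_rat t) r \<noteq> 0"
proof
  assume root: "poly (cubic_rat t) r = 0"
  obtain a b where ab: "quotient_of r = (a, b)"
    by fastforce
  then have b: "b > 0" "coprime a b" and r: "r = of_int a / of_int b"
    by (auto intro: quotient_of_denom_pos quotient_of_coprime quotient_of_div)
  have "r ^ 3 - of_int t * r ^ 2 - (of_int t + 3) * r - 1 = 0"
    using root by (simp add: cubic_rat_def algebra_simps power2_eq_square power3_eq_cube)
  then have "(r ^ 3 - of_int t * r ^ 2 - (of_int t + 3) * r - 1) * of_int b ^ 3 = 0"
    by simp
  then have "of_int (a ^ 3 - t * a ^ 2 * b - (t + 3) * a * b ^ 2 - b ^ 3) = (0 :: rat)"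
    using b(1) unfolding r by (simp add: field_simps power2_eq_square power3_eq_cube)
  then have eq: "a ^ 3 - t * a ^ 2 * b - (t + 3) * a * b ^ 2 - b ^ 3 = 0"
    by (simp only: of_int_eq_0_iff)
  have "b dvd a ^ 3"
  proof -
    have "a ^ 3 = b * (t * a ^ 2 + (t + 3) * a * b + b ^ 2)"
      using eq by (simp add: algebra_simps power2_eq_square power3_eq_cube)
    then show ?thesis
      by simp
  qed
  then have "is_unit b"
    using b(2) by (metis coprime_commute coprime_power_right_iff coprime_self coprime_absorb_left)
  have "a dvd b ^ 3"
  proof -
    have "b ^ 3 = a * (a ^ 2 - t * a * b - (t + 3) * b ^ 2)"
      using eq by (simp add: algebra_simps power2_eq_square power3_eq_cube)
    then show ?thesis
      by simp
  qed
  then have "is_unit a"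
    using \<open>is_unit b\<close> by (meson dvd_trans is_unit_power_iff)
  have "b = 1"
    using \<open>is_unit b\<close> b(1) by simp
  moreover have "a = 1 \<or> a = -1"
    using \<open>is_unit a\<close> by auto
  ultimately show False
    using eq by (auto simp: algebra_simps) presburger
qed

lemma rat_eval_theta_linear:
  assumes "rat_eval p (theta t) = 0" "degree p \<le> 1"
  shows "p = 0"
proof (rule ccontr)
  assume "p \<noteq> 0"
  obtain a b where p: "p = [:a, b:]"
    using assms(2) by (metis degree1_coeffs degree_0_id le_eq_less_or_eq less_one pCons_0_0)
  have eq: "of_rat a + theta t * of_rat b = 0"
    using assms(1) by (simp add: p)
  show False
  proof (cases "b = 0")
    case True
    with eq \<open>p \<noteq> 0\<close> show False
      by (simp add: p)
  next
    case False
    then have "theta t = of_rat (- a / b)"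
      using eq by (simp add: of_rat_divide of_rat_minus field_simps eq_neg_iff_add_eq_0)
    then have "rat_eval (cubic_rat t) (of_rat (- a / b)) = 0"
      using poly_simplest_cubic_theta[of t] by (simp add: rat_eval_cubic_rat)
    moreover have "rat_eval q (of_rat r) = of_rat (poly q r)" for q r
      by (induction q) (simp_all add: of_rat_add of_rat_mult)
    ultimately show False
      using poly_cubic_rat_nonzero[of t "- a / b"] by simp
  qed
qed

text \<open>The remainder of the cubic modulo such a quadratic vanishes at \<open>theta t\<close>
  and is linear, hence 0; the quadratic would then divide the cubic and leave a linear factor with a
  rational root.\<close>

lemma rat_eval_theta_quadratic:
  assumes "rat_eval p (theta t) = 0" "degree p \<le> 2"
  shows "p = 0"
proof (rule ccontr)
  assume "p \<noteq> 0"
  with rat_eval_theta_linear[OF assms(1)] assms(2) have deg: "degree p = 2"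
    by linarith
  let ?g = "cubic_rat t"
  have g: "?g = (?g div p) * p + ?g mod p"
    by simp
  have "rat_eval (?g mod p) (theta t) = 0"
    using assms(1) poly_simplest_cubic_theta[of t]
    unfolding minus_div_mult_eq_mod[symmetric] by (simp add: rat_eval_cubic_rat)
  moreover have "degree (?g mod p) \<le> 1"
    using degree_mod_less[OF \<open>p \<noteq> 0\<close>, of ?g] deg by auto
  ultimately have "?g mod p = 0"
    by (rule rat_eval_theta_linear)
  with g have gp: "?g = (?g div p) * p"
    by simp
  have "degree ?g = 3" "?g \<noteq> 0"
    by (simp_all add: cubic_rat_def)
  then have "degree (?g div p) = 1"
    using gp deg degree_mult_eq[of "?g div p" p] by (metis Suc_eq_plus1 \<open>p \<noteq> 0\<close> add_right_cancel mult_eq_0_iff numeral_2_eq_2 numeral_3_eq_3 One_nat_def add.commute plus_1_eq_Suc)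
  then obtain a b where ab: "?g div p = [:a, b:]" "b \<noteq> 0"
    by (metis degree1_coeffs)
  have "poly (?g div p) (- a / b) = 0"
    using ab by simp
  then have "poly ?g (- a / b) = 0"
    using gp by (metis mult_zero_left poly_mult)
  with poly_cubic_rat_nonzero show False
    by blast
qed

lemma cubic_rat_dvd_if_root:
  assumes "rat_eval p (theta t) = 0"
  shows "cubic_rat t dvd p"
proof -
  let ?g = "cubic_rat t"
  have "rat_eval (p mod ?g) (theta t) = 0"
    using assms poly_simplest_cubic_theta[of t]
    unfolding minus_div_mult_eq_mod[symmetric] by (simp add: rat_eval_cubic_rat)
  moreover have "degree (p mod ?g) \<le> 2"
    using degree_mod_less[of ?g p] by (auto simp: cubic_rat_def)
  ultimately have "p mod ?g = 0"
    by (rule rat_eval_theta_quadratic)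
  then show ?thesis
    by (simp add: mod_eq_0_iff_dvd)
qed

text \<open>\<open>gcd p ?g\<close> does not vanish at \<open>theta t\<close>, so its cofactor in
  \<open>?g\<close> does and is divisible by \<open>?g\<close>. Hence the gcd is a unit and Bezout
  gives the inverse.\<close>

lemma inverse_rat_eval_theta:
  assumes "rat_eval p (theta t) \<noteq> 0"
  obtains q where "inverse (rat_eval p (theta t)) = rat_eval q (theta t)"
proof -
  let ?g = "cubic_rat t"
  have g0: "rat_eval ?g (theta t) = 0"
    using poly_simplest_cubic_theta[of t] by (simp add: rat_eval_cubic_rat)
  obtain u v where uv: "u * p + v * ?g = gcd p ?g"
    using bezout_coefficients_fst_snd[of p ?g] by blast
  obtain w where w: "?g = gcd p ?g * w"
    using gcd_dvd2[of p ?g] by blast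
  have "rat_eval (gcd p ?g) (theta t) \<noteq> 0"
    using assms gcd_dvd1[of p ?g] by (metis dvdE mult_zero_left rat_eval_mult)
  then have "rat_eval w (theta t) = 0"
    using w g0 by (metis mult_eq_0_iff rat_eval_mult)
  then have "?g dvd w"
    by (rule cubic_rat_dvd_if_root)
  moreover have "?g \<noteq> 0"
    by (simp add: cubic_rat_def)
  ultimately have "is_unit (gcd p ?g)"
    using w by (metis dvd_mult_cancel_right dvd_refl mult.commute mult_eq_0_iff dvd_times_left_cancel_iff mult.right_neutral dvd_mult_cancel2 dvd_triv_left is_unit_gcd dvd_trans mult_dvd_mono one_dvd)
  then obtain z where "gcd p ?g * z = 1"
    by (metis dvdE)
  then have "rat_eval (u * p + v * ?g) (theta t) * rat_eval z (theta t) = 1"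
    unfolding uv by (metis rat_eval_1 rat_eval_mult)
  then have "rat_eval p (theta t) * rat_eval (u * z) (theta t) = 1"
    using g0 by (simp add: mult_ac)
  then show ?thesis
    using that[of "u * z"] by (metis inverse_unique)
qed

text \<open>Values of rational polynomials at \<open>theta t\<close> are already closed under
  inverses, so generating a field adds nothing to them.\<close>

lemma cubic_field_rat_eval:
  assumes "y \<in> cubic_field t"
  shows "\<exists>p. y = rat_eval p (theta t)"
proof -
  let ?R = "ring_of_type_algebra :: real ring"
  have carrier: "carrier ?R = UNIV" "\<one>\<^bsub>?R\<^esub> = 1" "\<zero>\<^bsub>?R\<^esub> = 0"
    and ops: "\<And>a b. a \<oplus>\<^bsub>?R\<^esub> b = a + b" "\<And>a b. a \<otimes>\<^bsub>?R\<^esub> b = a * b"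
    by (simp_all add: ring_of_type_algebra_def)
  have minus: "\<ominus>\<^bsub>?R\<^esub> a = - a" for a :: real
    unfolding a_inv_def m_inv_def by (rule the_equality) (auto simp: carrier ops)
  have inv: "inv\<^bsub>?R\<^esub> a = inverse a" if "a \<noteq> 0" for a :: real
    unfolding m_inv_def using that by (intro the_equality) (auto simp: carrier ops inverse_unique)
  show ?thesis
    using assms unfolding cubic_field_def
  proof (induction rule: generate_field.induct)
    case one
    then show ?case
      by (intro exI[of _ 1]) (simp add: carrier)
  next
    case (incl h)
    then consider "h \<in> \<rat>" | "h = theta t"
      by blast
    then show ?case
    proof cases
      case 1
      then obtain r where "h = of_rat r"
        by (auto elim: Rats_cases)
      then show ?thesis
        by (intro exI[of _ "[:r:]"]) simp
    next
      case 2
      then show ?thesis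
        by (intro exI[of _ "[:0, 1:]"]) simp
    qed
  next
    case (a_inv h)
    then show ?case
      unfolding minus by (metis rat_eval_minus)
  next
    case (m_inv h)
    then show ?case
      using inverse_rat_eval_theta inv carrier(3) by metis
  next
    case (eng_add h1 h2)
    then show ?case
      unfolding ops by (metis rat_eval_add)
  next
    case (eng_mult h1 h2)
    then show ?case
      unfolding ops by (metis rat_eval_mult)
  qed
qed

lemma int_square_if_rat_square:
  assumes "(s :: rat) ^ 2 = of_int N"
  obtains k :: int where "N = k ^ 2"
proof -
  obtain a b where ab: "quotient_of s = (a, b)"
    by fastforce
  then have b: "b > 0" "coprime a b" and s: "s = of_int a / of_int b"
    by (auto intro: quotient_of_denom_pos quotient_of_coprime quotient_of_div)
  have "of_int (a ^ 2) = (of_int (N * b ^ 2) :: rat)"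
    using assms b(1) unfolding s by (simp add: power_divide field_simps)
  then have eq: "a ^ 2 = N * b ^ 2"
    by (simp only: of_int_eq_iff)
  then have "b ^ 2 dvd a ^ 2"
    by simp
  moreover have "coprime (a ^ 2) (b ^ 2)"
    using b(2) by simp
  ultimately have "is_unit (b ^ 2)"
    by (metis coprime_absorb_right)
  then have "b ^ 2 = 1"
    using b(1) by simp
  with eq have "N = a ^ 2"
    by simp
  with that show ?thesis
    by blast
qed

section \<open>Points as polynomial identities, and their norms\<close>

definition curve_poly :: "nat \<Rightarrow> rat poly" where
  "curve_poly n = [:-1, 1:] ^ 3 - smult (of_nat n ^ 2) [:-1, 1:]"

lemma poly_curve_poly: "poly (curve_poly n) x = (x - 1) ^ 3 - of_nat n ^ 2 * (x - 1)"
  by (simp add: curve_poly_def algebra_simps)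

lemma rat_eval_curve_poly: "rat_eval (curve_poly n) x = (x - 1) ^ 3 - of_nat n ^ 2 * (x - 1)"
  unfolding curve_poly_def rat_eval_diff rat_eval_power rat_eval_smult
  by (simp add: of_rat_power of_rat_minus)

text \<open>Unlike the equation at \<open>theta t\<close>, an identity of rational polynomials can
  be evaluated at the conjugates of \<open>theta t\<close> and at rational points.\<close>

lemma curve_point_identity:
  assumes "Affine (theta t - 1) y \<in> curve_points n (cubic_field t)"
  obtains p h where "degree p \<le> 2" "p ^ 2 - curve_poly n = cubic_rat t * h"
proof -
  have y: "y \<in> cubic_field t" "y ^ 2 = (theta t - 1) ^ 3 - of_nat n ^ 2 * (theta t - 1)"
    using assms by (auto simp: curve_points_def)
  obtain q where q: "y = rat_eval q (theta t)"
    using cubic_field_rat_eval[OF y(1)] by blast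
  define p where "p = q mod cubic_rat t"
  have "rat_eval p (theta t) = y"
    using poly_simplest_cubic_theta[of t]
    unfolding p_def minus_div_mult_eq_mod[symmetric] by (simp add: rat_eval_cubic_rat q)
  then have "rat_eval (p ^ 2 - curve_poly n) (theta t) = 0"
    using y(2) by (simp add: power2_eq_square rat_eval_curve_poly)
  then have "cubic_rat t dvd p ^ 2 - curve_poly n"
    by (rule cubic_rat_dvd_if_root)
  moreover have "degree p \<le> 2"
    using degree_mod_less[of "cubic_rat t" q] by (auto simp: p_def cubic_rat_def)
  ultimately show ?thesis
    using that by blast
qed

lemma simplest_cubic_conjugates:
  obtains \<theta>\<^sub>0 \<theta>\<^sub>1 \<theta>\<^sub>2 :: real where
    "\<theta>\<^sub>0 + \<theta>\<^sub>1 + \<theta>\<^sub>2 = of_int t" "\<theta>\<^sub>0 * \<theta>\<^sub>1 + \<theta>\<^sub>0 * \<theta>\<^sub>2 + \<theta>\<^sub>1 * \<theta>\<^sub>2 = - (of_int t + 3)" "\<theta>\<^sub>0 * \<theta>\<^sub>1 * \<theta>\<^sub>2 = 1"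
proof -
  define x u where "x = theta t" and "u = real_of_int t"
  have g: "x ^ 3 - u * x ^ 2 - (u + 3) * x - 1 = 0"
    using poly_simplest_cubic_theta[of t] by (simp add: poly_simplest_cubic x_def u_def)
  \<comment> \<open>This is \<open>-1 / (1 + x)\<close> reduced modulo the cubic, the image of
    \<open>x\<close> under the order 3 map that permutes the roots.\<close>
  define y where "y = x ^ 2 - (u + 1) * x - 2"
  define z where "z = u - x - y"
  have "x * y + x * z + y * z + (u + 3) = (u + 1 - x) * (x ^ 3 - u * x ^ 2 - (u + 3) * x - 1)"
    by (simp add: y_def z_def algebra_simps power2_eq_square power3_eq_cube)
  then have "x * y + x * z + y * z = - (u + 3)"
    unfolding g by simp
  moreover have "x * y * z - 1 = - (1 + y) * (x ^ 3 - u * x ^ 2 - (u + 3) * x - 1)"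
    by (simp add: y_def z_def algebra_simps power2_eq_square power3_eq_cube)
  then have "x * y * z = 1"
    unfolding g by simp
  moreover have "x + y + z = u"
    by (simp add: z_def)
  ultimately show ?thesis
    using that by (simp add: u_def)
qed

text \<open>The form in the elementary symmetric functions shows that the norm of an element with
  rational coordinates is rational.\<close>

lemma norm_quadratic:
  fixes a b c x y z :: real
  assumes "e1 = x + y + z" "e2 = x * y + x * z + y * z" "e3 = x * y * z"
  shows "(a + b * x + c * x ^ 2) * (a + b * y + c * y ^ 2) * (a + b * z + c * z ^ 2) =
    a ^ 3 + a ^ 2 * b * e1 + a ^ 2 * c * (e1 ^ 2 - 2 * e2) + a * b ^ 2 * e2 + a * b * c * (e1 * e2 - 3 * e3)
    + a * c ^ 2 * (e2 ^ 2 - 2 * e1 * e3) + b ^ 3 * e3 + b ^ 2 * c * e1 * e3 + b * c ^ 2 * e2 * e3 + c ^ 3 * e3 ^ 2"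
  unfolding assms by (simp add: algebra_simps power2_eq_square power3_eq_cube)

lemma norm_is_square:
  assumes "Affine (theta t - 1) y \<in> curve_points n (cubic_field t)"
  obtains s :: int where
    "(2 * t + 3) * ((int n + 1) * (int n + 2) * t - int n ^ 3 - 3 * int n ^ 2 + 3)
      * ((int n - 1) * (int n - 2) * t + int n ^ 3 - 3 * int n ^ 2 + 3) = s ^ 2"
proof -
  obtain p h where deg: "degree p \<le> 2" and ph: "p ^ 2 - curve_poly n = cubic_rat t * h"
    using curve_point_identity[OF assms] by blast
  obtain a b c where p: "p = [:a, b, c:]"
  proof
    show "p = [:coeff p 0, coeff p 1, coeff p 2:]"
      using deg by (intro poly_eqI) (auto simp: coeff_pCons coeff_eq_0 numeral_2_eq_2 split: nat.split)
  qed
  obtain x y z :: real where xyz: "x + y + z = of_int t" "x * y + x * z + y * z = - (of_int t + 3)" "x * y * z = 1"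
    using simplest_cubic_conjugates by blast
  have root: "w ^ 3 - of_int t * w ^ 2 - (of_int t + 3) * w - 1 = (w - x) * (w - y) * (w - z)" for w
  proof -
    have "(w - x) * (w - y) * (w - z) =
        w ^ 3 - (x + y + z) * w ^ 2 + (x * y + x * z + y * z) * w - x * y * z"
      by (simp add: algebra_simps power2_eq_square power3_eq_cube)
    then show ?thesis
      unfolding xyz by (simp add: algebra_simps)
  qed
  have sq: "(of_rat a + of_rat b * w + of_rat c * w ^ 2) ^ 2 = (w - 1) ^ 3 - of_nat n ^ 2 * (w - 1)"
    if "w \<in> {x, y, z}" for w
  proof -
    have "rat_eval (cubic_rat t) w = 0"
      using that root[of w] by (auto simp: rat_eval_cubic_rat poly_simplest_cubic)
    then have "rat_eval (p ^ 2 - curve_poly n) w = 0"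
      unfolding ph by simp
    moreover have "rat_eval p w = of_rat a + of_rat b * w + of_rat c * w ^ 2"
      by (simp add: p power2_eq_square algebra_simps)
    ultimately show ?thesis
      by (simp add: rat_eval_curve_poly)
  qed
  \<comment> \<open>The norm of \<open>p\<close> at the conjugates, written with the symmetric
    functions of the roots, whose product is 1.\<close>
  define N :: rat where "N = (let e1 = of_int t; e2 = - (of_int t + 3) in
     a ^ 3 + a ^ 2 * b * e1 + a ^ 2 * c * (e1 ^ 2 - 2 * e2) + a * b ^ 2 * e2 + a * b * c * (e1 * e2 - 3 * 1)
    + a * c ^ 2 * (e2 ^ 2 - 2 * e1 * 1) + b ^ 3 * 1 + b ^ 2 * c * e1 * 1 + b * c ^ 2 * e2 * 1 + c ^ 3 * 1 ^ 2)"
  have N: "of_rat N = (of_rat a + of_rat b * x + of_rat c * x ^ 2) * (of_rat a + of_rat b * y + of_rat c * y ^ 2)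
      * (of_rat a + of_rat b * z + of_rat c * z ^ 2)"
    unfolding norm_quadratic[OF xyz(1)[symmetric] xyz(2)[symmetric] xyz(3)[symmetric]] N_def Let_def
    by (simp add: of_rat_add of_rat_diff of_rat_mult of_rat_minus of_rat_power)
  have "of_rat (N ^ 2) = of_rat N ^ (2::nat)"
    by (simp add: of_rat_power)
  also have "\<dots> = ((x - 1) ^ 3 - of_nat n ^ 2 * (x - 1)) * ((y - 1) ^ 3 - of_nat n ^ 2 * (y - 1))
      * ((z - 1) ^ 3 - of_nat n ^ 2 * (z - 1))"
    unfolding N power_mult_distrib using sq by simp
  also have "\<dots> = - ((1 - x) * (1 + of_nat n - x) * (1 - of_nat n - x)) * - ((1 - y) * (1 + of_nat n - y) * (1 - of_nat n - y))
      * - ((1 - z) * (1 + of_nat n - z) * (1 - of_nat n - z))"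
  proof -
    have "(w - 1) ^ 3 - of_nat n ^ 2 * (w - 1) = - ((1 - w) * (1 + of_nat n - w) * (1 - of_nat n - w))" for w :: real
      by (simp add: algebra_simps power2_eq_square power3_eq_cube)
    then show ?thesis
      by simp
  qed
  \<comment> \<open>Regrouping by the zeros 1, \<open>1 + n\<close> and \<open>1 - n\<close> of the
    curve polynomial gives minus the product of the values of the cubic there.\<close>
  also have "\<dots> = - (((1 - x) * (1 - y) * (1 - z)) * ((1 + of_nat n - x) * (1 + of_nat n - y) * (1 + of_nat n - z))
      * ((1 - of_nat n - x) * (1 - of_nat n - y) * (1 - of_nat n - z)))"
    by (simp add: mult_ac)
  also have "\<dots> = of_int ((2 * t + 3) * ((int n + 1) * (int n + 2) * t - int n ^ 3 - 3 * int n ^ 2 + 3)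
      * ((int n - 1) * (int n - 2) * t + int n ^ 3 - 3 * int n ^ 2 + 3))"
    unfolding root[symmetric] by (simp add: algebra_simps power2_eq_square power3_eq_cube)
  finally have "of_rat (N ^ 2) = (of_rat (of_int ((2 * t + 3) * ((int n + 1) * (int n + 2) * t - int n ^ 3 - 3 * int n ^ 2 + 3)
      * ((int n - 1) * (int n - 2) * t + int n ^ 3 - 3 * int n ^ 2 + 3))) :: real)"
    by (simp only: of_rat_of_int_eq)
  then show ?thesis
    using int_square_if_rat_square that by (metis of_rat_eq_iff)
qed

text \<open>The cubic changes sign between -2 and -1. At the conjugate \<open>x\<close> found there,
  \<open>x - 1 < -2 \<le> -n\<close>, so the right-hand side of the curve equation is negative,
  while the identity makes it a real square.\<close>

lemma no_curve_point_if_le_2: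
  assumes "t \<ge> -1" "n \<le> 2"
  shows "Affine (theta t - 1) y \<notin> curve_points n (cubic_field t)"
proof
  assume "Affine (theta t - 1) y \<in> curve_points n (cubic_field t)"
  then obtain p h where ph: "p ^ 2 - curve_poly n = cubic_rat t * h"
    using curve_point_identity by blast
  have "poly (simplest_cubic t) (-2) < 0" "poly (simplest_cubic t) (-1) > 0"
    using assms(1) by (simp_all add: poly_simplest_cubic)
  then obtain x where x: "-2 < x" "x < -1" "poly (simplest_cubic t) x = 0"
    using poly_IVT_pos[of "-2" "-1" "simplest_cubic t"] by auto
  have "rat_eval (p ^ 2 - curve_poly n) x = 0"
    unfolding ph by (simp add: rat_eval_cubic_rat x(3))
  then have "(x - 1) ^ 3 - of_nat n ^ 2 * (x - 1) = rat_eval p x ^ 2"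
    by (simp add: rat_eval_curve_poly power2_eq_square)
  then have "(x - 1) * ((x - 1) ^ 2 - of_nat n ^ 2) \<ge> 0"
    by (simp add: algebra_simps power2_eq_square power3_eq_cube)
  moreover have "(real n) ^ 2 < (1 - x) ^ 2"
    using assms(2) x(2) by (intro power_strict_mono) auto
  then have "(x - 1) ^ 2 - of_nat n ^ 2 > 0"
    by (simp add: power2_commute)
  then have "(x - 1) * ((x - 1) ^ 2 - of_nat n ^ 2) < 0"
    using x(2) by (intro mult_neg_pos) auto
  ultimately show False
    by simp
qed

text \<open>Both sides have degree at most 4, so the cofactor of the cubic is linear; the
  coefficients of degree 4 and 3 determine it.\<close>

lemma curve_point_coefficients:
  assumes "Affine (theta t - 1) y \<in> curve_points n (cubic_field t)"
  obtains a b c :: rat where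
    "\<And>x. (a + b * x + c * x ^ 2) ^ 2 - ((x - 1) ^ 3 - of_nat n ^ 2 * (x - 1)) =
      (x ^ 3 - of_int t * x ^ 2 - (of_int t + 3) * x - 1) * (2 * b * c - 1 + of_int t * c ^ 2 + c ^ 2 * x)"
proof -
  obtain p h where deg: "degree p \<le> 2" and ph: "p ^ 2 - curve_poly n = cubic_rat t * h"
    using curve_point_identity[OF assms] by blast
  obtain a b c where p: "p = [:a, b, c:]"
  proof
    show "p = [:coeff p 0, coeff p 1, coeff p 2:]"
      using deg by (intro poly_eqI) (auto simp: coeff_pCons coeff_eq_0 numeral_2_eq_2 split: nat.split)
  qed
  have "degree (p ^ 2) \<le> 4"
    using deg by (simp add: degree_power_eq order_trans[OF degree_power_le])
  moreover have "degree (curve_poly n) \<le> 4"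
    unfolding curve_poly_def by (intro degree_diff_le) (auto intro: order_trans[OF degree_power_le])
  ultimately have "degree (cubic_rat t * h) \<le> 4"
    unfolding ph[symmetric] by (rule degree_diff_le)
  moreover have "degree (cubic_rat t) = 3" "cubic_rat t \<noteq> 0"
    by (simp_all add: cubic_rat_def)
  ultimately have "degree h \<le> 1"
    by (cases "h = 0") (auto simp: degree_mult_eq)
  then obtain e f where h: "h = [:e, f:]"
    by (metis degree1_coeffs degree_0_id le_eq_less_or_eq less_one pCons_0_0)
  have "coeff (p ^ 2 - curve_poly n) 4 = coeff (cubic_rat t * h) 4"
    "coeff (p ^ 2 - curve_poly n) 3 = coeff (cubic_rat t * h) 3"
    by (simp_all only: ph)
  then have "f = c ^ 2" "2 * b * c - 1 = e - of_int t * f"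
    by (simp_all add: p h curve_poly_def cubic_rat_def power2_eq_square power3_eq_cube eval_nat_numeral algebra_simps)
  then have e: "e = 2 * b * c - 1 + of_int t * c ^ 2" and f: "f = c ^ 2"
    by (simp_all add: algebra_simps)
  show ?thesis
  proof (rule that)
    fix x
    have "poly (p ^ 2 - curve_poly n) x = poly (cubic_rat t * h) x"
      by (simp only: ph)
    moreover have "poly p x = a + b * x + c * x ^ 2"
      by (simp add: p algebra_simps power2_eq_square)
    moreover have "poly (cubic_rat t) x = x ^ 3 - of_int t * x ^ 2 - (of_int t + 3) * x - 1"
      by (simp add: cubic_rat_def algebra_simps power2_eq_square power3_eq_cube)
    moreover have "poly h x = 2 * b * c - 1 + of_int t * c ^ 2 + c ^ 2 * x"
      by (simp add: h e f)
    ultimately show "(a + b * x + c * x ^ 2) ^ 2 - ((x - 1) ^ 3 - of_nat n ^ 2 * (x - 1)) =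
      (x ^ 3 - of_int t * x ^ 2 - (of_int t + 3) * x - 1) * (2 * b * c - 1 + of_int t * c ^ 2 + c ^ 2 * x)"
      by (simp add: poly_curve_poly)
  qed
qed

section \<open>The curves for n = 5 and n = 6\<close>

lemma square_mod_3: "(x :: int) ^ 2 mod 3 = (if 3 dvd x then 0 else 1)"
proof -
  have step: "x ^ 2 mod 3 = (x mod 3) ^ 2 mod 3"
    by (simp add: power_mod)
  have "x mod 3 = 0 \<or> x mod 3 = 1 \<or> x mod 3 = 2"
    by presburger
  then show ?thesis
    unfolding step dvd_eq_mod_eq_0 by (elim disjE) simp_all
qed

lemma square_mod_4: "(x :: int) ^ 2 mod 4 = 0 \<or> x ^ 2 mod 4 = 1"
proof -
  have step: "x ^ 2 mod 4 = (x mod 4) ^ 2 mod 4"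
    by (simp add: power_mod)
  have "x mod 4 = 0 \<or> x mod 4 = 1 \<or> x mod 4 = 2 \<or> x mod 4 = 3"
    by presburger
  then show ?thesis
    unfolding step dvd_eq_mod_eq_0 by (elim disjE) simp_all
qed

lemma square_mod_5: "(x :: int) ^ 2 mod 5 = 0 \<and> 5 dvd x \<or> x ^ 2 mod 5 = 1 \<or> x ^ 2 mod 5 = 4"
proof -
  have step: "x ^ 2 mod 5 = (x mod 5) ^ 2 mod 5"
    by (simp add: power_mod)
  have "x mod 5 = 0 \<or> x mod 5 = 1 \<or> x mod 5 = 2 \<or> x mod 5 = 3 \<or> x mod 5 = 4"
    by presburger
  then show ?thesis
    unfolding step dvd_eq_mod_eq_0 by (elim disjE) simp_all
qed

lemma square_mod_7: "(x :: int) ^ 2 mod 7 \<in> {0, 1, 2, 4}"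
proof -
  have step: "x ^ 2 mod 7 = (x mod 7) ^ 2 mod 7"
    by (simp add: power_mod)
  have "x mod 7 = 0 \<or> x mod 7 = 1 \<or> x mod 7 = 2 \<or> x mod 7 = 3 \<or> x mod 7 = 4 \<or> x mod 7 = 5 \<or> x mod 7 = 6"
    by presburger
  then show ?thesis
    unfolding step dvd_eq_mod_eq_0 by (elim disjE) simp_all
qed

lemma square_mod_8: "(x :: int) ^ 2 mod 8 \<in> {0, 1, 4}"
proof -
  have step: "x ^ 2 mod 8 = (x mod 8) ^ 2 mod 8"
    by (simp add: power_mod)
  have "x mod 8 = 0 \<or> x mod 8 = 1 \<or> x mod 8 = 2 \<or> x mod 8 = 3 \<or> x mod 8 = 4 \<or> x mod 8 = 5 \<or> x mod 8 = 6 \<or> x mod 8 = 7"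
    by presburger
  then show ?thesis
    unfolding step dvd_eq_mod_eq_0 by (elim disjE) simp_all
qed

lemma not_square_between:
  fixes m N k :: int
  assumes "m \<ge> 0" "m ^ 2 < N" "N < (m + 1) ^ 2"
  shows "N \<noteq> k ^ 2"
proof
  assume "N = k ^ 2"
  then have "m ^ 2 < \<bar>k\<bar> ^ 2" "\<bar>k\<bar> ^ 2 < (m + 1) ^ 2"
    using assms by simp_all
  then have "m < \<bar>k\<bar>" "\<bar>k\<bar> < m + 1"
    using assms(1) by (meson abs_ge_zero power2_less_imp_less add_nonneg_nonneg zero_le_one)+
  then show False
    by simp
qed

text \<open>Descent on the common denominator \<open>D\<close>. Modulo 5 the cubic is
  \<open>(x - 1) * (x - 2) * (x + 2)\<close>. If 5 divides \<open>D\<close>, the quadratic vanishes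
  modulo 5 at three points, so all its coefficients are divisible by 5 and the relation can be
  divided by 25. Otherwise \<open>x = -2\<close> gives a contradiction.\<close>

lemma no_integral_relation_5:
  fixes \<alpha> \<beta> \<gamma> D t :: int
  assumes "D \<noteq> 0" and t: "5 dvd 2 * t + 3"
    and eq: "\<And>x. (\<alpha> + \<beta> * x + \<gamma> * x ^ 2) ^ 2 - D ^ 2 * ((x - 1) ^ 3 - 25 * (x - 1)) =
      (x ^ 3 - t * x ^ 2 - (t + 3) * x - 1) * (2 * \<beta> * \<gamma> - D ^ 2 + t * \<gamma> ^ 2 + \<gamma> ^ 2 * x)"
  shows False
  using assms
proof (induction "nat \<bar>D\<bar>" arbitrary: \<alpha> \<beta> \<gamma> D rule: less_induct)
  case less
  note eq = less.prems(3)
  have square_dvd: "5 dvd x" if "5 dvd x ^ 2" for x :: int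
    using square_mod_5[of x] that by auto
  show False
  proof (cases "5 dvd D")
    case True
    have root: "5 dvd \<alpha> + \<beta> * x + \<gamma> * x ^ 2" if "5 dvd x ^ 3 - t * x ^ 2 - (t + 3) * x - 1" for x
    proof (rule square_dvd)
      have "(\<alpha> + \<beta> * x + \<gamma> * x ^ 2) ^ 2 = D ^ 2 * ((x - 1) ^ 3 - 25 * (x - 1)) +
          (x ^ 3 - t * x ^ 2 - (t + 3) * x - 1) * (2 * \<beta> * \<gamma> - D ^ 2 + t * \<gamma> ^ 2 + \<gamma> ^ 2 * x)"
        using eq[of x] by simp
      also have "5 dvd \<dots>"
        using True that by (intro dvd_add) (auto simp: power2_eq_square)
      finally show "5 dvd (\<alpha> + \<beta> * x + \<gamma> * x ^ 2) ^ 2" .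
    qed
    obtain r where r: "2 * t + 3 = 5 * r"
      using t by blast
    have "5 dvd \<alpha> + \<beta> + \<gamma>"
    proof -
      have "1 ^ 3 - t * 1 ^ 2 - (t + 3) * 1 - 1 = 5 * - r"
        using r by simp
      then show ?thesis
        using root[of 1] by simp
    qed
    then obtain k1 where k1: "\<alpha> + \<beta> + \<gamma> = 5 * k1"
      by blast
    have "5 dvd \<alpha> + 2 * \<beta> + 4 * \<gamma>"
    proof -
      have "2 ^ 3 - t * 2 ^ 2 - (t + 3) * 2 - 1 = 5 * (2 - 3 * r)"
        using r by simp
      then show ?thesis
        using root[of 2] by (simp add: mult_ac)
    qed
    then obtain k2 where k2: "\<alpha> + 2 * \<beta> + 4 * \<gamma> = 5 * k2"
      by blast
    have "5 dvd \<alpha> - 2 * \<beta> + 4 * \<gamma>"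
    proof -
      have "(-2) ^ 3 - t * (-2) ^ 2 - (t + 3) * (-2) - 1 = 5 * - r"
        using r by simp
      then show ?thesis
        using root[of "-2"] by (simp add: mult_ac)
    qed
    then obtain k3 where k3: "\<alpha> - 2 * \<beta> + 4 * \<gamma> = 5 * k3"
      by blast
    \<comment> \<open>\<open>m\<close> and \<open>w\<close> are \<open>\<beta> / 5\<close> and
      \<open>\<gamma> / 5\<close>, obtained by solving the Vandermonde system for the values at 1, 2
      and -2.\<close>
    define m where "m = \<beta> - k2 + k3"
    define w where "w = 2 * (k2 - k1 - m) - \<gamma>"
    have "5 * m = 5 * \<beta> - 5 * k2 + 5 * k3"
      by (simp add: m_def)
    then have m: "5 * m = \<beta>"
      unfolding k2[symmetric] k3[symmetric] by simp
    have "5 * w = 2 * (5 * k2) - 2 * (5 * k1) - 2 * (5 * m) - 5 * \<gamma>"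
      by (simp add: w_def)
    then have w: "5 * w = \<gamma>"
      unfolding k1[symmetric] k2[symmetric] m by simp
    have "5 * (k1 - m - w) = 5 * k1 - 5 * m - 5 * w"
      by simp
    then have "5 * (k1 - m - w) = \<alpha>"
      unfolding k1[symmetric] m w by simp
    with m w have "5 dvd \<alpha> \<and> 5 dvd \<beta> \<and> 5 dvd \<gamma>"
      by (metis dvd_triv_left)
    then obtain \<alpha>' \<beta>' \<gamma>' D' where d: "\<alpha> = 5 * \<alpha>'" "\<beta> = 5 * \<beta>'" "\<gamma> = 5 * \<gamma>'" "D = 5 * D'"
      using True by (elim dvdE conjE) blast
    show False
    proof (rule less.hyps[of D' \<alpha>' \<beta>' \<gamma>'])
      show "nat \<bar>D'\<bar> < nat \<bar>D\<bar>" "D' \<noteq> 0"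
        using less.prems(1) by (auto simp: d)
      fix x
      have "25 * ((\<alpha>' + \<beta>' * x + \<gamma>' * x ^ 2) ^ 2 - D' ^ 2 * ((x - 1) ^ 3 - 25 * (x - 1))) =
          25 * ((x ^ 3 - t * x ^ 2 - (t + 3) * x - 1) * (2 * \<beta>' * \<gamma>' - D' ^ 2 + t * \<gamma>' ^ 2 + \<gamma>' ^ 2 * x))"
        using eq[of x] unfolding d by (simp add: algebra_simps power2_eq_square)
      then show "(\<alpha>' + \<beta>' * x + \<gamma>' * x ^ 2) ^ 2 - D' ^ 2 * ((x - 1) ^ 3 - 25 * (x - 1)) =
          (x ^ 3 - t * x ^ 2 - (t + 3) * x - 1) * (2 * \<beta>' * \<gamma>' - D' ^ 2 + t * \<gamma>' ^ 2 + \<gamma>' ^ 2 * x)"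
        by simp
    qed (rule t)
  next
    case False
    define q where "q = (\<alpha> - 2 * \<beta> + 4 * \<gamma>) ^ 2"
    \<comment> \<open>At -2 the cubic is \<open>- (2 * t + 3)\<close>, divisible by 5, and the curve
      polynomial is 48, congruent to the nonresidue 3.\<close>
    have "q - 48 * D ^ 2 = - (2 * t + 3) * (2 * \<beta> * \<gamma> - D ^ 2 + t * \<gamma> ^ 2 + \<gamma> ^ 2 * (- 2))"
      using eq[of "-2"] by (simp add: q_def algebra_simps)
    then have "5 dvd q - 48 * D ^ 2"
      using t by (metis dvd_minus_iff dvd_mult2)
    moreover have "q mod 5 = 0 \<or> q mod 5 = 1 \<or> q mod 5 = 4"
      unfolding q_def using square_mod_5[of "\<alpha> - 2 * \<beta> + 4 * \<gamma>"] by blast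
    moreover have "D ^ 2 mod 5 = 1 \<or> D ^ 2 mod 5 = 4"
      using square_mod_5[of D] False by blast
    ultimately show False
      by presburger
  qed
qed

lemma rat_as_quotient:
  fixes r :: rat
  obtains a b :: int where "r = of_int a / of_int b" "b > 0"
proof -
  obtain a b where "quotient_of r = (a, b)"
    by fastforce
  then show ?thesis
    using that quotient_of_div quotient_of_denom_pos by blast
qed

lemma curve_point_5_not_dvd:
  assumes "Affine (theta t - 1) y \<in> curve_points 5 (cubic_field t)"
  shows "\<not> 5 dvd 2 * t + 3"
proof
  assume t: "5 dvd 2 * t + 3"
  obtain a b c :: rat where eq: "\<And>x. (a + b * x + c * x ^ 2) ^ 2 - ((x - 1) ^ 3 - of_nat 5 ^ 2 * (x - 1)) =
      (x ^ 3 - of_int t * x ^ 2 - (of_int t + 3) * x - 1) * (2 * b * c - 1 + of_int t * c ^ 2 + c ^ 2 * x)"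
    by (rule curve_point_coefficients[OF assms]) blast
  obtain a1 a2 where a: "a = of_int a1 / of_int a2" "a2 > 0"
    by (rule rat_as_quotient)
  obtain b1 b2 where b: "b = of_int b1 / of_int b2" "b2 > 0"
    by (rule rat_as_quotient)
  obtain c1 c2 where c: "c = of_int c1 / of_int c2" "c2 > 0"
    by (rule rat_as_quotient)
  define D \<alpha> \<beta> \<gamma> where "D = a2 * b2 * c2" and "\<alpha> = a1 * b2 * c2" and "\<beta> = a2 * b1 * c2" and "\<gamma> = a2 * b2 * c1"
  have D: "D \<noteq> 0"
    using a b c by (simp add: D_def)
  have abc: "of_int \<alpha> = of_int D * a" "of_int \<beta> = of_int D * b" "of_int \<gamma> = of_int D * c"
    using a(2) b(2) c(2) by (simp_all add: \<alpha>_def \<beta>_def \<gamma>_def D_def a(1) b(1) c(1))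
  show False
  proof (rule no_integral_relation_5[OF D t])
    fix x :: int
    have "of_int ((\<alpha> + \<beta> * x + \<gamma> * x ^ 2) ^ 2 - D ^ 2 * ((x - 1) ^ 3 - 25 * (x - 1))) =
        of_int D ^ 2 * ((a + b * of_int x + c * of_int x ^ 2) ^ 2 - ((of_int x - 1) ^ 3 - of_nat 5 ^ 2 * (of_int x - 1)))"
      by (simp add: abc algebra_simps power2_eq_square)
    also have "\<dots> = of_int ((x ^ 3 - t * x ^ 2 - (t + 3) * x - 1) * (2 * \<beta> * \<gamma> - D ^ 2 + t * \<gamma> ^ 2 + \<gamma> ^ 2 * x))"
      unfolding eq by (simp add: abc algebra_simps power2_eq_square)
    finally show "(\<alpha> + \<beta> * x + \<gamma> * x ^ 2) ^ 2 - D ^ 2 * ((x - 1) ^ 3 - 25 * (x - 1)) =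
      (x ^ 3 - t * x ^ 2 - (t + 3) * x - 1) * (2 * \<beta> * \<gamma> - D ^ 2 + t * \<gamma> ^ 2 + \<gamma> ^ 2 * x)"
      by (simp only: of_int_eq_iff)
  qed
qed

text \<open>Eliminates \<open>t\<close> when \<open>x\<close>, \<open>y\<close>, \<open>z\<close>
  are linear in it: modulo \<open>x\<close> the multiples \<open>a * y\<close> and
  \<open>c * z\<close> are the constants \<open>b\<close> and \<open>e\<close>.\<close>

lemma dvd_if_cong_product:
  fixes d a b :: int
  assumes "d dvd x" "d dvd y * z" "a * y = x * u + b" "c * z = x * v + e"
  shows "d dvd b * e"
proof -
  have "b * e = (a * y - x * u) * (c * z - x * v)"
    using assms(3,4) by simp
  also have "\<dots> = a * c * (y * z) - x * (a * y * v + c * z * u - x * u * v)"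
    by (simp add: algebra_simps)
  also have "d dvd \<dots>"
    using assms(1,2) by (intro dvd_diff dvd_mult[of d "y * z"] dvd_mult2[of d x])
  finally show ?thesis .
qed

lemma dvd_cancel_prime:
  fixes p d m :: int
  assumes "prime p" "\<not> p dvd d" "d dvd p * m"
  shows "d dvd m"
  using assms prime_imp_coprime[of p d] by (simp add: coprime_commute coprime_dvd_mult_right_iff)

lemma dvd_prime_mult_cases:
  fixes p d m :: int
  assumes "prime p" "d dvd p * m"
  obtains "d dvd m" | d' where "d = p * d'" "d' dvd m"
proof (cases "p dvd d")
  case True
  then obtain d' where "d = p * d'"
    by blast
  then show ?thesis
    using assms that(2) by auto
next
  case False
  then show ?thesis
    using dvd_cancel_prime assms that(1) by blast
qed

lemma pos_dvd_product_of_primes: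
  fixes d p q :: int
  assumes "prime p" "prime q" "d dvd p * q" "d > 0"
  shows "d \<in> {1, p, q, p * q}"
proof -
  have *: "x \<in> {1, q}" if "x dvd q" "x > 0" for x
  proof -
    have "x dvd q * 1"
      using that by simp
    then show ?thesis
      using assms(2) that(2)
      by (elim dvd_prime_mult_cases[rotated]) (auto simp: zero_less_mult_iff dest: prime_gt_0_int)
  qed
  from assms(1,3) show ?thesis
  proof (cases rule: dvd_prime_mult_cases)
    case 1
    then show ?thesis
      using * assms(4) by auto
  next
    case (2 d')
    then have "d' > 0"
      using assms(4) prime_gt_0_int[OF assms(1)] by (simp add: zero_less_mult_iff)
    then show ?thesis
      using *[of d'] 2 by auto
  qed
qed

lemma int_primes: "prime (2 :: int)" "prime (3 :: int)" "prime (5 :: int)" "prime (7 :: int)"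
  "prime (13 :: int)" "prime (17 :: int)"
  by (simp_all add: prime_int_numeral_eq)

lemma mult_mod_mod: "(a * b) mod m = ((a mod m) * (b mod m)) mod m" for a b m :: int
  by (simp add: mod_mult_eq)

lemma mult_square_mod_3: "(a * x ^ 2) mod 3 = 0 \<or> (a * x ^ 2) mod 3 = a mod 3" for a x :: int
  unfolding mult_mod_mod[of a] using square_mod_3[of x] by (cases "3 dvd x") simp_all

lemma mult_square_mod_4: "(a * x ^ 2) mod 4 = 0 \<or> (a * x ^ 2) mod 4 = a mod 4" for a x :: int
  unfolding mult_mod_mod[of a] using square_mod_4[of x] by (elim disjE) simp_all

text \<open>Elimination and congruences force the squarefree parts 17 of \<open>C\<close> and 13 of
  \<open>A\<close>. Then \<open>221 * B\<close> is a square, so 17 divides \<open>B\<close> as well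
  as \<open>C = 6 * B + 35\<close>, and hence 35.\<close>

lemma no_square_5:
  fixes t s :: int
  assumes t: "t \<ge> -1" and not5: "\<not> 5 dvd 2 * t + 3"
  shows "(2 * t + 3) * (42 * t - 197) * (12 * t + 53) \<noteq> s ^ 2"
proof
  define A B C where "A = 42 * t - 197" and "B = 2 * t + 3" and "C = 12 * t + 53"
  assume "(2 * t + 3) * (42 * t - 197) * (12 * t + 53) = s ^ 2"
  then have s: "B * A * C = s ^ 2"
    by (simp add: A_def B_def C_def)
  have pos: "B > 0" "C > 0"
    using t by (simp_all add: B_def C_def)
  have "A > 0"
  proof (rule ccontr)
    assume "\<not> A > 0"
    moreover have "A \<noteq> 0"
      unfolding A_def by presburger
    ultimately have "A * (B * C) < 0"
      using pos by (intro mult_neg_pos) auto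
    moreover have "A * (B * C) = s ^ 2"
      using s by (simp only: mult_ac)
    ultimately show False
      by simp
  qed
  define d r where "d = squarefree_part C" and "r = square_part C"
  define e q where "e = squarefree_part A" and "q = square_part A"
  have C: "C = d * r ^ 2" and A: "A = e * q ^ 2"
    unfolding d_def e_def r_def q_def by (rule squarefree_decompose)+
  have d0: "d > 0" "e > 0"
    unfolding d_def e_def using pos \<open>A > 0\<close> by (auto intro: squarefree_part_pos)
  have dC: "d dvd C" and eA: "e dvd A"
    by (subst C, simp) (subst A, simp)

  have "d = 17"
  proof -
    have "d dvd B * A"
      unfolding d_def by (rule squarefree_part_dvd_of_square_product[where s = s]) (use s in \<open>simp add: mult_ac\<close>)
    \<comment> \<open>From \<open>6 * B = C - 35\<close> and
      \<open>2 * A = 7 * C - 765\<close>.\<close>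
    then have "d dvd (-35) * (-765)"
      by (rule dvd_if_cong_product[OF dC, where a = 6 and u = 1 and c = 2 and v = 7]) (simp_all add: A_def B_def C_def)
    then have *: "d dvd 3 * (3 * (5 * (5 * (7 * 17))))"
      by simp
    have "\<not> 3 dvd C" "\<not> 5 dvd C"
      using not5 unfolding C_def by presburger+
    then have "\<not> 3 dvd d" "\<not> 5 dvd d"
      using dC dvd_trans by blast+
    with * have "d dvd 7 * 17"
      using int_primes dvd_cancel_prime by metis
    then have "d \<in> {1, 7, 17, 7 * 17}"
      using d0 int_primes by (intro pos_dvd_product_of_primes)
    moreover have "d \<noteq> 1"
    proof
      assume "d = 1"
      then have "r ^ 2 mod 3 = C mod 3"
        using C by (metis mult_1)
      moreover have "C mod 3 = 2"
        unfolding C_def by presburger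
      ultimately show False
        using square_mod_3[of r] by (auto split: if_splits)
    qed
    moreover have "d \<noteq> 7" "d \<noteq> 119"
    proof -
      have "C mod 4 = 1"
        unfolding C_def by presburger
      moreover have "(7 * r ^ 2) mod 4 \<noteq> 1" "(119 * r ^ 2) mod 4 \<noteq> 1"
        using mult_square_mod_4[of 7 r] mult_square_mod_4[of 119 r] by auto
      ultimately have "C \<noteq> 7 * r ^ 2" "C \<noteq> 119 * r ^ 2"
        by metis+
      then show "d \<noteq> 7" "d \<noteq> 119"
        using C by metis+
    qed
    ultimately show ?thesis
      by auto
  qed

  have "e = 13"
  proof -
    have "e dvd B * C"
      unfolding e_def by (rule squarefree_part_dvd_of_square_product[where s = s]) (use s in \<open>simp add: mult_ac\<close>)
    \<comment> \<open>From \<open>21 * B = A + 260\<close> and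
      \<open>7 * C = 2 * A + 765\<close>.\<close>
    then have "e dvd 260 * 765"
      by (rule dvd_if_cong_product[OF eA, where a = 21 and u = 1 and c = 7 and v = 2]) (simp_all add: A_def B_def C_def)
    then have *: "e dvd 2 * (2 * (3 * (3 * (5 * (5 * (13 * 17))))))"
      by simp
    have "A = (2 * t + 3) + 5 * (8 * t - 40)"
      by (simp add: A_def)
    then have "\<not> 5 dvd A"
      using not5 by (metis dvd_add_left_iff dvd_triv_left)
    moreover have "\<not> 2 dvd A" "\<not> 3 dvd A"
      unfolding A_def by presburger+
    ultimately have "\<not> 2 dvd e" "\<not> 3 dvd e" "\<not> 5 dvd e"
      using eA dvd_trans by blast+
    with * have "e dvd 13 * 17"
      using int_primes dvd_cancel_prime by metis
    then have "e \<in> {1, 13, 17, 13 * 17}"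
      using d0 int_primes by (intro pos_dvd_product_of_primes)
    moreover have "e \<noteq> 1"
    proof
      assume "e = 1"
      then have "q ^ 2 mod 7 = A mod 7"
        using A by (metis mult_1)
      moreover have "A mod 7 = 6"
        unfolding A_def by presburger
      ultimately show False
        using square_mod_7[of q] by auto
    qed
    moreover have "e \<noteq> 17" "e \<noteq> 221"
    proof -
      have "A mod 3 = 1"
        unfolding A_def by presburger
      moreover have "(17 * q ^ 2) mod 3 \<noteq> 1" "(221 * q ^ 2) mod 3 \<noteq> 1"
        using mult_square_mod_3[of 17 q] mult_square_mod_3[of 221 q] by auto
      ultimately have "A \<noteq> 17 * q ^ 2" "A \<noteq> 221 * q ^ 2"
        by metis+
      then show "e \<noteq> 17" "e \<noteq> 221"
        using A by metis+
    qed
    ultimately show ?thesis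
      by auto
  qed

  have "q \<noteq> 0" "r \<noteq> 0"
    using A C \<open>A > 0\<close> pos by auto
  have "(q * r) ^ 2 * (221 * B) = s ^ 2"
    using s unfolding A C \<open>d = 17\<close> \<open>e = 13\<close> by (simp add: power_mult_distrib mult_ac)
  then have "q * r dvd s"
    by (metis dvd_triv_left pow_divides_pow_iff zero_less_numeral)
  then obtain k where "s = (q * r) * k"
    by blast
  then have k: "221 * B = k ^ 2"
    using \<open>(q * r) ^ 2 * (221 * B) = s ^ 2\<close> \<open>q \<noteq> 0\<close> \<open>r \<noteq> 0\<close> by (simp add: power_mult_distrib)
  have "k ^ 2 = 17 * (13 * B)"
    using k by simp
  then have "17 dvd k ^ 2"
    by simp
  then have "17 dvd k"
    using int_primes(6) prime_dvd_power by blast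
  then obtain l where "k = 17 * l"
    by blast
  then have "13 * B = 17 * l ^ 2"
    using k by (simp add: power_mult_distrib)
  then have "17 dvd 13 * B"
    by simp
  then have "17 dvd B"
    using prime_dvd_multD[OF int_primes(6)] by fastforce
  moreover have "17 dvd C"
    using dC \<open>d = 17\<close> by simp
  moreover have "C = 35 + B * 6"
    by (simp add: B_def C_def)
  ultimately have "(17 :: int) dvd 35"
    by (metis dvd_add_left_iff dvd_mult2)
  then show False
    by simp
qed

lemma sum_of_squares_dvd_3:
  fixes x y :: int
  assumes "3 dvd x ^ 2 + y ^ 2"
  shows "3 dvd x" "3 dvd y"
proof -
  have "(x ^ 2 mod 3 + y ^ 2 mod 3) mod 3 = 0"
    using assms by (simp add: mod_add_eq dvd_eq_mod_eq_0)
  then show "3 dvd x" "3 dvd y"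
    unfolding square_mod_3 by (auto split: if_splits)
qed

lemma mult_square_mod_5: "(a * x ^ 2) mod 5 = 0 \<or> (a * x ^ 2) mod 5 = a mod 5 \<or> (a * x ^ 2) mod 5 = (a * 4) mod 5"
  for a x :: int
  unfolding mult_mod_mod[of a "x ^ 2"] mult_mod_mod[of a 4] using square_mod_5[of x]
  by (elim disjE conjE) simp_all

lemma mult_square_mod_8: "(a * x ^ 2) mod 8 = 0 \<or> (a * x ^ 2) mod 8 = a mod 8 \<or> (a * x ^ 2) mod 8 = (a * 4) mod 8"
  for a x :: int
  unfolding mult_mod_mod[of a "x ^ 2"] mult_mod_mod[of a 4] using square_mod_8[of x]
  by (elim insertE) simp_all

text \<open>The equation forces 3 to divide \<open>p\<close>, \<open>r\<close>, \<open>p / 3\<close>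
  and \<open>r / 3\<close> in turn; what remains makes a square plus 1 divisible by 3.\<close>

lemma no_3_adic_solution:
  fixes p r :: int
  shows "10 * p ^ 2 + 81 \<noteq> 39 * r ^ 2"
proof
  have three: "3 dvd x" if "3 dvd x ^ 2" for x :: int
    using that prime_dvd_power[OF int_primes(2)] by blast
  assume eq: "10 * p ^ 2 + 81 = 39 * r ^ 2"
  have "p ^ 2 = 3 * (13 * r ^ 2 - 27 - 3 * p ^ 2)"
    using eq by simp
  then have "3 dvd p"
    using three by (metis dvd_triv_left)
  then obtain p1 where p1: "p = 3 * p1"
    by blast
  have eq1: "30 * p1 ^ 2 + 27 = 13 * r ^ 2"
    using eq by (simp add: p1 power_mult_distrib)
  have "r ^ 2 = 3 * (10 * p1 ^ 2 + 9 - 4 * r ^ 2)"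
    using eq1 by simp
  then have "3 dvd r"
    using three by (metis dvd_triv_left)
  then obtain r1 where r1: "r = 3 * r1"
    by blast
  have eq2: "10 * p1 ^ 2 + 9 = 39 * r1 ^ 2"
    using eq1 by (simp add: r1 power_mult_distrib)
  have "p1 ^ 2 = 3 * (13 * r1 ^ 2 - 3 - 3 * p1 ^ 2)"
    using eq2 by simp
  then have "3 dvd p1"
    using three by (metis dvd_triv_left)
  then obtain p2 where p2: "p1 = 3 * p2"
    by blast
  have eq3: "30 * p2 ^ 2 + 3 = 13 * r1 ^ 2"
    using eq2 by (simp add: p2 power_mult_distrib)
  have "r1 ^ 2 = 3 * (10 * p2 ^ 2 + 1 - 4 * r1 ^ 2)"
    using eq3 by simp
  then have "3 dvd r1"
    using three by (metis dvd_triv_left)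
  then obtain r2 where r2: "r1 = 3 * r2"
    by blast
  have "10 * p2 ^ 2 + 1 = 39 * r2 ^ 2"
    using eq3 by (simp add: r2 power_mult_distrib)
  then have "p2 ^ 2 + 1 ^ 2 = 3 * (13 * r2 ^ 2 - 3 * p2 ^ 2)"
    by simp
  then have "3 dvd p2 ^ 2 + 1 ^ 2"
    by (metis dvd_triv_left)
  then have "3 dvd (1 :: int)"
    by (rule sum_of_squares_dvd_3)
  then show False
    by simp
qed

text \<open>The squarefree parts of \<open>A\<close>, \<open>C\<close>, \<open>B\<close> divide 195,
  39 and 15, and residues modulo 8 and 4 restrict the first two. As \<open>d * e * b\<close> is a
  square, only (15, 3, 5) and (39, 39, 1) remain; the first fails modulo 5, the second by
  \<open>no_3_adic_solution\<close>.\<close>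

lemma no_square_6:
  fixes t s :: int
  assumes t: "t \<ge> -1"
  shows "(2 * t + 3) * (56 * t - 321) * (20 * t + 111) \<noteq> s ^ 2"
proof
  define A B C where "A = 56 * t - 321" and "B = 2 * t + 3" and "C = 20 * t + 111"
  assume "(2 * t + 3) * (56 * t - 321) * (20 * t + 111) = s ^ 2"
  then have s: "B * A * C = s ^ 2"
    by (simp add: A_def B_def C_def)
  have pos: "B > 0" "C > 0"
    using t by (simp_all add: B_def C_def)
  have "A > 0"
  proof (rule ccontr)
    assume "\<not> A > 0"
    moreover have "A \<noteq> 0"
      unfolding A_def by presburger
    ultimately have "A * (B * C) < 0"
      using pos by (intro mult_neg_pos) auto
    moreover have "A * (B * C) = s ^ 2"
      using s by (simp only: mult_ac)
    ultimately show False
      by simp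
  qed
  define d q where "d = squarefree_part A" and "q = square_part A"
  define e r where "e = squarefree_part C" and "r = square_part C"
  define b p where "b = squarefree_part B" and "p = square_part B"
  have A: "A = d * q ^ 2" and C: "C = e * r ^ 2" and B: "B = b * p ^ 2"
    unfolding d_def e_def b_def q_def r_def p_def by (rule squarefree_decompose)+
  have pos': "d > 0" "e > 0" "b > 0"
    unfolding d_def e_def b_def using pos \<open>A > 0\<close> by (auto intro: squarefree_part_pos)
  have sqf: "squarefree d" "squarefree e" "squarefree b"
    by (simp_all add: d_def e_def b_def)
  have dvd: "d dvd A" "e dvd C" "b dvd B"
    by (subst A, simp) (subst C, simp, subst B, simp)

  have d: "d = 15 \<or> d = 39"
  proof -
    have "d dvd B * C"
      unfolding d_def by (rule squarefree_part_dvd_of_square_product[where s = s]) (use s in \<open>simp add: mult_ac\<close>)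
    then have "d dvd 405 * 3159"
      by (rule dvd_if_cong_product[OF dvd(1), where a = 28 and u = 1 and c = 14 and v = 5])
        (simp_all add: A_def B_def C_def)
    \<comment> \<open>\<open>405 * 3159 = 3 ^ 9 * 5 * 13\<close>; the exponent 9 covers the power of
      3, and squarefreeness then removes it. The bounds for \<open>e\<close> and \<open>b\<close>
      work in the same way.\<close>
    also have "405 * 3159 dvd (195 ^ 9 :: int)"
      by simp
    finally have "d dvd 195"
      by (rule squarefree_dvd_power[OF sqf(1)])
    then have "d dvd 3 * (5 * 13)"
      by simp
    then have "d \<in> {1, 5, 13, 65, 3, 15, 39, 195}"
    proof (rule dvd_prime_mult_cases[OF int_primes(2)])
      assume "d dvd 5 * 13"
      then show ?thesis
        using pos_dvd_product_of_primes[OF int_primes(3,5) _ pos'(1)] by auto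
    next
      fix d'
      assume d': "d = 3 * d'" "d' dvd 5 * 13"
      then show ?thesis
        using pos_dvd_product_of_primes[OF int_primes(3,5) d'(2)] pos'(1) by auto
    qed
    moreover have "A mod 8 = 7"
      unfolding A_def by presburger
    then have "(d * q ^ 2) mod 8 = 7"
      using A by simp
    then have "d mod 8 = 7 \<or> (d * 4) mod 8 = 7"
      using mult_square_mod_8[of d q] by auto
    ultimately show ?thesis
      by auto
  qed
  have e: "e = 3 \<or> e = 39"
  proof -
    have "e dvd B * A"
      unfolding e_def by (rule squarefree_part_dvd_of_square_product[where s = s]) (use s in \<open>simp add: mult_ac\<close>)
    then have "e dvd (-81) * (-3159)"
      by (rule dvd_if_cong_product[OF dvd(2), where a = 10 and u = 1 and c = 5 and v = 14])
        (simp_all add: A_def B_def C_def)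
    also have "(-81) * (-3159) dvd (39 ^ 9 :: int)"
      by simp
    finally have "e dvd 39"
      by (rule squarefree_dvd_power[OF sqf(2)])
    then have "e \<in> {1, 3, 13, 39}"
      using pos_dvd_product_of_primes[OF int_primes(2,5) _ pos'(2)] by simp
    moreover have "C mod 4 = 3"
      unfolding C_def by presburger
    then have "(e * r ^ 2) mod 4 = 3"
      using C by simp
    then have "e mod 4 = 3"
      using mult_square_mod_4[of e r] by auto
    ultimately show ?thesis
      by auto
  qed
  have b: "b \<in> {1, 3, 5, 15}"
  proof -
    have "b dvd A * C"
      unfolding b_def by (rule squarefree_part_dvd_of_square_product[where s = s]) (use s in \<open>simp add: mult_ac\<close>)
    then have "b dvd (-405) * 81"
      by (rule dvd_if_cong_product[OF dvd(3), where a = 1 and u = 28 and c = 1 and v = 10])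
        (simp_all add: A_def B_def C_def)
    also have "(-405) * 81 dvd (15 ^ 9 :: int)"
      by simp
    finally have "b dvd 15"
      by (rule squarefree_dvd_power[OF sqf(3)])
    then show ?thesis
      using pos_dvd_product_of_primes[OF int_primes(2,3) _ pos'(3)] by simp
  qed
  have "p * q * r \<noteq> 0"
    using A B C \<open>A > 0\<close> pos by auto
  have eq: "(p * q * r) ^ 2 * (d * e * b) = s ^ 2"
    unfolding s[symmetric] by (subst A, subst B, subst C) (simp add: power_mult_distrib mult_ac)
  then have "p * q * r dvd s"
    by (metis dvd_triv_left pow_divides_pow_iff zero_less_numeral)
  then obtain k where "s = (p * q * r) * k"
    by blast
  then have k: "d * e * b = k ^ 2"
    using eq \<open>p * q * r \<noteq> 0\<close> by (simp add: power_mult_distrib)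
  have nonsquares: "45 \<noteq> k ^ 2" "135 \<noteq> k ^ 2" "675 \<noteq> k ^ 2" "585 \<noteq> k ^ 2" "1755 \<noteq> k ^ 2" "2925 \<noteq> k ^ 2" "8775 \<noteq> k ^ 2"
    "117 \<noteq> k ^ 2" "351 \<noteq> k ^ 2" "4563 \<noteq> k ^ 2" "7605 \<noteq> k ^ 2" "22815 \<noteq> k ^ 2"
    by (rule not_square_between[of 6] not_square_between[of 11] not_square_between[of 25]
        not_square_between[of 24] not_square_between[of 41] not_square_between[of 54] not_square_between[of 93]
        not_square_between[of 10] not_square_between[of 18] not_square_between[of 67] not_square_between[of 87]
        not_square_between[of 151]; simp; fail)+
  have "(d, e, b) = (15, 3, 5) \<or> (d, e, b) = (39, 39, 1)"
    using d e b k nonsquares by auto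
  then show False
  proof
    assume "(d, e, b) = (15, 3, 5)"
    then have "C = 3 * r ^ 2"
      using C by simp
    moreover have "C mod 5 = 1"
      unfolding C_def by presburger
    ultimately show False
      using mult_square_mod_5[of 3 r] by auto
  next
    assume "(d, e, b) = (39, 39, 1)"
    then have "C = 39 * r ^ 2" "B = p ^ 2"
      using B C by simp_all
    moreover have "C = 10 * B + 81"
      by (simp add: B_def C_def)
    ultimately show False
      using no_3_adic_solution[of p r] by simp
  qed
qed

section \<open>The curve for n = 3\<close>

lemma three_times_square:
  fixes h z :: int
  assumes "3 * h ^ 2 = z ^ 2"
  shows "h = 0"
proof (rule ccontr)
  assume "h \<noteq> 0"
  then have "z \<noteq> 0"
    using assms by auto
  have p: "prime (3 :: int)"
    by (simp add: prime_int_numeral_eq)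
  have "multiplicity 3 (3 * h ^ 2) = Suc (2 * multiplicity 3 h)"
    using p \<open>h \<noteq> 0\<close> by (simp add: prime_elem_multiplicity_mult_distrib prime_elem_multiplicity_power_distrib)
  moreover have "multiplicity 3 (z ^ 2) = 2 * multiplicity 3 z"
    using p \<open>z \<noteq> 0\<close> by (simp add: prime_elem_multiplicity_power_distrib)
  ultimately show False
    unfolding assms by presburger
qed

lemma square_if_coprime_product:
  fixes a b s :: int
  assumes "a * b = s ^ 2" "coprime a b" "a > 0"
  obtains x where "a = x ^ 2" "x > 0"
proof -
  have "squarefree_part a dvd b"
    by (rule squarefree_part_dvd_of_square_product) fact
  moreover have "squarefree_part a dvd a"
    by (metis dvd_triv_left squarefree_decompose)
  ultimately have "is_unit (squarefree_part a)"
    using assms(2) coprime_common_divisor by blast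
  then have "squarefree_part a = 1"
    using squarefree_part_pos[OF assms(3)] by simp
  then have "a = \<bar>square_part a\<bar> ^ 2"
    using squarefree_decompose[of a] by simp
  moreover have "square_part a \<noteq> 0"
    using assms(3) by auto
  ultimately show ?thesis
    using that[of "\<bar>square_part a\<bar>"] by simp
qed

text \<open>The squarefree part of \<open>a\<close> divides \<open>3 * b\<close> and is coprime to
  \<open>b\<close>, so it divides 3.\<close>

lemma square_or_three_times_square:
  fixes a b h :: int
  assumes "a * b = 3 * h ^ 2" "coprime a b" "a > 0"
  obtains x where "a = x ^ 2" | x where "a = 3 * x ^ 2"
proof -
  have "a * (3 * b) = (3 * h) ^ 2"
    using assms(1) by (simp add: power_mult_distrib)
  then have "squarefree_part a dvd 3 * b"
    by (rule squarefree_part_dvd_of_square_product)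
  moreover have a: "squarefree_part a dvd a"
    by (metis dvd_triv_left squarefree_decompose)
  then have "coprime (squarefree_part a) b"
    using assms(2) by (rule coprime_divisors[OF _ dvd_refl])
  ultimately have "squarefree_part a dvd 3"
    by (simp add: coprime_dvd_mult_left_iff)
  moreover have "0 < squarefree_part a"
    by (rule squarefree_part_pos) fact
  ultimately have "squarefree_part a \<le> 3" "squarefree_part a \<noteq> 2"
    by (auto dest: zdvd_imp_le)
  then have "squarefree_part a = 1 \<or> squarefree_part a = 3"
    using \<open>0 < squarefree_part a\<close> by linarith
  then show ?thesis
  proof
    assume "squarefree_part a = 1"
    then show ?thesis
      using that(1)[of "square_part a"] squarefree_decompose[of a] by simp
  next
    assume "squarefree_part a = 3"
    then show ?thesis
      using that(2)[of "square_part a"] squarefree_decompose[of a] by simp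
  qed
qed

text \<open>The four factors are pairwise coprime, so each is a square or 3 times a square. If
  \<open>k\<close>, \<open>k + l\<close> or \<open>k - l\<close> were 3 times a square, a sum of two
  squares divisible by 3 would contradict coprimality. So these three are squares; \<open>l\<close>
  is not, since \<open>3 * h ^ 2\<close> is not a square, and \<open>l = 3 * y ^ 2\<close> yields a
  new progression.\<close>

lemma congruent_3_descent_step:
  fixes k l h :: int
  assumes kl: "k * l * (k - l) * (k + l) = 3 * h ^ 2" and cop: "coprime k l" and odd: "odd (k + l)"
    and pos: "l > 0" "k > l" "h > 0"
  obtains x y z w where "z ^ 2 + 3 * y ^ 2 = x ^ 2" "x ^ 2 + 3 * y ^ 2 = w ^ 2" "y \<noteq> 0" "\<bar>y\<bar> \<le> h"
proof -
  have not3: False if "3 dvd k" "3 dvd l"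
    using coprime_common_divisor[OF cop that] by simp
  have cop1: "coprime k (k - l)" "coprime k (k + l)" "coprime l (k - l)" "coprime l (k + l)"
  proof -
    have *: "coprime x y" if "\<And>c. c dvd x \<Longrightarrow> c dvd y \<Longrightarrow> c dvd k \<and> c dvd l" for x y
      using that cop by (meson coprimeI coprime_common_divisor)
    show "coprime k (k - l)" "coprime k (k + l)" "coprime l (k - l)" "coprime l (k + l)"
      by (rule *; simp add: dvd_diff_left_iff dvd_diff_right_iff dvd_add_left_iff dvd_add_right_iff)+
  qed
  have cop2: "coprime (k - l) (k + l)"
  proof (rule coprimeI)
    fix c
    assume c: "c dvd k - l" "c dvd k + l"
    have "odd c"
      using c(2) odd dvd_trans by blast
    have "c dvd 2 * k" "c dvd 2 * l"
      using dvd_add[OF c] dvd_diff[OF c(2,1)] by simp_all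
    then have "c dvd k" "c dvd l"
      using \<open>odd c\<close> by (simp_all add: coprime_dvd_mult_right_iff)
    then show "is_unit c"
      using cop coprime_common_divisor by blast
  qed
  have k: "(\<exists>x. k = x ^ 2) \<or> (\<exists>x. k = 3 * x ^ 2)"
    by (rule square_or_three_times_square[of k "l * (k - l) * (k + l)" h])
      (use kl cop cop1 pos in \<open>auto simp: mult_ac\<close>)
  have l: "(\<exists>x. l = x ^ 2) \<or> (\<exists>x. l = 3 * x ^ 2)"
    by (rule square_or_three_times_square[of l "k * (k - l) * (k + l)" h])
      (use kl cop cop1 pos in \<open>auto simp: mult_ac coprime_commute\<close>)
  have m: "(\<exists>x. k - l = x ^ 2) \<or> (\<exists>x. k - l = 3 * x ^ 2)"
    by (rule square_or_three_times_square[of "k - l" "k * l * (k + l)" h])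
      (use kl cop1 cop2 pos in \<open>auto simp: mult_ac coprime_commute\<close>)
  have p: "(\<exists>x. k + l = x ^ 2) \<or> (\<exists>x. k + l = 3 * x ^ 2)"
    by (rule square_or_three_times_square[of "k + l" "k * l * (k - l)" h])
      (use kl cop1 cop2 pos in \<open>auto simp: mult_ac coprime_commute\<close>)
  have not_k: False if "k = 3 * x ^ 2" for x
  proof -
    have 3: "3 dvd k"
      using that by simp
    then have "\<not> 3 dvd l" "\<not> 3 dvd k - l"
      using not3 by (auto simp: dvd_diff_right_iff)
    then obtain y z where "l = y ^ 2" "k - l = z ^ 2"
      using l m by auto
    then have "3 dvd y ^ 2 + z ^ 2"
      using 3 by (metis add.commute diff_add_cancel)
    then have "3 dvd y"
      by (rule sum_of_squares_dvd_3)
    then have "3 dvd l"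
      using \<open>l = y ^ 2\<close> by (simp add: power2_eq_square)
    then show False
      using 3 not3 by blast
  qed
  have not_p: False if "k + l = 3 * w ^ 2" for w
  proof -
    have 3: "3 dvd k + l"
      using that by simp
    then have "\<not> 3 dvd l"
      using not3 by (metis dvd_add_left_iff)
    then have "\<exists>y. l = y ^ 2"
      using l by auto
    then obtain x y where xy: "k = x ^ 2" "l = y ^ 2"
      using not_k k by blast
    then have "3 dvd y"
      using 3 sum_of_squares_dvd_3 by metis
    then show False
      using \<open>\<not> 3 dvd l\<close> xy(2) by (simp add: power2_eq_square)
  qed
  have not_m: False if "k - l = 3 * z ^ 2" for z
  proof -
    have 3: "3 dvd k - l"
      using that by simp
    then have "\<not> 3 dvd l"
      using not3 by (metis dvd_diff_left_iff)
    then have "\<exists>y. l = y ^ 2"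
      using l by auto
    then obtain x y w where xy: "k = x ^ 2" "l = y ^ 2" "k + l = w ^ 2"
      using not_k not_p k p by blast
    have "3 dvd w ^ 2 + y ^ 2"
    proof -
      have "w ^ 2 + y ^ 2 = (k - l) + 3 * l"
        using xy by simp
      then show ?thesis
        using 3 by (simp only: dvd_add dvd_triv_left)
    qed
    then have "3 dvd y"
      by (rule sum_of_squares_dvd_3)
    then show False
      using \<open>\<not> 3 dvd l\<close> xy(2) by (simp add: power2_eq_square)
  qed
  have "\<exists>x. k = x ^ 2" "\<exists>z. k - l = z ^ 2" "\<exists>w. k + l = w ^ 2"
    using k m p not_k not_m not_p by blast+
  then obtain x z w where xzw: "k = x ^ 2" "k - l = z ^ 2" "k + l = w ^ 2"
    by blast
  have "\<not> (\<exists>y. l = y ^ 2)"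
  proof
    assume "\<exists>y. l = y ^ 2"
    then obtain y where "l = y ^ 2"
      by blast
    then have "3 * h ^ 2 = (x * y * z * w) ^ 2"
      unfolding kl[symmetric] xzw(2,3) by (simp add: xzw(1) power_mult_distrib)
    then show False
      using three_times_square pos(3) by fastforce
  qed
  then obtain y where y: "l = 3 * y ^ 2"
    using l by blast
  have "1 * l * 1 * 1 \<le> k * l * (k - l) * (k + l)"
    using pos by (intro mult_mono) auto
  then have "y ^ 2 \<le> h ^ 2"
    unfolding kl by (simp add: y)
  then have "\<bar>y\<bar> \<le> h"
    using pos(3) by (simp add: abs_le_square_iff[symmetric])
  moreover have "y \<noteq> 0"
    using y pos(1) by auto
  moreover have "z ^ 2 + 3 * y ^ 2 = x ^ 2" "x ^ 2 + 3 * y ^ 2 = w ^ 2"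
    using xzw y by simp_all
  ultimately show ?thesis
    using that by blast
qed

text \<open>The triple is parametrised as \<open>m = k ^ 2 - l ^ 2\<close>,
  \<open>n = 2 * k * l\<close>, \<open>r = k ^ 2 + l ^ 2\<close>, which turns the area condition
  into the product equation of \<open>congruent_3_descent_step\<close>.\<close>

lemma congruent_3_pythagorean:
  fixes m n h r :: int
  assumes "m * n = 6 * h ^ 2" "m ^ 2 + n ^ 2 = r ^ 2" "coprime m n" "odd m" "even n"
    and pos: "m > 0" "n > 0" "h > 0" "r > 0"
  obtains x y z w where "z ^ 2 + 3 * y ^ 2 = x ^ 2" "x ^ 2 + 3 * y ^ 2 = w ^ 2" "y \<noteq> 0" "\<bar>y\<bar> \<le> h"
proof -
  obtain n' where n': "n = 2 * n'"
    using \<open>even n\<close> by blast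
  have "odd (r ^ 2)"
    using assms(4,5) by (simp flip: assms(2))
  then have "odd r"
    by simp
  then have "even (r + m)" "even (r - m)"
    using \<open>odd m\<close> by simp_all
  then obtain a b where ab: "r + m = 2 * a" "r - m = 2 * b"
    by (elim evenE)
  then have r: "r = a + b" and m: "m = a - b"
    by simp_all
  have "4 * (a * b) = (r + m) * (r - m)"
    by (simp add: ab)
  also have "\<dots> = r ^ 2 - m ^ 2"
    by (simp add: algebra_simps power2_eq_square)
  also have "\<dots> = 4 * n' ^ 2"
    by (simp flip: assms(2)) (simp add: n' power_mult_distrib)
  finally have sq: "a * b = n' ^ 2"
    by simp
  have "coprime a b"
  proof (rule coprimeI)
    fix c
    assume c: "c dvd a" "c dvd b"
    then have "c dvd m" "c dvd r"
      by (simp_all add: m r)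
    then have "c dvd r ^ 2 - m ^ 2"
      by (simp add: power2_eq_square)
    then have "c dvd n ^ 2"
      by (simp flip: assms(2))
    moreover have "coprime m (n ^ 2)"
      using assms(3) by simp
    ultimately show "is_unit c"
      using \<open>c dvd m\<close> coprime_common_divisor by blast
  qed
  have "m < r"
  proof -
    have "m ^ 2 < r ^ 2"
      using pos by (simp flip: assms(2))
    then show ?thesis
      using pos(4) by (simp add: power2_less_imp_less)
  qed
  then have "b > 0" "a > b"
    using ab pos m by auto
  obtain k where k: "a = k ^ 2" "k > 0"
    using square_if_coprime_product[OF sq \<open>coprime a b\<close>] \<open>b > 0\<close> \<open>a > b\<close> by auto
  obtain l where l: "b = l ^ 2" "l > 0"
    using square_if_coprime_product[of b a n'] sq \<open>coprime a b\<close> \<open>b > 0\<close>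
    by (auto simp: mult.commute coprime_commute)
  have "n' ^ 2 = (k * l) ^ 2"
    using sq by (simp add: k l power_mult_distrib)
  then have "n' = k * l"
    using pos(2) k(2) l(2) n' by (simp add: power2_eq_iff_nonneg)
  have "k * l * (k - l) * (k + l) = m * n'"
    by (simp add: m k l \<open>n' = k * l\<close> algebra_simps power2_eq_square)
  also have "\<dots> = 3 * h ^ 2"
    using assms(1) by (simp add: n')
  finally have kl: "k * l * (k - l) * (k + l) = 3 * h ^ 2" .
  show ?thesis
  proof (rule congruent_3_descent_step[OF kl])
    show "coprime k l"
      using \<open>coprime a b\<close> by (simp add: k l)
    show "odd (k + l)"
      using \<open>odd m\<close> by (simp add: m k l)
    show "k > l"
      using \<open>a > b\<close> k l by (simp add: power2_less_imp_less)
  qed (use pos l that in auto)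
qed

text \<open>Fermat's descent on the size of \<open>g\<close>. After removing common factors, half
  the sum and half the difference of the outer roots are the legs of a primitive right triangle with
  hypotenuse \<open>r\<close>; its area is 3 times the square of \<open>g / 2\<close>.\<close>

lemma squares_in_progression_3:
  fixes f g r u :: int
  assumes "f ^ 2 + 3 * g ^ 2 = r ^ 2" "r ^ 2 + 3 * g ^ 2 = u ^ 2"
  shows "g = 0"
  using assms
proof (induction "nat \<bar>g\<bar>" arbitrary: f g r u rule: less_induct)
  case less
  show ?case
  proof (rule ccontr)
    assume "g \<noteq> 0"
    have "r \<noteq> 0"
    proof
      assume "r = 0"
      then have "f ^ 2 + 3 * g ^ 2 = 0"
        using less.prems(1) by simp
      moreover have "g ^ 2 > 0" "f ^ 2 \<ge> 0"
        using \<open>g \<noteq> 0\<close> by simp_all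
      ultimately show False
        by linarith
    qed
    show False
    proof (cases "coprime r g")
      case False
      define c where "c = gcd r g"
      obtain r' g' where rg: "r = c * r'" "g = c * g'"
        unfolding c_def by (meson dvdE gcd_dvd1 gcd_dvd2)
      have "c > 1"
      proof -
        have "c > 0" "c \<noteq> 1"
          using \<open>g \<noteq> 0\<close> False by (simp_all add: c_def coprime_iff_gcd_eq_1)
        then show ?thesis
          by linarith
      qed
      have "f ^ 2 = c ^ 2 * (r' ^ 2 - 3 * g' ^ 2)" "u ^ 2 = c ^ 2 * (r' ^ 2 + 3 * g' ^ 2)"
        using less.prems by (simp_all add: rg power_mult_distrib algebra_simps)
      then have "c ^ 2 dvd f ^ 2" "c ^ 2 dvd u ^ 2"
        by simp_all
      then have "c dvd f" "c dvd u"
        by simp_all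
      then obtain f' u' where fu: "f = c * f'" "u = c * u'"
        by blast
      have "c ^ 2 * (f' ^ 2 + 3 * g' ^ 2) = c ^ 2 * r' ^ 2" "c ^ 2 * (r' ^ 2 + 3 * g' ^ 2) = c ^ 2 * u' ^ 2"
        using less.prems by (simp_all add: rg fu power_mult_distrib algebra_simps)
      then have "f' ^ 2 + 3 * g' ^ 2 = r' ^ 2" "r' ^ 2 + 3 * g' ^ 2 = u' ^ 2"
        using \<open>c > 1\<close> by simp_all
      moreover have "nat \<bar>g'\<bar> < nat \<bar>g\<bar>"
        using \<open>c > 1\<close> \<open>g \<noteq> 0\<close> by (simp add: rg abs_mult)
      ultimately have "g' = 0"
        using less.hyps by blast
      then show False
        using \<open>g \<noteq> 0\<close> rg by simp
    next
      case True
      \<comment> \<open>For odd \<open>g\<close> the roots \<open>u\<close> and \<open>f\<close>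
        would have equal parity, making \<open>u ^ 2 - f ^ 2 = 6 * g ^ 2\<close> divisible by
        4.\<close>
      have "even g"
      proof (rule ccontr)
        assume "odd g"
        then have "even (u + f)" "even (u - f)"
          using arg_cong[OF less.prems(1), of even] arg_cong[OF less.prems(2), of even] by auto
        then obtain a b where "u + f = 2 * a" "u - f = 2 * b"
          by (elim evenE)
        then have "4 * (a * b) = (u + f) * (u - f)"
          by simp
        also have "\<dots> = u ^ 2 - f ^ 2"
          by (simp add: algebra_simps power2_eq_square)
        also have "\<dots> = 2 * (3 * g ^ 2)"
          using less.prems by simp
        finally have "3 * g ^ 2 = 2 * (a * b)"
          by simp
        then have "even (3 * g ^ 2)"
          by simp
        then show False
          using \<open>odd g\<close> by simp
      qed
      then have "odd r"
        using coprime_common_divisor[OF True, of 2] by auto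
      have "even (\<bar>g\<bar>)"
        using \<open>even g\<close> by simp
      then obtain h where h: "\<bar>g\<bar> = 2 * h"
        by blast
      have "h > 0"
        using h \<open>g \<noteq> 0\<close> by linarith
      have g2: "g ^ 2 = 4 * h ^ 2"
      proof -
        have "g ^ 2 = \<bar>g\<bar> ^ 2"
          by simp
        also have "\<dots> = 4 * h ^ 2"
          unfolding h by (simp add: power_mult_distrib)
        finally show ?thesis .
      qed
      have "f ^ 2 = r ^ 2 - 2 * (6 * h ^ 2)" "u ^ 2 = r ^ 2 + 2 * (6 * h ^ 2)"
        using less.prems g2 by simp_all
      then have "odd (f ^ 2)" "odd (u ^ 2)"
        using \<open>odd r\<close> by simp_all
      then have "even (\<bar>u\<bar> + \<bar>f\<bar>)" "even (\<bar>u\<bar> - \<bar>f\<bar>)"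
        by simp_all
      then obtain m n where mn: "\<bar>u\<bar> + \<bar>f\<bar> = 2 * m" "\<bar>u\<bar> - \<bar>f\<bar> = 2 * n"
        by (elim evenE)
      have u: "\<bar>u\<bar> = m + n" and f: "\<bar>f\<bar> = m - n"
        using mn by linarith+
      have u2: "u ^ 2 = (m + n) ^ 2" and f2: "f ^ 2 = (m - n) ^ 2"
        by (simp_all flip: u f)
      have "4 * (m * n) = u ^ 2 - f ^ 2"
        unfolding u2 f2 by (simp add: algebra_simps power2_eq_square)
      also have "\<dots> = 4 * (6 * h ^ 2)"
        using less.prems g2 by simp
      finally have prod: "m * n = 6 * h ^ 2"
        by simp
      have "2 * (m ^ 2 + n ^ 2) = u ^ 2 + f ^ 2"
        unfolding u2 f2 by (simp add: algebra_simps power2_eq_square)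
      also have "\<dots> = 2 * r ^ 2"
        using less.prems by simp
      finally have sum: "m ^ 2 + n ^ 2 = r ^ 2"
        by simp
      \<comment> \<open>A common prime \<open>p\<close> of the legs divides \<open>r\<close>, hence
        not \<open>h\<close>; but \<open>p ^ 2\<close> divides \<open>6 * h ^ 2\<close>, hence 6,
        which is impossible.\<close>
      have cop: "coprime m n"
      proof (rule ccontr)
        assume "\<not> coprime m n"
        then have "\<not> is_unit (gcd m n)" "gcd m n \<noteq> 0"
          using prod \<open>h > 0\<close> by (auto simp: coprime_iff_gcd_eq_1)
        then obtain p where p: "prime p" "p dvd gcd m n"
          using prime_divisor_exists by blast
        then have pm: "p dvd m" "p dvd n"
          by simp_all
        then have "p dvd m ^ 2 + n ^ 2"
          by (simp add: power2_eq_square)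
        then have "p dvd r ^ 2"
          by (simp only: sum)
        then have "p dvd r"
          using p(1) prime_dvd_power by blast
        have "p * p dvd 6 * h ^ 2"
          unfolding prod[symmetric] using pm by (rule mult_dvd_mono)
        have "\<not> p dvd h"
        proof
          assume "p dvd h"
          then have "p dvd g"
            using h by (metis dvd_abs_iff dvd_mult)
          then show False
            using True \<open>p dvd r\<close> p(1) coprime_common_divisor not_prime_unit by blast
        qed
        then have "coprime (p * p) (h ^ 2)"
          using p(1) prime_imp_coprime by auto
        then have "p * p dvd 6"
          using \<open>p * p dvd 6 * h ^ 2\<close> by (simp add: coprime_dvd_mult_left_iff)
        moreover have "p \<ge> 2"
          using p(1) by (rule prime_ge_2_int)
        moreover have "p < 3"
        proof (rule ccontr)
          assume "\<not> p < 3"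
          then have "3 * 3 \<le> p * p"
            by (intro mult_mono) auto
          then show False
            using zdvd_imp_le[OF \<open>p * p dvd 6\<close>] by simp
        qed
        ultimately show False
          by (cases "p = 2") auto
      qed
      have "0 < m * n"
        using prod \<open>h > 0\<close> by simp
      moreover have "0 \<le> m + n" "0 \<le> m - n"
        using u f by simp_all
      ultimately have "m > 0" "n > 0"
        by (auto simp: zero_less_mult_iff)
      have "odd (m ^ 2 + n ^ 2)"
        unfolding sum using \<open>odd r\<close> by simp
      then consider "odd m" "even n" | "odd n" "even m"
        by auto
      then obtain x y z w where "z ^ 2 + 3 * y ^ 2 = x ^ 2" "x ^ 2 + 3 * y ^ 2 = w ^ 2" "y \<noteq> 0" "\<bar>y\<bar> \<le> h"
      proof cases
        case 1
        show ?thesis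
          by (rule congruent_3_pythagorean[of m n h "\<bar>r\<bar>"])
            (use 1 prod sum cop \<open>m > 0\<close> \<open>n > 0\<close> \<open>h > 0\<close> \<open>r \<noteq> 0\<close> that in auto)
      next
        case 2
        show ?thesis
          by (rule congruent_3_pythagorean[of n m h "\<bar>r\<bar>"])
            (use 2 prod sum cop \<open>m > 0\<close> \<open>n > 0\<close> \<open>h > 0\<close> \<open>r \<noteq> 0\<close> that
             in \<open>auto simp: mult.commute add.commute coprime_commute\<close>)
      qed
      moreover from this have "nat \<bar>y\<bar> < nat \<bar>g\<bar>"
        using h \<open>h > 0\<close> by simp
      ultimately show False
        using less.hyps by blast
    qed
  qed
qed

section \<open>Rational squares in progression with difference 3, and the fourth zero\<close>

lemma rat_square_quotient:
  fixes x y :: rat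
  assumes "y ^ 2 = a ^ 2 * x" "a \<noteq> 0"
  shows "x = (y / a) ^ 2"
  using assms by (simp add: power_divide)

text \<open>After clearing denominators, \<open>U\<close> and \<open>V\<close> share a squarefree
  part dividing both \<open>2 * U - V = f ^ 2\<close> and \<open>V - U = 3 * g ^ 2\<close>, so it is
  1 or 3. The value 1 gives an excluded progression of integer squares; 3 forces 3 to divide both
  \<open>f\<close> and \<open>g\<close>.\<close>

lemma no_rational_squares_3:
  fixes q v w :: rat
  assumes "q - 3 = v ^ 2" "q * (q + 3) = w ^ 2"
  shows False
proof -
  obtain f g where fg: "quotient_of v = (f, g)"
    by fastforce
  then have g: "g > 0" "coprime f g" and v: "v = of_int f / of_int g"
    by (auto intro: quotient_of_denom_pos quotient_of_coprime quotient_of_div)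
  define U V where "U = f ^ 2 + 3 * g ^ 2" and "V = f ^ 2 + 6 * g ^ 2"
  have q: "q * of_int g ^ 2 = of_int U" "(q + 3) * of_int g ^ 2 = of_int V"
  proof -
    have "q = of_int f ^ 2 / of_int g ^ 2 + 3"
      using assms(1) by (simp add: v power_divide)
    then have "q * of_int g ^ 2 = of_int f ^ 2 + 3 * of_int g ^ 2"
      using g(1) by (simp add: distrib_right)
    then show "q * of_int g ^ 2 = of_int U" "(q + 3) * of_int g ^ 2 = of_int V"
      by (simp_all add: U_def V_def distrib_right)
  qed
  have "(w * of_int g ^ 2) ^ 2 = w ^ 2 * (of_int g ^ 2 * of_int g ^ 2)"
    by (simp add: power2_eq_square)
  also have "\<dots> = (q * of_int g ^ 2) * ((q + 3) * of_int g ^ 2)"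
    unfolding assms(2)[symmetric] by (simp only: mult_ac)
  finally have "(w * of_int g ^ 2) ^ 2 = of_int (U * V)"
    unfolding q by (simp only: of_int_mult)
  then obtain s where s: "U * V = s ^ 2"
    by (rule int_square_if_rat_square)
  have "U > 0" "V > 0"
    using zero_less_power[OF g(1), of 2] zero_le_power2[of f] unfolding U_def V_def by linarith+
  define d r where "d = squarefree_part U" and "r = square_part U"
  have U: "U = d * r ^ 2"
    unfolding d_def r_def by (rule squarefree_decompose)
  obtain u where V: "V = d * u ^ 2"
    using squarefree_part_of_square_product[OF s] \<open>U > 0\<close> unfolding d_def by auto
  have "d > 0"
    unfolding d_def by (rule squarefree_part_pos) fact
  have "d dvd U" "d dvd V"
    by (simp_all add: U V)
  have "2 * U - V = f ^ 2" "V - U = 3 * g ^ 2"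
    by (simp_all add: U_def V_def)
  then have df: "d dvd f ^ 2" "d dvd 3 * g ^ 2"
    using \<open>d dvd U\<close> \<open>d dvd V\<close> by (metis dvd_diff dvd_mult)+
  have "coprime (f ^ 2) (g ^ 2)"
    using g(2) by simp
  then have "coprime d (g ^ 2)"
    using df(1) by (rule coprime_divisors[OF _ dvd_refl, rotated])
  then have "d dvd 3 * 1"
    using df(2) by (simp add: coprime_dvd_mult_left_iff)
  then have "d = 1 \<or> d = 3"
    using \<open>d > 0\<close> by (elim dvd_prime_mult_cases[OF int_primes(2)]) (auto simp: zero_less_mult_iff)
  then show False
  proof
    assume "d = 1"
    then have "f ^ 2 + 3 * g ^ 2 = r ^ 2" "r ^ 2 + 3 * g ^ 2 = u ^ 2"
      using U V by (simp_all add: U_def V_def)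
    then show False
      using squares_in_progression_3 g(1) by fastforce
  next
    assume "d = 3"
    then have "3 dvd f"
      using df(1) prime_dvd_power[OF int_primes(2)] by blast
    then obtain f' where "f = 3 * f'"
      by blast
    then have "3 * (3 * f' ^ 2 + 2 * g ^ 2) = 3 * u ^ 2"
      using V \<open>d = 3\<close> by (simp add: V_def power_mult_distrib)
    then have "u ^ 2 + g ^ 2 = 3 * (f' ^ 2 + g ^ 2)"
      by simp
    then have "3 dvd g"
      using sum_of_squares_dvd_3(2) by (metis dvd_triv_left)
    then show False
      using \<open>3 dvd f\<close> g(2) coprime_common_divisor[of f g 3] by simp
  qed
qed

text \<open>Evaluation at the zeros 1, 4 and -2 of the curve polynomial gives squares on the left.
  The cubic takes the same value at 1 and -2, so the norm condition says that \<open>A\<close> is a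
  square, and the zero of the cofactor contradicts \<open>no_rational_squares_3\<close>. Only a
  constant cofactor leaves room for \<open>t\<close>.\<close>

lemma curve_point_3:
  assumes pt: "Affine (theta t - 1) y \<in> curve_points 3 (cubic_field t)" and "t \<ge> -1"
  shows "t = 3 \<or> t = 39"
proof -
  obtain a b c :: rat where eq: "\<And>x :: rat. (a + b * x + c * x ^ 2) ^ 2 - ((x - 1) ^ 3 - of_nat 3 ^ 2 * (x - 1)) =
      (x ^ 3 - of_int t * x ^ 2 - (of_int t + 3) * x - 1) * (2 * b * c - 1 + of_int t * c ^ 2 + c ^ 2 * x)"
    using curve_point_coefficients[OF pt] by metis
  define A B :: rat where "A = 20 * of_int t - 51" and "B = 2 * of_int t + 3"
  define h where "h x = 2 * b * c - 1 + of_int t * c ^ 2 + c ^ 2 * x" for x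
  have e1: "(a + b + c) ^ 2 = - B * h 1" and e4: "(a + 4 * b + 16 * c) ^ 2 = - A * h 4"
    and e2: "(a - 2 * b + 4 * c) ^ 2 = - B * h (-2)"
    using eq[of 1] eq[of 4] eq[of "-2"] by (simp_all add: A_def B_def h_def algebra_simps)
  have "B = of_int (2 * t + 3)" "A = of_int (20 * t - 51)"
    by (simp_all add: A_def B_def)
  moreover have "2 * t + 3 \<noteq> 0" "20 * t - 51 \<noteq> 0"
    by presburger+
  ultimately have "B \<noteq> 0" "A \<noteq> 0"
    by (simp_all only: of_int_eq_0_iff not_False_eq_True)
  show ?thesis
  proof (cases "c = 0")
    case True
    \<comment> \<open>For \<open>c = 0\<close> the cofactor is the constant -1, and a linear
      polynomial has equal squares at 1 and -2.\<close>
    then have "(a + b) ^ 2 = B" "(a + 4 * b) ^ 2 = A" "(a - 2 * b) ^ 2 = B"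
      using e1 e4 e2 by (simp_all add: h_def)
    then have "(a + b) ^ 2 - (a - 2 * b) ^ 2 = 0"
      by simp
    then have "(3 * b) * (2 * a - b) = 0"
      by (simp add: algebra_simps power2_eq_square)
    then consider "b = 0" | "b = 2 * a"
      by auto
    then show ?thesis
    proof cases
      case 1
      then have "A = B"
        using \<open>(a + b) ^ 2 = B\<close> \<open>(a + 4 * b) ^ 2 = A\<close> by simp
      then have "of_int (18 * t) = (of_int 54 :: rat)"
        by (simp add: A_def B_def)
      then show ?thesis
        by (simp only: of_int_eq_iff) simp
    next
      case 2
      then have "A = 9 * B"
        using \<open>(a + b) ^ 2 = B\<close> \<open>(a + 4 * b) ^ 2 = A\<close> by (simp add: power2_eq_square algebra_simps)
      then have "of_int (2 * t) = (of_int 78 :: rat)"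
        by (simp add: A_def B_def)
      then show ?thesis
        by (simp only: of_int_eq_iff) simp
    qed
  next
    case False
    \<comment> \<open>\<open>q + 1\<close> is the zero of the cofactor, the fourth zero of the
      left-hand side of \<open>eq\<close>.\<close>
    define q where "q = - (2 * b * c - 1 + of_int t * c ^ 2) / c ^ 2 - 1"
    have h: "h x = c ^ 2 * (x - 1 - q)" for x
      using False by (simp add: h_def q_def field_simps)
    \<comment> \<open>For \<open>n = 3\<close> the norm condition reads
      \<open>B ^ 2 * A = s ^ 2\<close>.\<close>
    obtain s :: int where "(2 * t + 3) * ((3 + 1) * (3 + 2) * t - 3 ^ 3 - 3 * 3 ^ 2 + 3)
      * ((3 - 1) * (3 - 2) * t + 3 ^ 3 - 3 * 3 ^ 2 + 3) = s ^ 2"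
      using norm_is_square[OF pt] by auto
    then have "of_int (s ^ 2) = (of_int ((2 * t + 3) ^ 2 * (20 * t - 51)) :: rat)"
      by (simp add: power2_eq_square mult_ac)
    then have "A = (of_int s / B) ^ 2"
      using \<open>B \<noteq> 0\<close> by (simp add: A_def B_def power_divide)
    then obtain z where z: "A = z ^ 2" "z \<noteq> 0"
      using \<open>A \<noteq> 0\<close> by fastforce
    have "(a + 4 * b + 16 * c) ^ 2 = (z * c) ^ 2 * (q - 3)"
      using e4 by (simp add: h z(1) algebra_simps)
    then have "q - 3 = ((a + 4 * b + 16 * c) / (z * c)) ^ 2"
      by (rule rat_square_quotient) (use False z in simp)
    moreover have "((a + b + c) * (a - 2 * b + 4 * c)) ^ 2 = (B * c ^ 2) ^ 2 * (q * (q + 3))"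
      unfolding power_mult_distrib e1 e2 by (simp add: h power2_eq_square algebra_simps)
    then have "q * (q + 3) = (((a + b + c) * (a - 2 * b + 4 * c)) / (B * c ^ 2)) ^ 2"
      by (rule rat_square_quotient) (use False \<open>B \<noteq> 0\<close> in simp)
    ultimately show ?thesis
      using no_rational_squares_3 by blast
  qed
qed

section \<open>The cases n = 5 and n = 6, and finiteness for each n\<close>

theorem theorem3:
  shows "(\<forall>t::int. t \<ge> -1 \<longrightarrow>
            \<not> (\<exists>y. Affine (theta t - 1) y \<in> curve_points 5 (cubic_field t)) \<and>
            \<not> (\<exists>y. Affine (theta t - 1) y \<in> curve_points 6 (cubic_field t))) \<and>
         (\<forall>n::nat. n > 0 \<longrightarrow>
            finite {t::int. t \<ge> -1 \<and>
              (\<exists>y. Affine (theta t - 1) y \<in> curve_points n (cubic_field t))})"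
proof (intro conjI allI impI notI)
  fix t :: int
  assume "t \<ge> -1" "\<exists>y. Affine (theta t - 1) y \<in> curve_points 5 (cubic_field t)"
  then obtain y where pt: "Affine (theta t - 1) y \<in> curve_points 5 (cubic_field t)"
    by blast
  obtain s where "(2 * t + 3) * ((int 5 + 1) * (int 5 + 2) * t - int 5 ^ 3 - 3 * int 5 ^ 2 + 3)
      * ((int 5 - 1) * (int 5 - 2) * t + int 5 ^ 3 - 3 * int 5 ^ 2 + 3) = s ^ 2"
    by (rule norm_is_square[OF pt])
  then have "(2 * t + 3) * (42 * t - 197) * (12 * t + 53) = s ^ 2"
    by (simp add: algebra_simps)
  then show False
    using no_square_5 \<open>t \<ge> -1\<close> curve_point_5_not_dvd[OF pt] by blast
next
  fix t :: int
  assume "t \<ge> -1" "\<exists>y. Affine (theta t - 1) y \<in> curve_points 6 (cubic_field t)"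
  then obtain y where pt: "Affine (theta t - 1) y \<in> curve_points 6 (cubic_field t)"
    by blast
  obtain s where "(2 * t + 3) * ((int 6 + 1) * (int 6 + 2) * t - int 6 ^ 3 - 3 * int 6 ^ 2 + 3)
      * ((int 6 - 1) * (int 6 - 2) * t + int 6 ^ 3 - 3 * int 6 ^ 2 + 3) = s ^ 2"
    by (rule norm_is_square[OF pt])
  then have "(2 * t + 3) * (56 * t - 321) * (20 * t + 111) = s ^ 2"
    by (simp add: algebra_simps)
  then show False
    using no_square_6 \<open>t \<ge> -1\<close> by blast
next
  fix n :: nat
  assume "n > 0"
  let ?T = "{t::int. t \<ge> -1 \<and> (\<exists>y. Affine (theta t - 1) y \<in> curve_points n (cubic_field t))}"
  consider "n \<le> 2" | "n = 3" | "n \<ge> 4"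
    by linarith
  then show "finite ?T"
  proof cases
    case 1
    then have "?T = {}"
      using no_curve_point_if_le_2 by blast
    then show ?thesis
      by (simp only: finite.emptyI)
  next
    case 2
    then have "?T \<subseteq> {3, 39}"
      using curve_point_3 by blast
    then show ?thesis
      by (rule finite_subset) simp
  next
    case 3
    define m where "m = int n"
    have m: "m \<ge> 4"
      using 3 by (simp add: m_def)
    define A B :: "nat \<Rightarrow> int" where
      "A i = (if i = 0 then 2 else if i = 1 then (m + 1) * (m + 2) else (m - 1) * (m - 2))" and
      "B i = (if i = 0 then 3 else if i = 1 then 3 - 3 * m ^ 2 - m ^ 3 else m ^ 3 - 3 * m ^ 2 + 3)" for i
    have less_3: "i = 0 \<or> i = 1 \<or> i = 2" if "i < 3" for i :: nat
      using that by linarith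
    have "A i > 0" for i
      using m by (simp add: A_def)
    moreover have "A i * B j \<noteq> A j * B i" if "i < 3" "j < 3" "i \<noteq> j" for i j
    proof -
      \<comment> \<open>The factor \<open>m - 3\<close> in the second determinant is why
        \<open>n = 3\<close> is treated apart: there the forms with index 0 and 2 coincide.\<close>
      have "A 1 * B 0 - A 0 * B 1 = m * (2 * m + 3) * (m + 3)"
        "A 0 * B 2 - A 2 * B 0 = m * (2 * m - 3) * (m - 3)"
        by (simp_all add: A_def B_def algebra_simps power2_eq_square power3_eq_cube)
      then have 01: "A 0 * B 1 \<noteq> A 1 * B 0" and 02: "A 0 * B 2 \<noteq> A 2 * B 0"
        using m by auto
      have "4 * 4 \<le> m * m"
        using m by (intro mult_mono) auto
      then have "m ^ 2 * (m ^ 2 - 7) > 0"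
        using m by (intro mult_pos_pos) (auto simp: power2_eq_square)
      moreover have "A 1 * B 2 - A 2 * B 1 = 2 * m * (m ^ 2 * (m ^ 2 - 7) + 9)"
        by (simp add: A_def B_def algebra_simps power2_eq_square power3_eq_cube)
      ultimately have 12: "A 1 * B 2 \<noteq> A 2 * B 1"
        using m by auto
      show ?thesis
        using 01 02 12 less_3[OF that(1)] less_3[OF that(2)] that(3) by (elim disjE) (metis+)
    qed
    ultimately have fin: "finite {t. t \<ge> 0 \<and> (\<exists>s. (\<Prod>i<3. A i * t + B i) = s ^ 2)}"
      by (rule finite_square_values)
    \<comment> \<open>\<open>finite_square_values\<close> covers \<open>t \<ge> 0\<close>, so the
      value -1 is put aside.\<close>
    have "?T \<subseteq> insert (-1) {t. t \<ge> 0 \<and> (\<exists>s. (\<Prod>i<3. A i * t + B i) = s ^ 2)}"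
    proof
      fix t
      assume "t \<in> ?T"
      then obtain y where t: "t \<ge> -1" and pt: "Affine (theta t - 1) y \<in> curve_points n (cubic_field t)"
        by blast
      obtain s :: int where "(2 * t + 3) * ((m + 1) * (m + 2) * t - m ^ 3 - 3 * m ^ 2 + 3)
          * ((m - 1) * (m - 2) * t + m ^ 3 - 3 * m ^ 2 + 3) = s ^ 2"
        unfolding m_def by (rule norm_is_square[OF pt])
      moreover have "(\<Prod>i<3. A i * t + B i) = (A 0 * t + B 0) * (A 1 * t + B 1) * (A 2 * t + B 2)"
        by (simp add: numeral_3_eq_3 numeral_2_eq_2)
      moreover have "A 0 * t + B 0 = 2 * t + 3"
        "A 1 * t + B 1 = (m + 1) * (m + 2) * t - m ^ 3 - 3 * m ^ 2 + 3"
        "A 2 * t + B 2 = (m - 1) * (m - 2) * t + m ^ 3 - 3 * m ^ 2 + 3"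
        by (simp_all add: A_def B_def)
      ultimately have "(\<Prod>i<3. A i * t + B i) = s ^ 2"
        by (simp only:)
      then show "t \<in> insert (-1) {t. t \<ge> 0 \<and> (\<exists>s. (\<Prod>i<3. A i * t + B i) = s ^ 2)}"
        using t by force
    qed
    then show ?thesis
      using fin by (meson finite.insertI finite_subset)
  qed
qed

end
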